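(* Let $n\ge 2$. A subset $A\subseteq\mathfrak{S}_n$ is cyclic Schur-positive if and only if it is Schur-positive and $\mathrm{cDes}$-invariant.
   Context: For $\pi\in\mathfrak{S}_n$ (one-line notation), $\mathrm{Des}(\pi)=\{i\in[n-1]:\pi(i)>\pi(i+1)\}$ and $\mathrm{cDes}(\pi)=\{i\in[n]:\pi(i)>\pi(i+1)\}$ with $\pi(n+1):=\pi(1)$. For $J\subseteq[n]$, $\mathbf{x}^J=\prod_{i\in J}x_i$, and $i+J=\{i+j\bmod n:j\in J\}\subseteq[n]$. Schur-positive: with $\mathcal{F}_{n,D}=\sum x_{i_1}\cdots x_{i_n}$ over $i_1\le\cdots\le i_n$ with $i_j<i_{j+1}$ whenever $j\in D$ (Gessel's fundamental quasisymmetric function), $A$ is Schur-positive if $\sum_{\pi\in A}\mathcal{F}_{n,\mathrm{Des}(\pi)}$ is symmetric with nonnegative coefficients in the Schur basis. $\mathrm{cDes}$-invariant: there is a bijection $\psi:A\to A$ with $\mathrm{cDes}(\psi\pi)=1+\mathrm{cDes}(\pi)$ for all $\pi\in A$. Cyclic Schur-positive: for a skew shape $\lambda/\mu$ with $n$ cells, $\mathrm{Des}(T)$ of $T\in\mathrm{SYT}(\lambda/\mu)$ is the set of $i\in[n-1]$ with $i+1$ in a strictly lower row than $i$. A cyclic descent extension on $\mathrm{SYT}(\lambda/\mu)$ is a pair $(\mathrm{cDes},\psi)$, $\mathrm{cDes}:\mathrm{SYT}(\lambda/\mu)\to2^{[n]}$, $\psi$ a bijection, with $\mathrm{cDes}(T)\cap[n-1]=\mathrm{Des}(T)$,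 $\mathrm{cDes}(\psi T)=1+\mathrm{cDes}(T)$, $\emptyset\ne\mathrm{cDes}(T)\ne[n]$; it exists iff $\lambda/\mu$ is not a connected ribbon, and $\sum_T\mathbf{x}^{\mathrm{cDes}(T)}$ is then independent of the choice. $A$ is cyclic Schur-positive if there are nonnegative integers $m_{\lambda/\mu}$ (over skew shapes with $n$ cells that are not connected ribbons) with $\sum_{\pi\in A}\mathbf{x}^{\mathrm{cDes}(\pi)}=\sum m_{\lambda/\mu}\sum_{T\in\mathrm{SYT}(\lambda/\mu)}\mathbf{x}^{\mathrm{cDes}(T)}$. *)

theory Defs
  imports Complex_Main "HOL-Combinatorics.Permutations" "HOL-Library.Multiset"
begin

text \<open>Permutations of [n] are functions nat => nat that permute {1..n} (one-line
notation: pi(1),...,pi(n)).\<close>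

definition Des_perm :: "nat \<Rightarrow> (nat \<Rightarrow> nat) \<Rightarrow> nat set" where
  "Des_perm n \<pi> = {i \<in> {1..n-1}. \<pi> i > \<pi> (i+1)}"

definition cDes_perm :: "nat \<Rightarrow> (nat \<Rightarrow> nat) \<Rightarrow> nat set" where
  "cDes_perm n \<pi> = {i \<in> {1..n}. \<pi> i > \<pi> (if i = n then 1 else i+1)}"

text \<open>The cyclic shift 1 + J inside [n] (residue 0 mod n is read as n).\<close>
definition cshift :: "nat \<Rightarrow> nat set \<Rightarrow> nat set" where
  "cshift n J = (\<lambda>j. j mod n + 1) ` J"

definition cDes_invariant :: "nat \<Rightarrow> (nat \<Rightarrow> nat) set \<Rightarrow> bool" where
  "cDes_invariant n A \<longleftrightarrow>
     (\<exists>\<psi>. bij_betw \<psi> A A \<and> (\<forall>\<pi>\<in>A. cDes_perm n (\<psi> \<pi>) = cshift n (cDes_perm n \<pi>)))"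

definition is_partition :: "nat list \<Rightarrow> bool" where
  "is_partition la \<longleftrightarrow> sorted_wrt (\<ge>) la \<and> 0 \<notin> set la"

definition partitions_of :: "nat \<Rightarrow> nat list set" where
  "partitions_of n = {la. is_partition la \<and> sum_list la = n}"

definition valid_skew :: "nat list \<times> nat list \<Rightarrow> bool" where
  "valid_skew s \<longleftrightarrow> (case s of (la, \<mu>) \<Rightarrow>
      is_partition la \<and> is_partition \<mu> \<and> length \<mu> \<le> length la \<and>
      (\<forall>i < length \<mu>. \<mu> ! i \<le> la ! i))"

definition part_row :: "nat list \<Rightarrow> nat \<Rightarrow> nat" where
  "part_row \<mu> i = (if i < length \<mu> then \<mu> ! i else 0)"

text \<open>Cells (row, column), 0-indexed, English convention: larger row index = lower row.\<close>
definition cells :: "nat list \<times> nat list \<Rightarrow> (nat \<times> nat) set" where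
  "cells s = (case s of (la, \<mu>) \<Rightarrow>
      {(i, j). i < length la \<and> part_row \<mu> i \<le> j \<and> j < la ! i})"

definition adjacent_cells :: "nat \<times> nat \<Rightarrow> nat \<times> nat \<Rightarrow> bool" where
  "adjacent_cells c d \<longleftrightarrow>
     (fst c = fst d \<and> (snd d = snd c + 1 \<or> snd c = snd d + 1)) \<or>
     (snd c = snd d \<and> (fst d = fst c + 1 \<or> fst c = fst d + 1))"

definition connected_ribbon :: "(nat \<times> nat) set \<Rightarrow> bool" where
  "connected_ribbon C \<longleftrightarrow> C \<noteq> {} \<and>
     (\<forall>c\<in>C. \<forall>d\<in>C. (\<lambda>x y. x \<in> C \<and> y \<in> C \<and> adjacent_cells x y)\<^sup>*\<^sup>* c d) \<and>
     \<not> (\<exists>i j. (i, j) \<in> C \<and> (i, j+1) \<in> C \<and> (i+1, j) \<in> C \<and> (i+1, j+1) \<in> C)"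

definition SYT :: "(nat \<times> nat) set \<Rightarrow> (nat \<times> nat \<Rightarrow> nat) set" where
  "SYT C = {T. bij_betw T C {1..card C} \<and> (\<forall>c. c \<notin> C \<longrightarrow> T c = 0) \<and>
     (\<forall>i j i' j'. (i, j) \<in> C \<and> (i', j') \<in> C \<and>
        ((i = i' \<and> j < j') \<or> (j = j' \<and> i < i')) \<longrightarrow> T (i, j) < T (i', j'))}"

definition Des_SYT :: "(nat \<times> nat) set \<Rightarrow> (nat \<times> nat \<Rightarrow> nat) \<Rightarrow> nat set" where
  "Des_SYT C T = {k \<in> {1..card C - 1}. \<exists>c\<in>C. \<exists>d\<in>C. T c = k \<and> T d = k + 1 \<and> fst c < fst d}"

definition SSYT :: "(nat \<times> nat) set \<Rightarrow> (nat \<times> nat \<Rightarrow> nat) set" where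
  "SSYT C = {T. (\<forall>c\<in>C. T c \<ge> 1) \<and> (\<forall>c. c \<notin> C \<longrightarrow> T c = 0) \<and>
     (\<forall>i j j'. (i, j) \<in> C \<and> (i, j') \<in> C \<and> j < j' \<longrightarrow> T (i, j) \<le> T (i, j')) \<and>
     (\<forall>i i' j. (i, j) \<in> C \<and> (i', j) \<in> C \<and> i < i' \<longrightarrow> T (i, j) < T (i', j))}"

text \<open>A homogeneous formal power series of degree n in x_1, x_2, ... is represented by its
coefficient function on monomials; the monomial x_{i_1} ... x_{i_n} is the multiset
{# i_1, ..., i_n #} of positive integers.\<close>

definition fundamental_qsym :: "nat \<Rightarrow> nat set \<Rightarrow> nat multiset \<Rightarrow> nat" where
  "fundamental_qsym n D M = card {w. length w = n \<and> sorted w \<and> 0 \<notin> set w \<and> mset w = M \<and>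
      (\<forall>j\<in>D. w ! (j - 1) < w ! j)}"

definition schur :: "nat list \<Rightarrow> nat multiset \<Rightarrow> nat" where
  "schur la M = card {T \<in> SSYT (cells (la, [])). image_mset T (mset_set (cells (la, []))) = M}"

text \<open>Schur-positivity: the sum of fundamental quasisymmetric functions is a nonnegative
combination of the Schur functions s_lambda, lambda a partition of n (this is exactly
"symmetric with nonnegative Schur coefficients").\<close>
definition schur_positive :: "nat \<Rightarrow> (nat \<Rightarrow> nat) set \<Rightarrow> bool" where
  "schur_positive n A \<longleftrightarrow> (\<exists>c :: nat list \<Rightarrow> real. (\<forall>la. c la \<ge> 0) \<and>
     (\<forall>M. (\<Sum>\<pi>\<in>A. real (fundamental_qsym n (Des_perm n \<pi>) M)) =
          (\<Sum>la\<in>partitions_of n. c la * real (schur la M))))"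

definition cyclic_descent_ext ::
  "(nat \<times> nat) set \<Rightarrow> ((nat \<times> nat \<Rightarrow> nat) \<Rightarrow> nat set) \<Rightarrow>
   ((nat \<times> nat \<Rightarrow> nat) \<Rightarrow> (nat \<times> nat \<Rightarrow> nat)) \<Rightarrow> bool" where
  "cyclic_descent_ext C cD \<psi> \<longleftrightarrow>
     bij_betw \<psi> (SYT C) (SYT C) \<and>
     (\<forall>T\<in>SYT C. cD T \<subseteq> {1..card C} \<and> cD T \<inter> {1..card C - 1} = Des_SYT C T \<and>
        cD (\<psi> T) = cshift (card C) (cD T) \<and> cD T \<noteq> {} \<and> cD T \<noteq> {1..card C})"

text \<open>Nonnegative integer coefficients m_{lambda/mu} are encoded as a finite multiset of skew
shapes; for each shape some cyclic descent extension is used (the distribution does not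
depend on this choice).\<close>
definition cyclic_schur_positive :: "nat \<Rightarrow> (nat \<Rightarrow> nat) set \<Rightarrow> bool" where
  "cyclic_schur_positive n A \<longleftrightarrow>
     (\<exists>S :: (nat list \<times> nat list) multiset.
        (\<forall>s\<in>#S. valid_skew s \<and> card (cells s) = n \<and> \<not> connected_ribbon (cells s)) \<and>
        (\<exists>cD \<psi>. (\<forall>s\<in>#S. cyclic_descent_ext (cells s) (cD s) (\<psi> s)) \<and>
           (\<forall>J. card {\<pi>\<in>A. cDes_perm n \<pi> = J} =
                (\<Sum>s\<in>#S. card {T\<in>SYT (cells s). cD s T = J}))))"

end

theory Submission
  imports Defs "HOL-Library.Function_Algebras"
begin

text \<open>
  In the seminormal form, the symmetric group acts on the real functions on \<open>SYT C\<close>; let \<open>V i\<close>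
  be the space fixed by the simple transposition \<open>s\<^sub>i\<close>, and \<open>U K\<close> the intersection of the \<open>V i\<close>
  with \<open>i \<in> K\<close>. A unitriangular basis indexed by \<open>T \<in> SYT C\<close> is adapted to all \<open>V i\<close>,
  \<open>1 \<le> i < n\<close>, with \<open>U K\<close> spanned by the \<open>T\<close> with \<open>Des T \<inter> K = {}\<close>. The long cycle \<open>R\<close> carries
  \<open>V i\<close> to \<open>V (i + 1)\<close> and produces a further space \<open>V n\<close>, so that \<open>V 1, \<dots>, V n\<close> are
  permuted cyclically and every proper subfamily generates a distributive lattice of subspaces.
  If no tableau has descent set \<open>{r..n - 1}\<close>, which holds for straight shapes that are not hooks, then
  Koszul-type complexes of the \<open>U K\<close> are exact and the whole family is distributive. The number of
  tableaux with cyclic descent set \<open>J\<close> is then defined as the codimension in \<open>U ([n] - J)\<close> of the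
  sum of all smaller \<open>U\<close>; it is nonnegative, invariant under rotation, and refines the descent statistic.

  Given a Schur-positive, \<open>cDes\<close>-invariant set, subtract the cyclic distributions of its non-hook
  components. What remains depends on \<open>card J\<close> only, because hooks see only the number of descents;
  it is nonnegative, since the non-hook distributions vanish on intervals \<open>{n - k + 1..n}\<close>, and it is
  therefore a nonnegative combination of the distributions of the disconnected shapes formed by one
  row and one column. Conversely, by the Robinson-Schensted correspondence the descent
  distribution of every skew shape is a nonnegative combination of those of straight shapes.
\<close>

section \<open>Distributive families of subspaces\<close>

text \<open>The obstacle is nonnegativity. Refining the descent statistic in a rotation-invariant
  way is a linear system whose solutions are alternating sums of descent counts, so \<open>m\<close>
  has to appear as a dimension. Distributivity is what makes the dimensions add up
  (\<open>excess_add\<close>), and it can fail for the full cyclic family: for a hook that is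
  neither a row nor a column the system has no nonnegative solution at all. What separates the other
  shapes is that the index sets \<open>{1..r}\<close> contribute nothing, which is the bottom-degree
  exactness assumed in \<open>run\<close>; long exact sequences carry it down along initial
  intervals, and from the empty set up to arbitrary ones.

  A second gap lies between the real coefficients in \<open>schur_positive\<close> and the
  multiplicities in \<open>cyclic_schur_positive\<close>; it is closed by unitriangularity of the
  Kostka numbers.\<close>

lemma span_Int_independent:
  fixes F :: "'v::real_vector set"
  assumes "independent F" "P \<subseteq> F" "Q \<subseteq> F"
  shows "span P \<inter> span Q = span (P \<inter> Q)"
proof
  show "span (P \<inter> Q) \<subseteq> span P \<inter> span Q"
    by (simp add: span_mono)
  show "span P \<inter> span Q \<subseteq> span (P \<inter> Q)"
  proof
    fix v assume v: "v \<in> span P \<inter> span Q"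
    have P: "representation F v = representation P v"
      using v assms by (intro representation_extend) auto
    have Q: "representation F v = representation Q v"
      using v assms by (intro representation_extend) auto
    have vF: "v \<in> span F" using v span_mono[OF assms(2)] by blast
    have "b \<in> P \<inter> Q" if "representation F v b \<noteq> 0" for b
      using that P Q representation_ne_zero by (metis IntI)
    then have "(\<Sum>b | representation F v b \<noteq> 0. representation F v b *\<^sub>R b) \<in> span (P \<inter> Q)"
      by (intro span_sum span_scale span_base) auto
    then show "v \<in> span (P \<inter> Q)"
      using sum_nonzero_representation_eq[OF assms(1) vF] by simp
  qed
qed

lemma independent_Un:
  fixes B D :: "'v::real_vector set"
  assumes "independent B" "independent D" and BD: "span B \<inter> span D \<subseteq> {0}"
  shows "independent (B \<union> D)"
proof -
  have *: False
    if B: "independent B" and BD: "span B \<inter> span D \<subseteq> {0}" and a: "a \<in> B"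
      and sp: "a \<in> span (B \<union> D - {a})" for a and B D :: "'v set"
  proof -
    have "B \<union> D - {a} \<subseteq> (B - {a}) \<union> D" by blast
    then have "a \<in> span ((B - {a}) \<union> D)"
      using sp span_mono by blast
    then obtain x y where xy: "a = x + y" "x \<in> span (B - {a})" "y \<in> span D"
      by (auto simp: span_Un)
    have "x \<in> span B" using xy(2) span_mono[of "B - {a}" B] by blast
    then have "y \<in> span B"
      using xy(1) a by (metis add_diff_cancel_left' span_base span_diff)
    then have "y = 0" using BD xy(3) by blast
    then show False using xy B a by (auto simp: dependent_def)
  qed
  show ?thesis
    unfolding dependent_def
    using *[OF assms(1) BD] *[OF assms(2), of B] BD by (auto simp: Un_commute Int_commute)
qed

text \<open>A basis \<open>C\<close> of \<open>X\<close> is extended inside \<open>Y\<close> by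
  \<open>D\<close>; a basis \<open>B\<close> of the intersection together with \<open>D\<close> is
  then a basis of \<open>Y\<close>, and both sides count \<open>B\<close>, \<open>C\<close> and
  \<open>D\<close>. In the application the ambient type is an infinite-dimensional function space,
  so finiteness enters through the spanning set \<open>W\<close>.\<close>

lemma dim_Un_Int:
  fixes X Y :: "'v::real_vector set"
  assumes X: "subspace X" and Y: "subspace Y" and fin: "X \<union> Y \<subseteq> span W" "finite W"
  shows "dim (X \<union> Y) + dim (X \<inter> Y) = dim X + dim Y"
proof -
  have finind: "finite B" if "independent B" "B \<subseteq> X \<union> Y" for B
    using independent_span_bound[OF fin(2) that(1)] that(2) fin(1) by auto
  obtain C where C: "C \<subseteq> X" "independent C" "X \<subseteq> span C"
    using basis_exists by metis
  obtain F where F: "C \<subseteq> F" "F \<subseteq> C \<union> Y" "independent F" "C \<union> Y \<subseteq> span F"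
    using maximal_independent_subset_extend[of C "C \<union> Y"] C by blast
  define D where "D = F - C"
  obtain B where B: "B \<subseteq> X \<inter> Y" "independent B" "X \<inter> Y \<subseteq> span B"
    using basis_exists by metis
  have spC: "span C = X" using C X by (simp add: span_eq_iff span_minimal subset_antisym)
  have DY: "D \<subseteq> Y" using F D_def by blast
  have spB: "span B \<subseteq> X \<inter> Y" using B X Y by (simp add: span_minimal)
  have CD: "span C \<inter> span D = span (C \<inter> D)"
    using F D_def by (intro span_Int_independent) auto
  then have CD0: "X \<inter> span D \<subseteq> {0}" using spC D_def by auto
  have indD: "independent D" using F(3) D_def independent_mono by blast
  have "independent (B \<union> D)"
    using CD0 spB by (intro independent_Un B(2) indD) blast
  moreover have "Y \<subseteq> span (B \<union> D)"
  proof
    fix y assume y: "y \<in> Y"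
    have "y \<in> span (C \<union> D)" using y F D_def by (metis Un_Diff_cancel Un_upper2 subset_Un_eq subset_iff)
    then obtain x d where xd: "y = x + d" "x \<in> span C" "d \<in> span D" by (auto simp: span_Un)
    have "d \<in> Y" using xd(3) DY Y by (metis span_minimal subset_iff)
    then have "x \<in> Y" using xd(1) y Y by (metis add_diff_cancel_right' subspace_diff)
    then have "x \<in> span B" using B(3) xd(2) spC by blast
    then show "y \<in> span (B \<union> D)" using xd by (auto simp: span_Un)
  qed
  moreover have "B \<union> D \<subseteq> Y" using B DY by blast
  ultimately have 1: "dim Y = card (B \<union> D)"
    using basis_card_eq_dim by metis
  have "0 \<notin> D" using indD dependent_zero by blast
  then have "B \<inter> D = {}" using CD0 B(1) span_base by blast
  then have 2: "dim Y = card B + card D"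
    using 1 finind[OF B(2)] finind[OF indD] B(1) DY by (subst 1, intro card_Un_disjoint) auto
  have 3: "dim (X \<union> Y) = card F"
  proof (rule basis_card_eq_dim[symmetric])
    show "F \<subseteq> X \<union> Y" using F C by blast
    show "X \<union> Y \<subseteq> span F" using C F(1,4) span_mono[OF F(1)] by blast
  qed (fact F)
  have "finite F" using finind F C by blast
  then have "card F = card C + card D" using F D_def
    by (metis Diff_disjoint Un_Diff_cancel card_Un_disjoint finite_Diff finite_subset subset_Un_eq)
  moreover have "dim X = card C" "dim (X \<inter> Y) = card B"
    using basis_card_eq_dim C B by metis+
  ultimately show ?thesis using 2 3 by simp
qed

lemma span_UN_sum:
  fixes W :: "'i \<Rightarrow> 'v::real_vector set"
  assumes "finite A" "\<And>i. i \<in> A \<Longrightarrow> subspace (W i)" "v \<in> span (\<Union>i\<in>A. W i)"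
  shows "\<exists>w. (\<forall>i\<in>A. w i \<in> W i) \<and> v = (\<Sum>i\<in>A. w i)"
  using assms
proof (induction A arbitrary: v rule: finite_induct)
  case empty
  then show ?case by simp
next
  case (insert a A)
  have "v \<in> span (W a \<union> (\<Union>i\<in>A. W i))" using insert.prems(2) by simp
  then obtain x y where xy: "v = x + y" "x \<in> span (W a)" "y \<in> span (\<Union>i\<in>A. W i)"
    by (auto simp: span_Un)
  have "x \<in> W a" using xy(2) insert.prems(1)[of a] by (metis insertI1 span_eq_iff)
  obtain w where w: "\<forall>i\<in>A. w i \<in> W i" "y = (\<Sum>i\<in>A. w i)"
    using insert.IH[OF _ xy(3)] insert.prems(1) by auto
  have "v = (\<Sum>i\<in>insert a A. (w(a := x)) i)"
    using insert.hyps w xy by (auto intro!: sum.cong)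
  moreover have "\<forall>i\<in>insert a A. (w(a := x)) i \<in> W i" using w \<open>x \<in> W a\<close> by auto
  ultimately show ?case by blast
qed

section \<open>Koszul complexes of nested subspaces\<close>

definition koszul_sign :: "nat \<Rightarrow> nat set \<Rightarrow> real" where
  "koszul_sign i B = (-1) ^ card {j \<in> B. j < i}"

lemma koszul_sign_square [simp]: "koszul_sign i B * koszul_sign i B = 1"
  by (simp add: koszul_sign_def flip: power_add)

lemma koszul_sign_swap:
  assumes "finite B" "i \<notin> B" "j \<notin> B" "i \<noteq> j"
  shows "koszul_sign i B * koszul_sign j (insert i B) = - (koszul_sign j B * koszul_sign i (insert j B))"
proof -
  have *: "koszul_sign i B * koszul_sign j (insert i B) = - (koszul_sign j B * koszul_sign i (insert j B))"
    if "i < j" "i \<notin> B" for i j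
  proof -
    have "{k \<in> insert i B. k < j} = insert i {k \<in> B. k < j}"
         "{k \<in> insert j B. k < i} = {k \<in> B. k < i}" using that by auto
    then show ?thesis using that assms(1) by (simp add: koszul_sign_def)
  qed
  show ?thesis using *[of i j] *[of j i] assms by (cases "i < j") auto
qed

text \<open>Since \<open>U (insert i B)\<close> lies in \<open>U B\<close>, the Koszul differential
  consists of signed inclusions. All components live in one ambient space, so a chain is a plain
  function on sets.\<close>

definition bd :: "nat set \<Rightarrow> (nat set \<Rightarrow> 'v::real_vector) \<Rightarrow> nat set \<Rightarrow> 'v" where
  "bd S z B = (\<Sum>i\<in>S - B. koszul_sign i B *\<^sub>R z (insert i B))"

lemma bd_bd:
  assumes "finite S" "B \<subseteq> S"
  shows "bd S (bd S y) B = 0"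
proof -
  define t where "t i j = (koszul_sign i B * koszul_sign j (insert i B)) *\<^sub>R y (insert j (insert i B))" for i j
  have finB: "finite B" using assms finite_subset by blast
  have anti: "t i j = - t j i" if "i \<in> S - B" "j \<in> S - B" "i \<noteq> j" for i j
    using koszul_sign_swap[of B i j] that finB
    by (simp add: t_def insert_commute)
  let ?P = "Sigma (S - B) (\<lambda>i. S - B - {i})"
  have "bd S (bd S y) B = (\<Sum>i\<in>S - B. \<Sum>j\<in>S - B - {i}. t i j)"
    by (auto simp: bd_def t_def scaleR_sum_right Diff_insert2[symmetric] intro!: sum.cong)
  also have "\<dots> = (\<Sum>p\<in>?P. t (fst p) (snd p))"
    using assms by (subst sum.Sigma) (auto simp: case_prod_beta)
  finally have 1: "bd S (bd S y) B = (\<Sum>p\<in>?P. t (fst p) (snd p))" .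
  also have "\<dots> = (\<Sum>p\<in>?P. t (snd p) (fst p))"
    by (rule sum.reindex_bij_witness[of _ prod.swap prod.swap]) auto
  also have "\<dots> = (\<Sum>p\<in>?P. - t (fst p) (snd p))"
    by (intro sum.cong refl) (auto intro: anti)
  also have "\<dots> = - bd S (bd S y) B"
    by (simp add: sum_negf 1)
  finally have "bd S (bd S y) B + bd S (bd S y) B = 0" by (simp only: eq_neg_iff_add_eq_0)
  then show ?thesis by (simp flip: scaleR_2)
qed

text \<open>
  \<open>distr\<close> is distributivity of every proper subfamily; together with \<open>run\<close> it yields distributivity
  of the whole family.
\<close>

locale subspace_family =
  fixes n :: nat and U :: "nat set \<Rightarrow> 'v::real_vector set"
  assumes subspace_U: "subspace (U K)"
    and U_insert: "U (insert i K) \<subseteq> U K"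
    and fin_dim: "\<exists>W. finite W \<and> U {} \<subseteq> span W"
    and distr: "K \<subseteq> {1..n} \<Longrightarrow> a \<in> {1..n} \<Longrightarrow> A \<subseteq> {1..n} \<Longrightarrow> insert a K \<union> A \<noteq> {1..n} \<Longrightarrow>
      U (insert a K) \<inter> span (\<Union>i\<in>A. U (insert i K)) \<subseteq> span (\<Union>i\<in>A. U (insert i (insert a K)))"
    and run: "r \<le> n \<Longrightarrow> U {1..r} \<subseteq> span (\<Union>i\<in>{1..n} - {1..r}. U (insert i {1..r}))"
begin

text \<open>
  The complex whose part of degree \<open>r\<close> is the direct sum of the \<open>U B\<close> with \<open>K \<subseteq> B \<subseteq> S\<close> and
  \<open>card B = r\<close>.
\<close>

definition chain :: "nat set \<Rightarrow> nat set \<Rightarrow> nat \<Rightarrow> (nat set \<Rightarrow> 'v) \<Rightarrow> bool" where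
  "chain K S r z \<longleftrightarrow> (\<forall>B. K \<subseteq> B \<and> B \<subseteq> S \<and> card B = r \<longrightarrow> z B \<in> U B)"

text \<open>For finite \<open>K\<close> the condition is void in degree \<open>card K\<close>, so
  exactness in this bottom degree says that \<open>U K\<close> is the sum of the
  \<open>U (insert i K)\<close> with \<open>i\<close> in \<open>S - K\<close>.\<close>

definition closed :: "nat set \<Rightarrow> nat set \<Rightarrow> nat \<Rightarrow> (nat set \<Rightarrow> 'v) \<Rightarrow> bool" where
  "closed K S r z \<longleftrightarrow> (\<forall>B. K \<subseteq> B \<and> B \<subseteq> S \<and> Suc (card B) = r \<longrightarrow> bd S z B = 0)"

definition boundary :: "nat set \<Rightarrow> nat set \<Rightarrow> nat \<Rightarrow> (nat set \<Rightarrow> 'v) \<Rightarrow> bool" where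
  "boundary K S r z \<longleftrightarrow>
     (\<exists>y. chain K S (Suc r) y \<and> (\<forall>B. K \<subseteq> B \<and> B \<subseteq> S \<and> card B = r \<longrightarrow> z B = bd S y B))"

definition exact :: "nat set \<Rightarrow> nat set \<Rightarrow> nat \<Rightarrow> bool" where
  "exact K S r \<longleftrightarrow> (\<forall>z. chain K S r z \<longrightarrow> closed K S r z \<longrightarrow> boundary K S r z)"

lemma chainD: "chain K S r z \<Longrightarrow> K \<subseteq> B \<Longrightarrow> B \<subseteq> S \<Longrightarrow> card B = r \<Longrightarrow> z B \<in> U B"
  by (auto simp: chain_def)

lemma closedD: "closed K S r z \<Longrightarrow> K \<subseteq> B \<Longrightarrow> B \<subseteq> S \<Longrightarrow> Suc (card B) = r \<Longrightarrow> bd S z B = 0"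
  by (auto simp: closed_def)

lemma exactD: "exact K S r \<Longrightarrow> chain K S r z \<Longrightarrow> closed K S r z \<Longrightarrow> boundary K S r z"
  by (auto simp: exact_def)

lemma exactI: "(\<And>z. chain K S r z \<Longrightarrow> closed K S r z \<Longrightarrow> boundary K S r z) \<Longrightarrow> exact K S r"
  by (auto simp: exact_def)

lemma boundaryE:
  assumes "boundary K S r z"
  obtains y where "chain K S (Suc r) y"
    "\<forall>B. K \<subseteq> B \<longrightarrow> B \<subseteq> S \<longrightarrow> card B = r \<longrightarrow> z B = bd S y B"
  using assms unfolding boundary_def by auto

lemma boundaryI:
  assumes "chain K S (Suc r) y" "\<And>B. K \<subseteq> B \<Longrightarrow> B \<subseteq> S \<Longrightarrow> card B = r \<Longrightarrow> z B = bd S y B"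
  shows "boundary K S r z"
  using assms unfolding boundary_def by (intro exI[of _ y]) auto

lemma bd_split:
  assumes "finite S" "a \<in> S" "a \<notin> B"
  shows "bd S z B = bd (S - {a}) z B + koszul_sign a B *\<^sub>R z (insert a B)"
proof -
  have "S - B = insert a (S - {a} - B)" using assms by blast
  then show ?thesis using assms by (simp add: bd_def add.commute)
qed

lemma bd_cong: "(\<And>i. i \<in> S - B \<Longrightarrow> z (insert i B) = z' (insert i B)) \<Longrightarrow> bd S z B = bd S z' B"
  unfolding bd_def by (intro sum.cong) auto

lemma bd_zero: "(\<And>i. i \<in> S - B \<Longrightarrow> z (insert i B) = 0) \<Longrightarrow> bd S z B = 0"
  unfolding bd_def by (intro sum.neutral) auto

lemma bd_diff: "bd S (\<lambda>B. z B - z' B) B = bd S z B - bd S z' B"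
  by (simp add: bd_def scaleR_diff_right sum_subtractf)

text \<open>Splitting the sets \<open>B\<close> by membership of \<open>a\<close> gives a short
  exact sequence of complexes, and this is exactness of its long sequence in the middle. The
  preimage \<open>y1\<close> over the sets with \<open>a\<close>, extended by zero, removes
  \<open>z\<close> there; what is left lives on the sets without \<open>a\<close>, is still a cycle,
  and is a boundary by \<open>ex\<close>.\<close>

lemma boundary_lift:
  assumes fin: "finite S" and K: "K \<subseteq> S" and a: "a \<in> S" "a \<notin> K"
    and ch: "chain K S r z" and cl: "closed K S r z"
    and bz: "boundary (insert a K) S r z" and ex: "exact K (S - {a}) r"
  shows "boundary K S r z"
proof -
  obtain y1 where y1a: "chain (insert a K) S (Suc r) y1"
    "\<forall>B. insert a K \<subseteq> B \<longrightarrow> B \<subseteq> S \<longrightarrow> card B = r \<longrightarrow> z B = bd S y1 B"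
    by (rule boundaryE[OF bz])
  note y1 = y1a(1) y1a(2)[rule_format]
  define y where "y B = (if a \<in> B then y1 B else 0)" for B
  define z' where "z' B = z B - bd S y B" for B
  have bdy_in: "bd S y B = bd S y1 B" if "a \<in> B" for B
    using that by (intro bd_cong) (auto simp: y_def)
  have bdy_out: "bd S y B = koszul_sign a B *\<^sub>R y1 (insert a B)" if "a \<notin> B" for B
    using that a by (subst bd_split[OF fin a(1)]) (auto simp: y_def split: if_splits intro!: bd_zero)
  have z'0: "z' B = 0" if "insert a K \<subseteq> B" "B \<subseteq> S" "card B = r" for B
    using that y1(2)[OF that] bdy_in[of B] by (auto simp: z'_def)
  have "chain K (S - {a}) r z'"
    unfolding chain_def
  proof (intro allI impI, elim conjE)
    fix B assume B: "K \<subseteq> B" "B \<subseteq> S - {a}" "card B = r"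
    have "finite B" using B fin by (meson finite_Diff finite_subset)
    then have "y1 (insert a B) \<in> U (insert a B)"
      using B a by (intro chainD[OF y1(1)]) (auto simp: card_insert_if)
    then have "bd S y B \<in> U B"
      using B U_insert[of a B] subspace_U by (subst bdy_out) (auto intro: subspace_scale)
    moreover have "z B \<in> U B" using B by (intro chainD[OF ch]) auto
    ultimately show "z' B \<in> U B" using subspace_U by (simp add: z'_def subspace_diff)
  qed
  moreover have "closed K (S - {a}) r z'"
    unfolding closed_def
  proof (intro allI impI, elim conjE)
    fix B assume B: "K \<subseteq> B" "B \<subseteq> S - {a}" "Suc (card B) = r"
    have "finite B" using B fin by (meson finite_Diff finite_subset)
    then have "z' (insert a B) = 0" using B a by (intro z'0) (auto simp: card_insert_if)
    then have "bd (S - {a}) z' B = bd S z' B" using B a by (subst bd_split[OF fin a(1)]) auto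
    also have "\<dots> = bd S z B - bd S (bd S y) B" unfolding z'_def by (rule bd_diff)
    also have "\<dots> = 0" using closedD[OF cl, of B] bd_bd[OF fin, of B y] B by (auto simp: subset_Diff_insert)
    finally show "bd (S - {a}) z' B = 0" .
  qed
  ultimately have "boundary K (S - {a}) r z'" by (rule exactD[OF ex])
  then obtain y2 where y2a: "chain K (S - {a}) (Suc r) y2"
    "\<forall>B. K \<subseteq> B \<longrightarrow> B \<subseteq> (S - {a}) \<longrightarrow> card B = r \<longrightarrow> z' B = bd (S - {a}) y2 B"
    by (rule boundaryE)
  note y2 = y2a(1) y2a(2)[rule_format]
  \<comment> \<open>\<open>y2\<close> does not disturb the sets containing \<open>a\<close>: the
    differential at such a set only sees larger sets, which contain \<open>a\<close> as
    well.\<close>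
  define w where "w B = (if a \<in> B then y1 B else y2 B)" for B
  have "chain K S (Suc r) w"
    unfolding chain_def w_def using chainD[OF y1(1)] chainD[OF y2(1)] by (auto simp: subset_Diff_insert)
  moreover have "z B = bd S w B" if B: "K \<subseteq> B" "B \<subseteq> S" "card B = r" for B
  proof (cases "a \<in> B")
    case True
    then have "bd S w B = bd S y1 B" by (intro bd_cong) (auto simp: w_def)
    then show ?thesis using y1(2) B True by auto
  next
    case False
    have "bd S w B = bd (S - {a}) w B + koszul_sign a B *\<^sub>R y1 (insert a B)"
      using False by (subst bd_split[OF fin a(1)]) (auto simp: w_def)
    also have "bd (S - {a}) w B = bd (S - {a}) y2 B" using False by (intro bd_cong) (auto simp: w_def)
    also have "\<dots> = z' B" using y2(2)[of B] B False by (simp add: subset_Diff_insert)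
    also have "z' B + koszul_sign a B *\<^sub>R y1 (insert a B) = z B"
      using bdy_out[OF False] by (simp add: z'_def)
    finally show ?thesis by simp
  qed
  ultimately show ?thesis by (rule boundaryI)
qed

lemma boundary_of_span:
  assumes fin: "finite S" and K: "K \<subseteq> S" and r: "card K = r"
    and z: "z K \<in> span (\<Union>i\<in>S - K. U (insert i K))"
  shows "boundary K S r z"
proof -
  have "finite K" using K fin finite_subset by blast
  obtain w where w: "\<And>i. i \<in> S - K \<Longrightarrow> w i \<in> U (insert i K)" "z K = (\<Sum>i\<in>S - K. w i)"
    using span_UN_sum[OF _ subspace_U z] fin by blast
  \<comment> \<open>\<open>the_elem (B - K)\<close> recovers \<open>i\<close> from
    \<open>B = insert i K\<close>; the sign is put in to cancel the one in
    \<open>bd\<close>.\<close>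
  define y where "y B = (let i = the_elem (B - K) in koszul_sign i K *\<^sub>R w i)" for B
  have y: "y (insert i K) = koszul_sign i K *\<^sub>R w i" if "i \<in> S - K" for i
  proof -
    have "insert i K - K = {i}" using that by auto
    then show ?thesis by (simp add: y_def)
  qed
  have "chain K S (Suc r) y" unfolding chain_def
  proof (intro allI impI, elim conjE)
    fix B assume B: "K \<subseteq> B" "B \<subseteq> S" "card B = Suc r"
    have "card (B - K) = 1" using B r \<open>finite K\<close> by (simp add: card_Diff_subset)
    then obtain i where i: "B - K = {i}" by (auto simp: card_1_singleton_iff)
    then have "B = insert i K" "i \<in> S - K" using B by auto
    then show "y B \<in> U B" using y w(1) subspace_U by (auto intro: subspace_scale)
  qed
  moreover have "bd S y K = z K"
    unfolding w(2) bd_def by (intro sum.cong) (auto simp: y)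
  moreover have "B = K" if "K \<subseteq> B" "B \<subseteq> S" "card B = r" for B
    using that r fin by (metis card_subset_eq finite_subset)
  then have "z B = bd S y B" if "K \<subseteq> B" "B \<subseteq> S" "card B = r" for B
    using that calculation(2) by metis
  ultimately show ?thesis by (intro boundaryI)
qed

lemma cycle_mono: "chain K S r z \<Longrightarrow> K \<subseteq> K' \<Longrightarrow> chain K' S r z"
  "closed K S r z \<Longrightarrow> K \<subseteq> K' \<Longrightarrow> closed K' S r z"
  unfolding chain_def closed_def using subset_trans[of K K'] by auto

text \<open>Induction on \<open>card (S - K)\<close>: an element \<open>a\<close> is moved into
  \<open>K\<close> or out of \<open>S\<close>, and \<open>boundary_lift\<close> combines the two.
  The bottom degree is excluded, as it need not be exact; \<open>distr\<close> enters exactly when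
  moving \<open>a\<close> into \<open>K\<close> turns \<open>r\<close> into the bottom
  degree.\<close>

lemma exact_proper:
  assumes "S \<subset> {1..n}" "K \<subseteq> S" "card K < r"
  shows "exact K S r"
  using assms
proof (induction "card (S - K)" arbitrary: S K)
  case 0
  have fin: "finite S" using 0 finite_subset by blast
  then have "S = K" using 0 by auto
  then have "\<not> (K \<subseteq> B \<and> B \<subseteq> S \<and> card B = r)" for B using 0 by auto
  then show ?case
    using subspace_0[OF subspace_U] by (intro exactI boundaryI[of _ _ _ "\<lambda>_. 0"]) (auto simp: chain_def)
next
  case (Suc m)
  have fin: "finite S" using Suc.prems finite_subset by blast
  have finK: "finite K" using Suc.prems fin finite_subset by blast
  obtain a where a: "a \<in> S" "a \<notin> K"
    using Suc.hyps(2) by (metis Diff_eq_empty_iff card.empty nat.distinct(1) subsetI)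
  have eq: "S - {a} - K = S - insert a K" "S - K = insert a (S - insert a K)" using a by auto
  have "card (S - K) = Suc (card (S - insert a K))" using fin by (subst eq(2)) simp
  then have "card (S - insert a K) = m" using Suc.hyps(2) by simp
  then have c: "card (S - {a} - K) = m" "card (S - insert a K) = m" by (simp_all only: eq(1))
  have ex: "exact K (S - {a}) r"
    using Suc.hyps(1)[of "S - {a}" K] c Suc.prems a by auto
  show ?case
  proof (rule exactI)
    fix z assume z: "chain K S r z" "closed K S r z"
    have "boundary (insert a K) S r z"
    proof (cases "Suc (card K) < r")
      case True
      then have "exact (insert a K) S r"
        using Suc.hyps(1)[of S "insert a K"] c Suc.prems a finK by auto
      then show ?thesis using z by (elim exactD cycle_mono) auto
    next
      \<comment> \<open>Now \<open>r\<close> is the bottom degree over \<open>insert a K\<close>.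
        Closedness at \<open>K\<close> writes \<open>z (insert a K)\<close> as a combination of
        elements of the other \<open>U (insert i K)\<close>, and distributivity moves it into the
        sum of the \<open>U (insert i (insert a K))\<close>. This is where \<open>S\<close> must not
        be all of \<open>{1..n}\<close>.\<close>
      case False
      then have r: "r = Suc (card K)" using Suc.prems by simp
      have zi: "z (insert i K) \<in> U (insert i K)" if "i \<in> S - K" for i
        using that r finK Suc.prems by (intro chainD[OF z(1)]) auto
      have "bd S z K = 0" using r Suc.prems by (intro closedD[OF z(2)]) auto
      then have "koszul_sign a K *\<^sub>R z (insert a K) = - bd (S - {a}) z K"
        by (subst (asm) bd_split[OF fin a]) (simp add: eq_neg_iff_add_eq_0 add.commute)
      then have "z (insert a K) = - (koszul_sign a K *\<^sub>R bd (S - {a}) z K)"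
        by (metis koszul_sign_square scaleR_minus_right scaleR_one scaleR_scaleR)
      moreover have "bd (S - {a}) z K \<in> span (\<Union>i\<in>S - insert a K. U (insert i K))"
        unfolding bd_def using zi by (intro span_sum span_scale span_base) auto
      ultimately have "z (insert a K) \<in> span (\<Union>i\<in>S - insert a K. U (insert i K))"
        by (simp add: span_neg span_scale)
      moreover have "insert a K \<union> (S - insert a K) \<noteq> {1..n}" using Suc.prems a by auto
      ultimately have "z (insert a K) \<in> span (\<Union>i\<in>S - insert a K. U (insert i (insert a K)))"
        using distr[of K a "S - insert a K"] zi[of a] a Suc.prems by (auto simp: subset_iff)
      then show ?thesis using fin a r Suc.prems finK by (intro boundary_of_span) auto
    qed
    then show "boundary K S r z"
      using boundary_lift[OF fin Suc.prems(2) a z _ ex] by blast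
  qed
qed

text \<open>Over the full index set the bottom degree has to be supplied from outside: for
  \<open>s = r\<close> it is \<open>run\<close>. The elements of the interval are then released one
  by one with \<open>boundary_lift\<close>, whose other half concerns the proper subset
  \<open>{1..n} - {Suc s}\<close>.\<close>

lemma exact_run: "s \<le> r \<Longrightarrow> r \<le> n \<Longrightarrow> exact {1..s} {1..n} r"
proof (induction "r - s" arbitrary: s)
  case 0
  then have "s = r" by simp
  show ?case
  proof (rule exactI)
    fix z assume "chain {1..s} {1..n} r z"
    then have "z {1..r} \<in> U {1..r}" using \<open>s = r\<close> 0 by (auto elim: chainD)
    then show "boundary {1..s} {1..n} r z"
      using run[of r] 0 \<open>s = r\<close> by (intro boundary_of_span) auto
  qed
next
  case (Suc m)
  then have s: "s < r" by simp
  have "exact {1..Suc s} {1..n} r" using Suc by auto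
  then have ex: "exact (insert (Suc s) {1..s}) {1..n} r" by (simp add: atLeastAtMostSuc_conv)
  show ?case
  proof (rule exactI)
    fix z assume z: "chain {1..s} {1..n} r z" "closed {1..s} {1..n} r z"
    have "boundary (insert (Suc s) {1..s}) {1..n} r z"
      using z by (intro exactD[OF ex]) (auto elim: cycle_mono)
    moreover have "exact {1..s} ({1..n} - {Suc s}) r"
    proof (rule exact_proper)
      have "Suc s \<in> {1..n}" using s Suc.prems by simp
      then show "{1..n} - {Suc s} \<subset> {1..n}" by blast
      show "{1..s} \<subseteq> {1..n} - {Suc s}" using s Suc.prems by (simp add: subset_iff)
      show "card {1..s} < r" using s by simp
    qed
    ultimately show "boundary {1..s} {1..n} r z"
      using s Suc.prems by (intro boundary_lift[OF _ _ _ _ z]) auto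
  qed
qed

text \<open>The opposite passage in the long exact sequence: a cycle on the sets containing
  \<open>a\<close> is completed to a cycle on all sets, which bounds by \<open>ex\<close>. The
  completion needs exactness without \<open>a\<close> one degree lower, hence
  \<open>Suc (card K) < r\<close>.\<close>

lemma exact_insert:
  assumes K: "K \<subseteq> {1..n}" and a: "a \<in> {1..n}" "a \<notin> K" and r: "Suc (card K) < r"
    and ex: "exact K {1..n} r"
  shows "exact (insert a K) {1..n} r"
proof (rule exactI)
  let ?S = "{1..n}"
  have fin: "finite ?S" by simp
  fix z assume z: "chain (insert a K) ?S r z" "closed (insert a K) ?S r z"
  \<comment> \<open>What the sets containing \<open>a\<close> leave uncancelled at \<open>B\<close>,
    with reversed sign; a chain \<open>y\<close> on sets without \<open>a\<close> completes
    \<open>z\<close> to a cycle if its differential is \<open>g\<close>.\<close>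
  define g where "g B = - (koszul_sign a B *\<^sub>R z (insert a B))" for B
  obtain p where p: "r = Suc p" using r by (cases r) auto
  have sg: "koszul_sign a (insert i B) *\<^sub>R koszul_sign i B *\<^sub>R x =
      - (koszul_sign a B *\<^sub>R koszul_sign i (insert a B) *\<^sub>R x)"
    if "i \<in> ?S - {a} - B" "a \<notin> B" "B \<subseteq> ?S" for i B and x :: 'v
    using koszul_sign_swap[of B i a] that finite_subset[OF that(3) fin]
    by (simp add: mult.commute flip: scaleR_minus_left)
  have "chain K (?S - {a}) p g"
    unfolding chain_def
  proof (intro allI impI, elim conjE)
    fix B assume B: "K \<subseteq> B" "B \<subseteq> ?S - {a}" "card B = p"
    have "finite B" using B by (meson fin finite_Diff finite_subset)
    then have "z (insert a B) \<in> U (insert a B)"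
      using B a p by (intro chainD[OF z(1)]) (auto simp: card_insert_if)
    then show "g B \<in> U B"
      using U_insert[of a B] subspace_U unfolding g_def by (auto intro: subspace_scale subspace_neg)
  qed
  moreover have "closed K (?S - {a}) p g"
    unfolding closed_def
  proof (intro allI impI, elim conjE)
    fix B assume B: "K \<subseteq> B" "B \<subseteq> ?S - {a}" "Suc (card B) = p"
    have "finite B" using B by (meson fin finite_Diff finite_subset)
    have "bd (?S - {a}) g B = (\<Sum>i\<in>?S - {a} - B. koszul_sign a B *\<^sub>R koszul_sign i (insert a B) *\<^sub>R z (insert i (insert a B)))"
      unfolding bd_def
    proof (intro sum.cong refl)
      fix i assume i: "i \<in> ?S - {a} - B"
      show "koszul_sign i B *\<^sub>R g (insert i B) = koszul_sign a B *\<^sub>R koszul_sign i (insert a B) *\<^sub>R z (insert i (insert a B))"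
        using sg[OF i _ _, of "z (insert i (insert a B))"] B
        by (simp add: g_def insert_commute mult.commute subset_Diff_insert)
    qed
    also have "\<dots> = koszul_sign a B *\<^sub>R bd ?S z (insert a B)"
      unfolding bd_def scaleR_sum_right by (intro sum.cong) auto
    also have "bd ?S z (insert a B) = 0"
      using B a p \<open>finite B\<close> by (intro closedD[OF z(2)]) (auto simp: card_insert_if)
    finally show "bd (?S - {a}) g B = 0" by simp
  qed
  moreover have "exact K (?S - {a}) p" using K a r p by (intro exact_proper) auto
  ultimately have "boundary K (?S - {a}) p g" by (blast intro: exactD)
  then obtain y where ya: "chain K (?S - {a}) r y"
    "\<forall>B. K \<subseteq> B \<longrightarrow> B \<subseteq> (?S - {a}) \<longrightarrow> card B = p \<longrightarrow> g B = bd (?S - {a}) y B"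
    unfolding p by (rule boundaryE)
  note y = ya(1) ya(2)[rule_format]
  define z' where "z' B = (if a \<in> B then z B else y B)" for B
  have "chain K ?S r z'"
    unfolding chain_def z'_def using chainD[OF z(1)] chainD[OF y(1)] by (auto simp: subset_Diff_insert)
  moreover have "closed K ?S r z'"
    unfolding closed_def
  proof (intro allI impI, elim conjE)
    fix B assume B: "K \<subseteq> B" "B \<subseteq> ?S" "Suc (card B) = r"
    show "bd ?S z' B = 0"
    proof (cases "a \<in> B")
      case True
      then have "bd ?S z' B = bd ?S z B" by (intro bd_cong) (auto simp: z'_def)
      then show ?thesis using B True closedD[OF z(2), of B] by auto
    next
      case False
      have "bd (?S - {a}) z' B = bd (?S - {a}) y B" using False by (intro bd_cong) (auto simp: z'_def)
      also have "\<dots> = g B" using y(2)[of B] B False p by (simp add: subset_Diff_insert)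
      finally show ?thesis
        using False by (subst bd_split[OF fin a(1)]) (auto simp: z'_def g_def)
    qed
  qed
  ultimately have "boundary K ?S r z'" by (rule exactD[OF ex])
  then obtain x where xa: "chain K ?S (Suc r) x"
    "\<forall>B. K \<subseteq> B \<longrightarrow> B \<subseteq> ?S \<longrightarrow> card B = r \<longrightarrow> z' B = bd ?S x B"
    by (rule boundaryE)
  note x = xa(1) xa(2)[rule_format]
  have "chain (insert a K) ?S (Suc r) x" by (rule cycle_mono(1)[OF x(1)]) auto
  moreover have "z B = bd ?S x B" if "insert a K \<subseteq> B" "B \<subseteq> ?S" "card B = r" for B
    using x(2)[of B] that by (auto simp: z'_def)
  ultimately show "boundary (insert a K) ?S r z" by (rule boundaryI)
qed

lemma exact_full:
  assumes "K \<subseteq> {1..n}" "card K < r" "r \<le> n"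
  shows "exact K {1..n} r"
proof -
  have "finite K" using assms(1) finite_subset by blast
  then show ?thesis using assms
  proof (induction K rule: finite_induct)
    case empty
    then show ?case using exact_run[of 0 r] by simp
  next
    case (insert a K)
    then show ?case by (intro exact_insert) auto
  qed
qed

text \<open>A vector in the intersection is a linear relation among elements of the
  \<open>U (insert i K)\<close> with \<open>i\<close> outside \<open>K\<close>, that is, a cycle in
  degree \<open>card K + 1\<close>; exactness there solves for its component at \<open>a\<close>.
  Unlike in \<open>distr\<close>, the indices \<open>insert a K\<close> and \<open>A\<close> now
  exhaust \<open>{1..n}\<close>.\<close>

lemma distr_full:
  assumes K: "K \<subseteq> {1..n}" and a: "a \<in> {1..n}" "a \<notin> K" and A: "A = {1..n} - insert a K"
  shows "U (insert a K) \<inter> span (\<Union>i\<in>A. U (insert i K)) = span (\<Union>i\<in>A. U (insert i (insert a K)))"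
proof
  let ?S = "{1..n}"
  have finK: "finite K" using K finite_subset by blast
  show "span (\<Union>i\<in>A. U (insert i (insert a K))) \<subseteq> U (insert a K) \<inter> span (\<Union>i\<in>A. U (insert i K))"
  proof (rule Int_greatest)
    show "span (\<Union>i\<in>A. U (insert i (insert a K))) \<subseteq> U (insert a K)"
      using U_insert subspace_U by (intro span_minimal) blast+
    have "U (insert i (insert a K)) \<subseteq> U (insert i K)" for i
      using U_insert[of a "insert i K"] by (simp add: insert_commute)
    then show "span (\<Union>i\<in>A. U (insert i (insert a K))) \<subseteq> span (\<Union>i\<in>A. U (insert i K))"
      by (intro span_mono) blast
  qed
  show "U (insert a K) \<inter> span (\<Union>i\<in>A. U (insert i K)) \<subseteq> span (\<Union>i\<in>A. U (insert i (insert a K)))"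
  proof
    fix v assume v: "v \<in> U (insert a K) \<inter> span (\<Union>i\<in>A. U (insert i K))"
    have "finite A" using A by simp
    then have "\<exists>w. (\<forall>i\<in>A. w i \<in> U (insert i K)) \<and> v = (\<Sum>i\<in>A. w i)"
      using v by (intro span_UN_sum subspace_U) blast+
    then obtain w where w: "\<And>i. i \<in> A \<Longrightarrow> w i \<in> U (insert i K)" "v = (\<Sum>i\<in>A. w i)" by blast
    \<comment> \<open>With \<open>- v\<close> in position \<open>a\<close> the components sum to
      zero, which is closedness at \<open>K\<close>.\<close>
    define w' where "w' = w(a := - v)"
    define z where "z B = (let i = the_elem (B - K) in koszul_sign i K *\<^sub>R w' i)" for B
    have zi: "z (insert i K) = koszul_sign i K *\<^sub>R w' i" if "i \<in> ?S - K" for i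
    proof -
      have "insert i K - K = {i}" using that by auto
      then show ?thesis by (simp add: z_def)
    qed
    have w'U: "w' i \<in> U (insert i K)" if "i \<in> ?S - K" for i
      using w(1)[of i] v that A subspace_U by (auto simp: w'_def subspace_neg)
    have "chain K ?S (Suc (card K)) z" unfolding chain_def
    proof (intro allI impI, elim conjE)
      fix B assume B: "K \<subseteq> B" "B \<subseteq> ?S" "card B = Suc (card K)"
      have "card (B - K) = 1" using B finK by (simp add: card_Diff_subset)
      then obtain i where i: "B - K = {i}" by (auto simp: card_1_singleton_iff)
      then have "B = insert i K" "i \<in> ?S - K" using B by auto
      then show "z B \<in> U B" using zi w'U subspace_U by (auto intro: subspace_scale)
    qed
    moreover have "closed K ?S (Suc (card K)) z" unfolding closed_def
    proof (intro allI impI, elim conjE)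
      fix B assume B: "K \<subseteq> B" "B \<subseteq> ?S" "Suc (card B) = Suc (card K)"
      then have "B = K" by (metis card_subset_eq finite_atLeastAtMost finite_subset nat.inject)
      have "bd ?S z K = (\<Sum>i\<in>?S - K. w' i)" unfolding bd_def by (intro sum.cong) (auto simp: zi)
      also have "?S - K = insert a A" using A a by auto
      also have "(\<Sum>i\<in>insert a A. w' i) = - v + (\<Sum>i\<in>A. w i)"
        using A by (subst sum.insert) (auto simp: w'_def intro!: sum.cong)
      finally show "bd ?S z B = 0" using w(2) \<open>B = K\<close> by simp
    qed
    moreover have "card K < n"
      using psubset_card_mono[of ?S K] K a by fastforce
    then have "exact K ?S (Suc (card K))" using K by (intro exact_full) auto
    ultimately have "boundary K ?S (Suc (card K)) z" by (blast intro: exactD)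
    then obtain y where ya: "chain K ?S (Suc (Suc (card K))) y"
      "\<forall>B. K \<subseteq> B \<longrightarrow> B \<subseteq> ?S \<longrightarrow> card B = Suc (card K) \<longrightarrow> z B = bd ?S y B"
      by (rule boundaryE)
    note y = ya(1) ya(2)[rule_format]
    have "z (insert a K) = bd ?S y (insert a K)" using a K finK by (intro y(2)) auto
    moreover have "bd ?S y (insert a K) \<in> span (\<Union>i\<in>A. U (insert i (insert a K)))"
      unfolding bd_def A[symmetric]
    proof (intro span_sum span_scale span_base)
      fix i assume "i \<in> A"
      then show "y (insert i (insert a K)) \<in> (\<Union>i\<in>A. U (insert i (insert a K)))"
        using a K finK A by (intro UN_I[of i] chainD[OF y(1)]) (auto simp: card_insert_if)
    qed
    ultimately have "z (insert a K) \<in> span (\<Union>i\<in>A. U (insert i (insert a K)))" by simp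
    then have "(- koszul_sign a K) *\<^sub>R z (insert a K) \<in> span (\<Union>i\<in>A. U (insert i (insert a K)))"
      by (rule span_scale)
    moreover have "(- koszul_sign a K) *\<^sub>R z (insert a K) = v" using zi[of a] a by (simp add: w'_def)
    ultimately show "v \<in> span (\<Union>i\<in>A. U (insert i (insert a K)))" by simp
  qed
qed

text \<open>The union stands for its span, the sum of the \<open>U (insert i K)\<close>. This sum
  lies in \<open>U K\<close>, so for \<open>K\<close> inside \<open>{1..n}\<close> the truncated
  subtraction is a genuine codimension.\<close>

definition excess :: "nat set \<Rightarrow> nat" where
  "excess K = dim (U K) - dim (\<Union>i\<in>{1..n} - K. U (insert i K))"

lemma U_fin_dim: "\<exists>W. finite W \<and> U {} \<subseteq> span W \<and> (\<forall>K. finite K \<longrightarrow> U K \<subseteq> span W)"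
proof -
  obtain W where W: "finite W" "U {} \<subseteq> span W" using fin_dim by blast
  have "U K \<subseteq> U {}" if "finite K" for K using that
    by (induction K rule: finite_induct) (use U_insert in blast)+
  then show ?thesis using W by blast
qed

lemma dim_mono_fin:
  assumes "X \<subseteq> Y" "subspace Y" "Y \<subseteq> span W" "finite W"
  shows "dim X \<le> dim (Y :: 'v set)"
proof -
  obtain B where B: "B \<subseteq> Y" "independent B" "Y \<subseteq> span B" "card B = dim Y"
    using basis_exists by metis
  have "finite B" using independent_span_bound[OF assms(4) B(2)] B(1) assms(3) by auto
  then show ?thesis using dim_le_card[of X B] B assms(1) by auto
qed

text \<open>The sum of all \<open>U (insert i K)\<close> is spanned by \<open>?X\<close> and
  \<open>?Y\<close>, and \<open>distr_full\<close> identifies their intersection with the sum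
  subtracted in \<open>excess (insert a K)\<close>; the dimension formula then leaves only
  \<open>dim ?X\<close>. For \<open>a = n\<close> the remaining dimensions involve indices below
  \<open>n\<close> only.\<close>

lemma excess_add:
  assumes K: "K \<subseteq> {1..n}" and a: "a \<in> {1..n}" "a \<notin> K" and A: "A = {1..n} - insert a K"
  shows "excess K + excess (insert a K) + dim (\<Union>i\<in>A. U (insert i K)) = dim (U K)"
proof -
  let ?X = "span (\<Union>i\<in>A. U (insert i K))" and ?Y = "U (insert a K)"
  obtain W where W: "finite W" "\<And>K. finite K \<Longrightarrow> U K \<subseteq> span W" using U_fin_dim by blast
  have finK: "finite K" using K finite_subset by blast
  have sub: "(\<Union>i\<in>B. U (insert i K)) \<subseteq> U K" for B K using U_insert by blast
  have XK: "?X \<subseteq> U K" using sub subspace_U by (intro span_minimal) auto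
  have "dim (?X \<union> ?Y) + dim (?X \<inter> ?Y) = dim ?X + dim ?Y"
  proof (rule dim_Un_Int)
    show "?X \<union> ?Y \<subseteq> span W"
      using XK W(2)[of K] W(2)[of "insert a K"] finK by blast
  qed (use subspace_U W in auto)
  moreover have "?X \<inter> ?Y = span (\<Union>i\<in>A. U (insert i (insert a K)))"
    using distr_full[OF K a A] by (simp add: Int_commute)
  moreover have "dim (?X \<union> ?Y) = dim (\<Union>i\<in>{1..n} - K. U (insert i K))"
  proof (rule span_eq_dim)
    have "{1..n} - K = insert a A" using A a by auto
    then have "(\<Union>i\<in>{1..n} - K. U (insert i K)) = (\<Union>i\<in>A. U (insert i K)) \<union> ?Y" by auto
    moreover have "span (?X \<union> ?Y) = span ((\<Union>i\<in>A. U (insert i K)) \<union> ?Y)"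
      by (simp add: span_Un span_span)
    ultimately show "span (?X \<union> ?Y) = span (\<Union>i\<in>{1..n} - K. U (insert i K))" by simp
  qed
  moreover have "dim (\<Union>i\<in>{1..n} - K. U (insert i K)) \<le> dim (U K)"
    using sub subspace_U W finK by (intro dim_mono_fin) auto
  moreover have "dim (\<Union>i\<in>A. U (insert i (insert a K))) \<le> dim ?Y"
    using sub subspace_U W(2)[of "insert a K"] W(1) finK by (intro dim_mono_fin) auto
  moreover have "{1..n} - insert a K = A" using A by simp
  ultimately show ?thesis unfolding excess_def by simp
qed

end

section \<open>The seminormal representation on tableaux\<close>

instantiation "fun" :: (type, real_vector) real_vector
begin

definition scaleR_fun :: "real \<Rightarrow> ('a \<Rightarrow> 'b) \<Rightarrow> 'a \<Rightarrow> 'b" where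
  "scaleR_fun r f = (\<lambda>x. r *\<^sub>R f x)"

instance
  by standard (auto simp: scaleR_fun_def fun_eq_iff algebra_simps)

end

lemma scaleR_fun_apply [simp]: "(r *\<^sub>R f) x = r *\<^sub>R f x"
  by (simp add: scaleR_fun_def)

lemma sum_fun_apply: "(\<Sum>i\<in>A. f i) x = (\<Sum>i\<in>A. f i x)"
  by (induction A rule: infinite_finite_induct) auto

definition swap_labels :: "nat \<Rightarrow> (nat \<times> nat \<Rightarrow> nat) \<Rightarrow> nat \<times> nat \<Rightarrow> nat" where
  "swap_labels i T = (\<lambda>c. transpose i (Suc i) (T c))"

lemma swap_labels_swap_labels [simp]: "swap_labels i (swap_labels i T) = T"
  by (simp add: swap_labels_def)

lemma swap_labels_commute:
  "Suc i < j \<Longrightarrow> swap_labels i (swap_labels j T) = swap_labels j (swap_labels i T)"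
  by (auto simp: swap_labels_def transpose_def fun_eq_iff)

lemma swap_labels_braid:
  "swap_labels i (swap_labels (Suc i) (swap_labels i T)) = swap_labels (Suc i) (swap_labels i (swap_labels (Suc i) T))"
  by (auto simp: swap_labels_def transpose_def fun_eq_iff)

text \<open>Convexity in the componentwise order is the property of skew diagrams on which the
  tableau arguments rest; it does not ask for connectedness.\<close>

locale convex_cells =
  fixes C :: "(nat \<times> nat) set"
  assumes finite_C: "finite C"
    and convex: "(a, b) \<in> C \<Longrightarrow> (a', b') \<in> C \<Longrightarrow> a \<le> x \<Longrightarrow> x \<le> a' \<Longrightarrow> b \<le> y \<Longrightarrow> y \<le> b' \<Longrightarrow> (x, y) \<in> C"
begin

abbreviation n where "n \<equiv> card C"

definition fillings :: "(nat \<times> nat \<Rightarrow> nat) set" where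
  "fillings = {T. bij_betw T C {1..n} \<and> (\<forall>c. c \<notin> C \<longrightarrow> T c = 0)}"

definition cell :: "(nat \<times> nat \<Rightarrow> nat) \<Rightarrow> nat \<Rightarrow> nat \<times> nat" where
  "cell T k = inv_into C T k"

definition content :: "nat \<times> nat \<Rightarrow> real" where
  "content c = real (snd c) - real (fst c)"

definition axial :: "(nat \<times> nat \<Rightarrow> nat) \<Rightarrow> nat \<Rightarrow> real" where
  "axial T i = content (cell T (Suc i)) - content (cell T i)"

lemma SYT_filling: "T \<in> SYT C \<Longrightarrow> T \<in> fillings"
  by (auto simp: SYT_def fillings_def)

lemma SYT_row: "T \<in> SYT C \<Longrightarrow> (i, j) \<in> C \<Longrightarrow> (i, j') \<in> C \<Longrightarrow> j < j' \<Longrightarrow> T (i, j) < T (i, j')"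
  by (auto simp: SYT_def)

lemma SYT_col: "T \<in> SYT C \<Longrightarrow> (i, j) \<in> C \<Longrightarrow> (i', j) \<in> C \<Longrightarrow> i < i' \<Longrightarrow> T (i, j) < T (i', j)"
  by (auto simp: SYT_def)

lemma SYT_le:
  assumes "T \<in> SYT C" "(i, j) \<in> C" "(i', j') \<in> C" "i \<le> i'" "j \<le> j'"
  shows "T (i, j) \<le> T (i', j')"
proof -
  have "(i, j') \<in> C" using convex[OF assms(2,3)] assms by auto
  then have "T (i, j) \<le> T (i, j')" "T (i, j') \<le> T (i', j')"
    using SYT_row[OF assms(1,2), of j'] SYT_col[OF assms(1) _ assms(3)] assms
    by (metis le_neq_implies_less less_imp_le order_refl)+
  then show ?thesis by simp
qed

lemma finite_SYT: "finite (SYT C)"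
proof -
  have "SYT C \<subseteq> {T. \<forall>c. (c \<in> C \<longrightarrow> T c \<in> {1..n}) \<and> (c \<notin> C \<longrightarrow> T c = 0)}"
    unfolding SYT_def bij_betw_def by auto
  then show ?thesis
    using finite_set_of_finite_funs[OF finite_C, of "{1..n}" 0] finite_subset by auto
qed

lemma cell_in: "T \<in> fillings \<Longrightarrow> k \<in> {1..n} \<Longrightarrow> cell T k \<in> C"
  unfolding cell_def fillings_def by (metis (mono_tags, lifting) bij_betw_imp_surj_on inv_into_into mem_Collect_eq)

lemma label_cell: "T \<in> fillings \<Longrightarrow> k \<in> {1..n} \<Longrightarrow> T (cell T k) = k"
  unfolding cell_def fillings_def by (metis (mono_tags, lifting) bij_betw_imp_surj_on f_inv_into_f mem_Collect_eq)

lemma cell_label: "T \<in> fillings \<Longrightarrow> c \<in> C \<Longrightarrow> cell T (T c) = c"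
  unfolding cell_def fillings_def by (metis (mono_tags, lifting) bij_betw_inv_into_left mem_Collect_eq)

lemma cell_eqI: "T \<in> fillings \<Longrightarrow> c \<in> C \<Longrightarrow> T c = k \<Longrightarrow> cell T k = c"
  using cell_label by blast

lemma label_in: "T \<in> fillings \<Longrightarrow> c \<in> C \<Longrightarrow> T c \<in> {1..n}"
  unfolding fillings_def bij_betw_def by blast

lemma label_inj: "T \<in> fillings \<Longrightarrow> c \<in> C \<Longrightarrow> d \<in> C \<Longrightarrow> T c = T d \<Longrightarrow> c = d"
  by (metis cell_label)

lemma fillings_eqI:
  assumes "T \<in> fillings" "T' \<in> fillings" "\<And>c. c \<in> C \<Longrightarrow> T c = T' c"
  shows "T = T'"
  using assms unfolding fillings_def by (auto simp: fun_eq_iff) (metis prod.exhaust)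

lemma swap_filling:
  assumes "T \<in> fillings" "1 \<le> i" "i < n"
  shows "swap_labels i T \<in> fillings"
proof -
  have "bij_betw (transpose i (Suc i)) {1..n} {1..n}"
    using assms permutes_swap_id[of i "{1..n}" "Suc i"] permutes_imp_bij by auto
  then have "bij_betw (transpose i (Suc i) \<circ> T) C {1..n}"
    using assms(1) unfolding fillings_def by (auto intro: bij_betw_trans)
  then show ?thesis using assms unfolding fillings_def swap_labels_def
    by (auto simp: comp_def transpose_def)
qed

lemma cell_swap:
  assumes "T \<in> fillings" "1 \<le> i" "i < n" "k \<in> {1..n}"
  shows "cell (swap_labels i T) k = cell T (transpose i (Suc i) k)"
proof (rule cell_eqI[OF swap_filling])
  have k: "transpose i (Suc i) k \<in> {1..n}" using assms by (auto simp: transpose_def)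
  show "cell T (transpose i (Suc i) k) \<in> C" using cell_in[OF assms(1) k] .
  show "swap_labels i T (cell T (transpose i (Suc i) k)) = k"
    by (simp add: swap_labels_def label_cell[OF assms(1) k])
qed (use assms in auto)

lemma cell_swap_simps:
  assumes "T \<in> fillings" "1 \<le> i" "i < n"
  shows "cell (swap_labels i T) i = cell T (Suc i)"
    and "cell (swap_labels i T) (Suc i) = cell T i"
    and "k \<in> {1..n} \<Longrightarrow> k \<noteq> i \<Longrightarrow> k \<noteq> Suc i \<Longrightarrow> cell (swap_labels i T) k = cell T k"
  using assms by (auto simp: cell_swap)

lemma axial_swap: "T \<in> fillings \<Longrightarrow> 1 \<le> i \<Longrightarrow> i < n \<Longrightarrow> axial (swap_labels i T) i = - axial T i"
  by (simp add: axial_def cell_swap_simps)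

text \<open>If \<open>i + 1\<close> sits weakly south-east of \<open>i\<close>, every cell of the
  rectangle between them lies in \<open>C\<close> and carries \<open>i\<close> or
  \<open>i + 1\<close>, so the two are neighbours. Otherwise they are strictly north-east or
  south-west of each other, where both coordinates contribute to the axial distance with the same
  sign.\<close>

lemma SYT_adjacent_cases:
  assumes T: "T \<in> SYT C" and i: "1 \<le> i" "i < n"
  obtains (row) "fst (cell T i) = fst (cell T (Suc i))" "axial T i = 1"
  | (col) "snd (cell T i) = snd (cell T (Suc i))" "fst (cell T i) < fst (cell T (Suc i))" "axial T i = -1"
  | (ne) "fst (cell T (Suc i)) < fst (cell T i)" "snd (cell T i) < snd (cell T (Suc i))" "axial T i \<ge> 2"
  | (sw) "fst (cell T i) < fst (cell T (Suc i))" "snd (cell T (Suc i)) < snd (cell T i)" "axial T i \<le> -2"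
proof -
  note F = SYT_filling[OF T]
  obtain a b where x: "cell T i = (a, b)" by (metis prod.exhaust)
  obtain a' b' where y: "cell T (Suc i) = (a', b')" by (metis prod.exhaust)
  have xC: "(a, b) \<in> C" "T (a, b) = i" using cell_in[OF F, of i] label_cell[OF F, of i] i x by auto
  have yC: "(a', b') \<in> C" "T (a', b') = Suc i" using cell_in[OF F, of "Suc i"] label_cell[OF F, of "Suc i"] i y by auto
  have ax: "axial T i = (real b' - real a') - (real b - real a)" by (simp add: axial_def content_def x y)
  have no_nw: "\<not> (a' \<le> a \<and> b' \<le> b)" using SYT_le[OF T yC(1) xC(1)] xC yC by auto
  have between: "(c, d) = (a, b) \<or> (c, d) = (a', b')"
    if "a \<le> c" "c \<le> a'" "b \<le> d" "d \<le> b'" for c d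
  proof -
    have c: "(c, d) \<in> C" using convex[OF xC(1) yC(1)] that by auto
    have "i \<le> T (c, d)" "T (c, d) \<le> Suc i"
      using SYT_le[OF T xC(1) c] SYT_le[OF T c yC(1)] that xC yC by auto
    then have "T (c, d) = T (a, b) \<or> T (c, d) = T (a', b')" using xC yC by auto
    then show ?thesis using label_inj[OF F] c xC yC by metis
  qed
  consider "a = a'" | "b = b'" "a < a'" | "a' < a" "b < b'" | "a < a'" "b' < b" | "a < a'" "b < b'"
    using no_nw by linarith
  then show ?thesis
  proof cases
    case 1
    then have "b < b'" using no_nw by auto
    then have "b' = Suc b" using between[of a "Suc b"] 1 by auto
    then show ?thesis using row 1 x y ax by auto
  next
    case 2
    then have "a' = Suc a" using between[of "Suc a" b] by auto
    then show ?thesis using col 2 x y ax by auto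
  next
    case 3
    then show ?thesis using ne x y ax by auto
  next
    case 4
    then show ?thesis using sw x y ax by auto
  next
    case 5
    then show ?thesis using between[of a b'] by auto
  qed
qed

lemma axial_nonzero: "T \<in> SYT C \<Longrightarrow> 1 \<le> i \<Longrightarrow> i < n \<Longrightarrow> axial T i \<noteq> 0"
  by (erule SYT_adjacent_cases) auto

lemma axial_eq_1: "T \<in> SYT C \<Longrightarrow> 1 \<le> i \<Longrightarrow> i < n \<Longrightarrow> axial T i = 1 \<longleftrightarrow> fst (cell T i) = fst (cell T (Suc i))"
  by (erule SYT_adjacent_cases) auto

lemma Des_iff:
  assumes "T \<in> SYT C" "1 \<le> i" "i < n"
  shows "i \<in> Des_SYT C T \<longleftrightarrow> fst (cell T i) < fst (cell T (Suc i))"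
proof -
  note F = SYT_filling[OF assms(1)]
  have *: "cell T i \<in> C" "cell T (Suc i) \<in> C" "T (cell T i) = i" "T (cell T (Suc i)) = Suc i"
    using cell_in[OF F] label_cell[OF F] assms by auto
  show ?thesis
  proof
    assume "i \<in> Des_SYT C T"
    then obtain c d where "c \<in> C" "d \<in> C" "T c = i" "T d = i + 1" "fst c < fst d"
      unfolding Des_SYT_def by blast
    then show "fst (cell T i) < fst (cell T (Suc i))" using cell_eqI[OF F, of c i] cell_eqI[OF F, of d "Suc i"] by simp
  next
    assume "fst (cell T i) < fst (cell T (Suc i))"
    then have "\<exists>c\<in>C. \<exists>d\<in>C. T c = i \<and> T d = i + 1 \<and> fst c < fst d"
      using * by (metis Suc_eq_plus1)
    then show "i \<in> Des_SYT C T" unfolding Des_SYT_def using assms by simp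
  qed
qed

lemma Des_subset: "Des_SYT C T \<subseteq> {1..n - 1}"
  by (auto simp: Des_SYT_def)

lemma swap_SYT:
  assumes T: "T \<in> SYT C" and i: "1 \<le> i" "i < n"
    and "fst (cell T i) \<noteq> fst (cell T (Suc i))" "snd (cell T i) \<noteq> snd (cell T (Suc i))"
  shows "swap_labels i T \<in> SYT C"
proof -
  note F = SYT_filling[OF T]
  have "swap_labels i T c < swap_labels i T d"
    if cd: "c \<in> C" "d \<in> C" "T c < T d" and "fst c = fst d \<or> snd c = snd d" for c d
  proof -
    have "\<not> (T c = i \<and> T d = Suc i)" using that cell_eqI[OF F] assms by metis
    then show ?thesis using cd by (auto simp: swap_labels_def transpose_def)
  qed
  then show ?thesis using swap_filling[OF F i] T unfolding SYT_def fillings_def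
    by auto
qed

definition col_viol :: "(nat \<times> nat \<Rightarrow> nat) \<Rightarrow> bool" where
  "col_viol T \<longleftrightarrow> (\<exists>r r' s. (r, s) \<in> C \<and> (r', s) \<in> C \<and> r < r' \<and> T (r, s) > T (r', s))"

text \<open>Young's seminormal form, with the off-diagonal entry normalized to
  \<open>1 - 1 / axial T i\<close>, so that fixed vectors are described without coefficients
  (\<open>act_fixed_iff\<close>). Where the swap is not standard the second term drops out for
  \<open>f\<close> in \<open>E\<close>.\<close>

definition act :: "nat \<Rightarrow> ((nat \<times> nat \<Rightarrow> nat) \<Rightarrow> real) \<Rightarrow> (nat \<times> nat \<Rightarrow> nat) \<Rightarrow> real" where
  "act i f = (\<lambda>T. if T \<in> SYT C then f T / axial T i + (1 - 1 / axial T i) * f (swap_labels i T) else 0)"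

text \<open>
  The Coxeter relations are checked for \<open>free_act\<close>, which acts on functions on all fillings and needs
  no case distinction. It agrees with \<open>act\<close> on standard tableaux as long as the function
  vanishes on fillings with a column violation, a property that \<open>free_act\<close> preserves.
\<close>

definition free_act :: "nat \<Rightarrow> ((nat \<times> nat \<Rightarrow> nat) \<Rightarrow> real) \<Rightarrow> (nat \<times> nat \<Rightarrow> nat) \<Rightarrow> real" where
  "free_act i f = (\<lambda>T. f T / axial T i + (1 - 1 / axial T i) * f (swap_labels i T))"

definition E :: "((nat \<times> nat \<Rightarrow> nat) \<Rightarrow> real) set" where
  "E = {f. \<forall>T. T \<notin> SYT C \<longrightarrow> f T = 0}"

lemma subspace_E: "subspace E"
  by (auto simp: subspace_def E_def)

lemma act_E: "act i f \<in> E"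
  by (simp add: act_def E_def)

lemma linear_act: "linear (act i)"
  by (rule linearI) (auto simp: act_def fun_eq_iff algebra_simps add_divide_distrib)

lemma act_act:
  assumes "f \<in> E" "1 \<le> i" "i < n"
  shows "act i (act i f) = f"
proof
  fix T
  show "act i (act i f) T = f T"
  proof (cases "T \<in> SYT C")
    case False
    then show ?thesis using assms by (simp add: act_def E_def)
  next
    case T: True
    note F = SYT_filling[OF T]
    have nz: "axial T i \<noteq> 0" using axial_nonzero T assms by blast
    show ?thesis
    proof (cases "swap_labels i T \<in> SYT C")
      case True
      \<comment> \<open>With d the axial distance, the diagonal terms give 1/d^2 + (1 - 1/d)(1 +
        1/d) = 1 and the mixed terms cancel, because swapping negates d.\<close>
      then show ?thesis using T nz axial_swap[OF F] assms
        by (simp add: act_def field_simps)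
    next
      case False
      then have f0: "f (swap_labels i T) = 0" using assms by (simp add: E_def)
      have "axial T i = 1 \<or> axial T i = -1"
        using SYT_adjacent_cases[OF T assms(2,3)] False swap_SYT[OF T assms(2,3)]
        by (metis nat_neq_iff)
      then show ?thesis using T False f0 by (auto simp: act_def)
    qed
  qed
qed

text \<open>The two failures of standardness match the two reasons why the illegal term of
  \<open>free_act\<close> vanishes: a zero coefficient for row neighbours, a zero of the function
  for column neighbours.\<close>

lemma swap_not_SYT:
  assumes "T \<in> SYT C" "swap_labels i T \<notin> SYT C" "1 \<le> i" "i < n"
  shows "axial T i = 1 \<or> col_viol (swap_labels i T)"
  using assms(1,3,4)
proof (cases rule: SYT_adjacent_cases)
  case col
  note F = SYT_filling[OF assms(1)]
  obtain a b where x: "cell T i = (a, b)" by (metis prod.exhaust)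
  obtain a' where y: "cell T (Suc i) = (a', b)" using col x by (metis prod.exhaust snd_conv)
  have "(a, b) \<in> C" "(a', b) \<in> C" "T (a, b) = i" "T (a', b) = Suc i" "a < a'"
    using cell_in[OF F, of i] cell_in[OF F, of "Suc i"] label_cell[OF F, of i] label_cell[OF F, of "Suc i"]
      assms x y col by auto
  then show ?thesis unfolding col_viol_def swap_labels_def
    by (intro disjI2 exI[of _ a] exI[of _ a'] exI[of _ b]) auto
next
  case ne
  then show ?thesis using swap_SYT[OF assms(1,3,4)] assms(2) by auto
next
  case sw
  then show ?thesis using swap_SYT[OF assms(1,3,4)] assms(2) by auto
qed auto

text \<open>If the swap repairs all column violations, the offending pair is \<open>i\<close>
  directly below \<open>i + 1\<close>: a cell between them would still be out of order with one of
  them. Then the axial distance is 1, and the value at the repaired filling has coefficient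
  0.\<close>

lemma free_act_col_viol:
  assumes g: "\<And>T. T \<in> fillings \<Longrightarrow> col_viol T \<Longrightarrow> g T = 0"
    and T: "T \<in> fillings" "col_viol T" and i: "1 \<le> i" "i < n"
  shows "free_act i g T = 0"
proof (cases "col_viol (swap_labels i T)")
  case True
  then show ?thesis using g T swap_filling[OF T(1) i] by (simp add: free_act_def)
next
  case False
  obtain r r' s where rs: "(r, s) \<in> C" "(r', s) \<in> C" "r < r'" "T (r, s) > T (r', s)"
    using T(2) by (auto simp: col_viol_def)
  have nv: "swap_labels i T (x, s) \<le> swap_labels i T (y, s)" if "(x, s) \<in> C" "(y, s) \<in> C" "x < y" for x y
    using False that unfolding col_viol_def by (meson not_less)
  have "swap_labels i T (r, s) \<le> swap_labels i T (r', s)" using nv rs by blast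
  then have eq: "T (r', s) = i" "T (r, s) = Suc i"
    using rs(4) by (auto simp: swap_labels_def transpose_def split: if_splits)
  have "r' = Suc r"
  proof (rule ccontr)
    assume "r' \<noteq> Suc r"
    then have lt: "r < Suc r" "Suc r < r'" using rs by auto
    have c: "(Suc r, s) \<in> C" using convex[OF rs(1,2)] lt by auto
    have "T (Suc r, s) \<noteq> i" "T (Suc r, s) \<noteq> Suc i"
      using label_inj[OF T(1) c] rs eq lt by (metis Pair_inject nat_neq_iff)+
    then show False
      using nv[OF rs(1) c lt(1)] nv[OF c rs(2) lt(2)] eq by (auto simp: swap_labels_def)
  qed
  moreover have "cell T i = (r', s)" "cell T (Suc i) = (r, s)"
    using cell_eqI[OF T(1)] rs eq by auto
  ultimately have "axial T i = 1" by (simp add: axial_def content_def)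
  then show ?thesis using g T by (simp add: free_act_def)
qed

lemma free_act_eq_act:
  assumes g: "\<And>T. T \<in> fillings \<Longrightarrow> col_viol T \<Longrightarrow> g T = 0"
    and h: "h \<in> E" and gh: "\<And>T. T \<in> SYT C \<Longrightarrow> g T = h T"
    and T: "T \<in> SYT C" and i: "1 \<le> i" "i < n"
  shows "free_act i g T = act i h T"
proof (cases "swap_labels i T \<in> SYT C")
  case True
  then show ?thesis using T gh by (simp add: free_act_def act_def)
next
  case False
  then have "h (swap_labels i T) = 0" using h by (simp add: E_def)
  moreover have "axial T i = 1 \<or> g (swap_labels i T) = 0"
    using swap_not_SYT[OF T False i] g swap_filling[OF SYT_filling[OF T] i] by blast
  ultimately show ?thesis using T gh by (auto simp: free_act_def act_def)
qed

lemma SYT_not_col_viol: "T \<in> SYT C \<Longrightarrow> \<not> col_viol T"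
  using SYT_col unfolding col_viol_def by (metis less_asym)

lemma act_act_act:
  assumes f: "f \<in> E" and T: "T \<in> SYT C" and ijk: "1 \<le> i" "i < n" "1 \<le> j" "j < n" "1 \<le> k" "k < n"
  shows "act i (act j (act k f)) T = free_act i (free_act j (free_act k f)) T"
proof -
  have v0: "f T = 0" if "T \<in> fillings" "col_viol T" for T
    using f that SYT_not_col_viol unfolding E_def by blast
  note v1 = free_act_col_viol[OF v0 _ _ ijk(5,6)]
  note v2 = free_act_col_viol[OF v1 _ _ ijk(3,4)]
  have e1: "free_act k f T = act k f T" if "T \<in> SYT C" for T
    using free_act_eq_act[OF v0 f _ that ijk(5,6)] by simp
  have e2: "free_act j (free_act k f) T = act j (act k f) T" if "T \<in> SYT C" for T
    using free_act_eq_act[OF v1 act_E e1 that ijk(3,4)] by simp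
  show ?thesis using free_act_eq_act[OF v2 act_E e2 T ijk(1,2)] by simp
qed

lemma act_commute:
  assumes f: "f \<in> E" and ij: "1 \<le> i" "Suc i < j" "j < n"
  shows "act i (act j f) = act j (act i f)"
proof
  fix T
  show "act i (act j f) T = act j (act i f) T"
  proof (cases "T \<in> SYT C")
    case False
    then show ?thesis by (simp add: act_def)
  next
    case T: True
    note F = SYT_filling[OF T]
    \<comment> \<open>Expanding the two sides reaches the double swap through different single
      swaps. If one of these is not standard, its path is lost on one side only, so \<open>f\<close>
      has to vanish at the double swap.\<close>
    have iff: "swap_labels b T \<notin> SYT C \<Longrightarrow> f (swap_labels a (swap_labels b T)) = 0"
      if ab: "(a, b) = (i, j) \<or> (a, b) = (j, i)" for a b
    proof -
      assume n: "swap_labels b T \<notin> SYT C"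
      have b: "1 \<le> b" "b < n" and a: "1 \<le> a" "a < n" using ab ij by auto
      have c: "cell (swap_labels b T) a = cell T a" "cell (swap_labels b T) (Suc a) = cell T (Suc a)"
        using cell_swap_simps(3)[OF F b] ab ij by auto
      have c': "cell (swap_labels a (swap_labels b T)) b = cell T (Suc b)"
        "cell (swap_labels a (swap_labels b T)) (Suc b) = cell T b"
        using cell_swap_simps(3)[OF swap_filling[OF F b] a, of b] cell_swap_simps(3)[OF swap_filling[OF F b] a, of "Suc b"]
          cell_swap_simps(1,2)[OF F b] ab ij by auto
      have "swap_labels a (swap_labels b T) \<notin> SYT C"
      proof
        assume S: "swap_labels a (swap_labels b T) \<in> SYT C"
        have "fst (cell T b) = fst (cell T (Suc b)) \<or> snd (cell T b) = snd (cell T (Suc b))"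
          using n swap_SYT[OF T b] by blast
        then show False
        proof
          assume "fst (cell T b) = fst (cell T (Suc b))"
          then show False using axial_eq_1[OF T b] axial_eq_1[OF S b] c' unfolding axial_def by simp
        next
          assume e: "snd (cell T b) = snd (cell T (Suc b))"
          show False using T b
          proof (cases rule: SYT_adjacent_cases)
            case row
            then show False using e by (simp add: axial_def content_def)
          next
            case col
            show False using S b by (cases rule: SYT_adjacent_cases) (use col c' in auto)
          qed (use e in auto)
        qed
      qed
      then show "f (swap_labels a (swap_labels b T)) = 0" using f by (simp add: E_def)
    qed
    have f0: "swap_labels b T \<notin> SYT C \<Longrightarrow> f (swap_labels b T) = 0" for b using f by (simp add: E_def)
    have ax: "axial (swap_labels i T) j = axial T j" "axial (swap_labels j T) i = axial T i"
      using cell_swap_simps(3)[OF F] ij by (auto simp: axial_def)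
    show ?thesis
      using T iff[of i j] iff[of j i] f0 ax swap_labels_commute[OF ij(2), of T]
      by (simp add: act_def algebra_simps add_divide_distrib diff_divide_distrib)
  qed
qed

lemma act_braid:
  assumes f: "f \<in> E" and i: "1 \<le> i" "Suc i < n"
  shows "act i (act (Suc i) (act i f)) = act (Suc i) (act i (act (Suc i) f))"
proof
  fix T
  let ?i = "swap_labels i" and ?j = "swap_labels (Suc i)"
  have i': "i < n" "1 \<le> Suc i" using i by auto
  show "act i (act (Suc i) (act i f)) T = act (Suc i) (act i (act (Suc i) f)) T"
  proof (cases "T \<in> SYT C")
    case False
    then show ?thesis by (simp add: act_def)
  next
    case T: True
    note F = SYT_filling[OF T]
    note Fi = swap_filling[OF _ i(1) i'(1)] and Fj = swap_filling[OF _ i'(2) i(2)]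
    note cs = cell_swap_simps[OF _ i(1) i'(1)] cell_swap_simps[OF _ i'(2) i(2)]
    define a b c where "a = content (cell T i)" "b = content (cell T (Suc i))" "c = content (cell T (Suc (Suc i)))"
    have ba: "b - a \<noteq> 0" "c - b \<noteq> 0"
      using axial_nonzero[OF T i(1) i'(1)] axial_nonzero[OF T i'(2) i(2)] by (simp_all add: axial_def a_b_c_def)
    \<comment> \<open>Equal contents would put \<open>i + 2\<close> strictly south-east of
      \<open>i\<close>, and both remaining corners of their rectangle would have to carry
      \<open>i + 1\<close>.\<close>
    have ca: "c - a \<noteq> 0"
    proof
      assume eq: "c - a = 0"
      obtain p q where x: "cell T i = (p, q)" by (metis prod.exhaust)
      obtain p' q' where z: "cell T (Suc (Suc i)) = (p', q')" by (metis prod.exhaust)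
      have xC: "(p, q) \<in> C" "T (p, q) = i" using cell_in[OF F, of i] label_cell[OF F, of i] i x by auto
      have zC: "(p', q') \<in> C" "T (p', q') = Suc (Suc i)"
        using cell_in[OF F, of "Suc (Suc i)"] label_cell[OF F, of "Suc (Suc i)"] i z by auto
      have d: "real q' - real p' = real q - real p" using eq by (simp add: a_b_c_def content_def x z)
      have "q < q'" using d SYT_le[OF T zC(1) xC(1)] xC zC by force
      moreover have "p < p'" using calculation d by linarith
      ultimately have "p < p'" "q < q'" by auto
      then have m: "(p, q') \<in> C" "(p', q) \<in> C" using convex[OF xC(1) zC(1)] by auto
      have "T (p, q') = Suc i" "T (p', q) = Suc i"
        using SYT_row[OF T xC(1) m(1)] SYT_col[OF T m(1) zC(1)] SYT_col[OF T xC(1) m(2)] SYT_row[OF T m(2) zC(1)]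
          \<open>p < p'\<close> \<open>q < q'\<close> xC zC by auto
      then show False using label_inj[OF F m] \<open>p < p'\<close> by auto
    qed
    have ax: "axial T i = b - a" "axial T (Suc i) = c - b"
      "axial (?i T) i = a - b" "axial (?i T) (Suc i) = c - a"
      "axial (?j T) i = c - a" "axial (?j T) (Suc i) = b - c"
      "axial (?i (?j T)) i = a - c" "axial (?i (?j T)) (Suc i) = b - a"
      "axial (?j (?i T)) i = c - b" "axial (?j (?i T)) (Suc i) = a - c"
      using F i by (simp_all add: axial_def a_b_c_def cs Fi Fj)
    have br: "?i (?j (?i T)) = ?j (?i (?j T))" by (rule swap_labels_braid)
    define v1 v2 v3 v4 v5 v6 where "v1 = f T" "v2 = f (?i T)" "v3 = f (?j T)" "v4 = f (?i (?j T))" "v5 = f (?j (?i T))" "v6 = f (?j (?i (?j T)))"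
    define p q where "p = b - a" "q = c - b"
    have pq: "c - a = p + q" "a - b = - p" "b - c = - q" "a - c = - (p + q)" "b - a = p" "c - b = q" by (auto simp: p_q_def)
    have nz: "p \<noteq> 0" "q \<noteq> 0" "p + q \<noteq> 0" using ba ca pq by auto
    have L: "free_act i (free_act (Suc i) (free_act i f)) T =
      (1/p) * ((1/q) * ((1/p) * v1 + (1 - 1/p) * v2) + (1 - 1/q) * ((1/(p+q)) * v3 + (1 - 1/(p+q)) * v4))
      + (1 - 1/p) * ((1/(p+q)) * (-(1/p) * v2 + (1 + 1/p) * v1) + (1 - 1/(p+q)) * ((1/q) * v5 + (1 - 1/q) * v6))"
      by (simp add: free_act_def ax br pq v1_v2_v3_v4_v5_v6_def)
    have R: "free_act (Suc i) (free_act i (free_act (Suc i) f)) T =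
      (1/q) * ((1/p) * ((1/q) * v1 + (1 - 1/q) * v3) + (1 - 1/p) * ((1/(p+q)) * v2 + (1 - 1/(p+q)) * v5))
      + (1 - 1/q) * ((1/(p+q)) * (-(1/q) * v3 + (1 + 1/q) * v1) + (1 - 1/(p+q)) * ((1/p) * v4 + (1 - 1/p) * v6))"
      by (simp add: free_act_def ax br pq v1_v2_v3_v4_v5_v6_def)
    \<comment> \<open>Both sides are polynomials in the reciprocals of \<open>p\<close>,
      \<open>q\<close> and \<open>p + q\<close>. Their difference is a multiple of
      \<open>u * v - w * (u + v)\<close>, which vanishes by partial fractions.\<close>
    define u v w where "u = 1/p" "v = 1/q" "w = 1/(p+q)"
    have key: "u * v = w * (u + v)" using nz by (simp add: u_v_w_def field_simps)
    have "free_act i (free_act (Suc i) (free_act i f)) T - free_act (Suc i) (free_act i (free_act (Suc i) f)) T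
      = (u * v - w * (u + v)) * ((u - v) * v1 + (1 - u) * v2 - (1 - v) * v3)"
      unfolding L R u_v_w_def[symmetric] by (simp add: ring_distribs mult_ac)
    then have "free_act i (free_act (Suc i) (free_act i f)) T = free_act (Suc i) (free_act i (free_act (Suc i) f)) T"
      using key by simp
    then show ?thesis using act_act_act[OF f T] i i' by simp
  qed
qed

subsection \<open>Rotation by the long cycle\<close>

text \<open>The product of the simple transpositions 1 to \<open>k\<close>, with
  \<open>act k\<close> applied first; \<open>rot1 k\<close> is the same product with all indices
  raised by one.\<close>

primrec rot :: "nat \<Rightarrow> ((nat \<times> nat \<Rightarrow> nat) \<Rightarrow> real) \<Rightarrow> (nat \<times> nat \<Rightarrow> nat) \<Rightarrow> real" where
  "rot 0 f = f"
| "rot (Suc k) f = rot k (act (Suc k) f)"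

primrec rot1 :: "nat \<Rightarrow> ((nat \<times> nat \<Rightarrow> nat) \<Rightarrow> real) \<Rightarrow> (nat \<times> nat \<Rightarrow> nat) \<Rightarrow> real" where
  "rot1 0 f = f"
| "rot1 (Suc k) f = rot1 k (act (Suc (Suc k)) f)"

lemma rot_E: "f \<in> E \<Longrightarrow> rot k f \<in> E"
  by (induction k arbitrary: f) (auto simp: act_E)

lemma linear_rot: "linear (rot k)"
proof (induction k)
  case 0
  then show ?case by (auto intro: linearI)
next
  case (Suc k)
  have "rot (Suc k) = rot k \<circ> act (Suc k)" by auto
  then show ?case using linear_compose[OF linear_act Suc] by (simp only:)
qed

lemma rot_act_far: "f \<in> E \<Longrightarrow> Suc k < i \<Longrightarrow> i < n \<Longrightarrow> rot k (act i f) = act i (rot k f)"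
proof (induction k arbitrary: f)
  case (Suc k)
  then show ?case using act_commute[of f "Suc k" i] by (simp add: act_E)
qed simp

text \<open>Conjugation by the cycle raises the index of a reflection: the braid relation does it at
  the factors \<open>i\<close> and \<open>i + 1\<close>, and all other factors commute past.\<close>

lemma rot_act: "f \<in> E \<Longrightarrow> 1 \<le> i \<Longrightarrow> i < k \<Longrightarrow> k < n \<Longrightarrow> rot k (act i f) = act (Suc i) (rot k f)"
proof (induction k arbitrary: f)
  case (Suc k)
  show ?case
  proof (cases "i = k")
    case True
    then obtain k' where k': "k = Suc k'" using Suc by (cases k) auto
    then show ?thesis
      using True Suc.prems act_braid[of f k] rot_act_far[of "act k (act (Suc k) f)" k' "Suc k"]
      by (simp add: act_E)
  next
    case False
    then have "act (Suc k) (act i f) = act i (act (Suc k) f)"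
      using Suc.prems act_commute[of f i "Suc k"] by simp
    then show ?thesis using False Suc.prems Suc.IH[of "act (Suc k) f"] by (simp add: act_E)
  qed
qed simp

lemma rot_Suc_rot1: "rot (Suc k) f = act 1 (rot1 k f)"
  by (induction k arbitrary: f) auto

lemma rot_rot: "f \<in> E \<Longrightarrow> Suc k < n \<Longrightarrow> rot (n - 1) (rot k f) = rot1 k (rot (n - 1) f)"
proof (induction k arbitrary: f)
  case (Suc k)
  then show ?case using rot_act[of f "Suc k" "n - 1"] by (simp add: act_E)
qed simp

definition R where "R = rot (n - 1)"

lemma R_E: "f \<in> E \<Longrightarrow> R f \<in> E"
  by (simp add: R_def rot_E)

lemma linear_R: "linear R"
  by (simp add: R_def linear_rot)

text \<open>Moving the outer \<open>R\<close> past the first \<open>n - 2\<close> factors of the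
  inner one raises their indices, and the extra \<open>act 1\<close> completes them to a full
  \<open>R\<close>. This relation closes the cycle: it carries \<open>V (n - 1)\<close> to
  \<open>V n\<close>, while \<open>V n\<close> goes to \<open>V 1\<close> by definition.\<close>

lemma act_R_R:
  assumes "n \<ge> 2" "f \<in> E"
  shows "act 1 (R (R f)) = R (R (act (n - 1) f))"
proof -
  obtain m where m: "n = Suc (Suc m)" using assms(1) by (metis Suc_le_D numeral_2_eq_2 Suc_le_mono)
  have "R (R f) = rot (n - 1) (rot m (act (n - 1) f))" by (simp add: R_def m)
  also have "\<dots> = rot1 m (R (act (n - 1) f))" unfolding R_def using m by (intro rot_rot act_E) simp
  finally have "act 1 (R (R f)) = rot (Suc m) (R (act (n - 1) f))" by (simp only: rot_Suc_rot1)
  then show ?thesis by (simp add: R_def m)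
qed

lemma rot_bij: "k < n \<Longrightarrow> bij_betw (rot k) E E"
proof (induction k)
  case 0
  then show ?case by (simp add: bij_betw_def inj_on_def image_def)
next
  case (Suc k)
  have "bij_betw (act (Suc k)) E E"
    using Suc.prems by (intro bij_betw_byWitness[of _ "act (Suc k)"]) (auto simp: act_act act_E)
  then have "bij_betw (rot k \<circ> act (Suc k)) E E" using Suc by (auto intro: bij_betw_trans)
  moreover have "rot (Suc k) = rot k \<circ> act (Suc k)" by auto
  ultimately show ?case by (simp only:)
qed

lemma R_bij: "n \<ge> 2 \<Longrightarrow> bij_betw R E E"
  unfolding R_def by (rule rot_bij) simp

lemma R_eq_iff: "n \<ge> 2 \<Longrightarrow> f \<in> E \<Longrightarrow> g \<in> E \<Longrightarrow> R f = R g \<longleftrightarrow> f = g"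
  using R_bij unfolding bij_betw_def inj_on_def by blast

text \<open>\<open>V n\<close> is the fixed space of the transposition of 1 and \<open>n\<close>,
  which is \<open>act 1\<close> conjugated by \<open>R\<close>; the equation is stated after
  applying \<open>R\<close> to avoid an inverse.\<close>

definition V :: "nat \<Rightarrow> ((nat \<times> nat \<Rightarrow> nat) \<Rightarrow> real) set" where
  "V i = (if i = n then {f \<in> E. act 1 (R f) = R f} else {f \<in> E. act i f = f})"

lemma V_R:
  assumes n: "n \<ge> 2" and i: "i \<in> {1..n}" and f: "f \<in> E"
  shows "R f \<in> V (i mod n + 1) \<longleftrightarrow> f \<in> V i"
proof -
  consider "i = n" | "i = n - 1" "i \<noteq> n" | "i < n - 1" using i by fastforce
  then show ?thesis
  proof cases
    case 1
    then show ?thesis using n f by (auto simp: V_def R_E)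
  next
    case 2
    then have "i mod n + 1 = n" using n by auto
    then show ?thesis
      using 2 n f act_R_R[OF n f] by (simp add: V_def R_E R_eq_iff act_E)
  next
    case 3
    then have m: "i mod n + 1 = Suc i" by simp
    have "act (Suc i) (R f) = R (act i f)" using rot_act[OF f, of i "n - 1"] 3 i by (simp add: R_def)
    moreover have "Suc i \<noteq> n" "i \<noteq> n" using 3 by auto
    ultimately show ?thesis using 3 n f m by (simp add: V_def R_E R_eq_iff act_E)
  qed
qed

definition U :: "nat set \<Rightarrow> ((nat \<times> nat \<Rightarrow> nat) \<Rightarrow> real) set" where
  "U K = {f \<in> E. \<forall>i\<in>K \<inter> {1..n}. f \<in> V i}"

lemma subspace_V: "subspace (V i)"
proof -
  have "linear (\<lambda>f. act 1 (R f))" using linear_compose[OF linear_R linear_act] by (simp add: comp_def)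
  then show ?thesis
    using subspace_E linear_act linear_R unfolding V_def subspace_def
    by (auto simp: linear_add[OF linear_act] linear_scale[OF linear_act] linear_0[OF linear_act]
        linear_add[OF linear_R] linear_scale[OF linear_R] linear_0[OF linear_R])
qed

lemma subspace_U: "subspace (U K)"
proof -
  have "U K = E \<inter> (\<Inter>i\<in>K \<inter> {1..n}. V i)" by (auto simp: U_def)
  then show ?thesis using subspace_E subspace_V
    by (auto intro!: subspace_inter subspace_Inter)
qed

lemma U_insert: "U (insert i K) \<subseteq> U K"
  by (auto simp: U_def)

lemma U_E: "U K \<subseteq> E"
  by (auto simp: U_def)

lemma next_in: "n \<ge> 2 \<Longrightarrow> i mod n + 1 \<in> {1..n}"
  using mod_less_divisor[of n i] by (simp only: atLeastAtMost_iff) linarith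

lemma U_shift:
  assumes n: "n \<ge> 2" and K: "K \<subseteq> {1..n}"
  shows "U (cshift n K) = R ` U K"
proof
  show "R ` U K \<subseteq> U (cshift n K)"
    using K V_R[OF n] R_E unfolding U_def cshift_def by auto
  show "U (cshift n K) \<subseteq> R ` U K"
  proof
    fix g assume g: "g \<in> U (cshift n K)"
    then obtain f where f: "f \<in> E" "g = R f" using R_bij[OF n] U_E unfolding bij_betw_def by blast
    have "f \<in> V i" if "i \<in> K" for i
    proof -
      have "i mod n + 1 \<in> cshift n K \<inter> {1..n}" using that next_in[OF n] by (auto simp: cshift_def)
      then have "R f \<in> V (i mod n + 1)" using g f unfolding U_def by blast
      then show ?thesis using V_R[OF n _ f(1)] that K by blast
    qed
    then have "f \<in> U K" using f by (auto simp: U_def)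
    then show "g \<in> R ` U K" using f by blast
  qed
qed

text \<open>\<open>act i f T - f T\<close> is the product of \<open>1 - 1 / axial T i\<close> and
  \<open>f (swap_labels i T) - f T\<close>, and the first factor vanishes exactly for row
  neighbours. For column neighbours the condition amounts to \<open>f T = 0\<close>, because the
  swap is not standard and \<open>f\<close> is in \<open>E\<close>.\<close>

lemma act_fixed_iff:
  assumes f: "f \<in> E" and i: "1 \<le> i" "i < n"
  shows "act i f = f \<longleftrightarrow> (\<forall>T\<in>SYT C. fst (cell T i) \<noteq> fst (cell T (Suc i)) \<longrightarrow> f (swap_labels i T) = f T)"
proof -
  have "act i f = f \<longleftrightarrow> (\<forall>T\<in>SYT C. act i f T = f T)"
    using f by (auto simp: fun_eq_iff E_def act_def)
  also have "\<dots> \<longleftrightarrow> (\<forall>T\<in>SYT C. fst (cell T i) \<noteq> fst (cell T (Suc i)) \<longrightarrow> f (swap_labels i T) = f T)"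
  proof (intro ball_cong refl)
    fix T assume T: "T \<in> SYT C"
    have nz: "axial T i \<noteq> 0" using axial_nonzero[OF T i] .
    have "act i f T = f T \<longleftrightarrow> (1 - 1 / axial T i) * (f (swap_labels i T) - f T) = 0"
      using T by (auto simp: act_def algebra_simps)
    also have "\<dots> \<longleftrightarrow> axial T i = 1 \<or> f (swap_labels i T) = f T" using nz by auto
    finally show "act i f T = f T \<longleftrightarrow> (fst (cell T i) \<noteq> fst (cell T (Suc i)) \<longrightarrow> f (swap_labels i T) = f T)"
      using axial_eq_1[OF T i] by blast
  qed
  finally show ?thesis .
qed

subsection \<open>The basis adapted to descents\<close>

text \<open>\<open>block T v\<close> numbers the maximal descent-free run of labels of \<open>T\<close> that contains \<open>v\<close>.\<close>

definition block :: "(nat \<times> nat \<Rightarrow> nat) \<Rightarrow> nat \<Rightarrow> nat" where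
  "block T v = card {d \<in> Des_SYT C T. d < v}"

lemma finite_Des: "finite (Des_SYT C T)"
  using Des_subset finite_subset by blast

lemma block_mono: "u \<le> v \<Longrightarrow> block T u \<le> block T v"
  unfolding block_def using finite_Des by (intro card_mono) auto

lemma block_less: "block T u < block T v \<Longrightarrow> u < v"
  using block_mono[of v u T] by (meson leD not_less)

lemma block_eq_no_des:
  assumes "block T u = block T v" "d \<in> Des_SYT C T" "u \<le> d" "d < v"
  shows False
proof -
  have "d \<in> {d \<in> Des_SYT C T. d < v}" "d \<notin> {d \<in> Des_SYT C T. d < u}"
    using assms by simp_all
  moreover have "{d \<in> Des_SYT C T. d < u} \<subseteq> {d \<in> Des_SYT C T. d < v}"
    using assms(3,4) by (simp add: subset_iff)
  ultimately have "{d \<in> Des_SYT C T. d < u} \<subset> {d \<in> Des_SYT C T. d < v}" by blast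
  then have "block T u < block T v" unfolding block_def using finite_Des by (intro psubset_card_mono) simp
  then show False using assms by simp
qed

lemma block_Suc: "i \<notin> Des_SYT C T \<Longrightarrow> block T (Suc i) = block T i"
  unfolding block_def by (rule arg_cong[of _ _ card]) (auto simp: less_Suc_eq)

lemma block_rows:
  assumes T: "T \<in> SYT C" and "u \<le> v" "1 \<le> u" "v \<le> n" "block T u = block T v"
  shows "fst (cell T v) \<le> fst (cell T u)"
  using assms(2,4,5)
proof (induction v rule: dec_induct)
  case (step v)
  have "block T u = block T v" using step block_mono[of u v T] block_mono[of v "Suc v" T] by simp
  then have IH: "fst (cell T v) \<le> fst (cell T u)" using step by simp
  have "v \<notin> Des_SYT C T" using block_eq_no_des[OF step.prems(2), of v] step by auto
  then show ?case using Des_iff[OF T, of v] step IH assms(3) by auto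
qed simp

lemma same_block_rows:
  assumes T: "T \<in> SYT C" and cd: "c \<in> C" "d \<in> C" "T c \<le> T d" "block T (T c) = block T (T d)"
  shows "fst d \<le> fst c"
proof -
  note F = SYT_filling[OF T]
  show ?thesis using block_rows[OF T cd(3) _ _ cd(4)] label_in[OF F] cell_label[OF F] cd by auto
qed

text \<open>Within a block larger labels never lie lower, whereas a column increases downwards. A
  block is therefore a horizontal strip.\<close>

lemma same_block_col:
  assumes T: "T \<in> SYT C" and cd: "c \<in> C" "d \<in> C" "snd c = snd d" "block T (T c) = block T (T d)"
  shows "c = d"
proof -
  have *: False if "c \<in> C" "d \<in> C" "snd c = snd d" "block T (T c) = block T (T d)" "fst c < fst d" for c d
  proof -
    have "T c < T d" using SYT_col[OF T, of "fst c" "snd c" "fst d"] that(1,2,3,5) by (metis prod.collapse)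
    then show False using same_block_rows[OF T that(1,2) _ that(4)] that(5) by simp
  qed
  then have "fst c = fst d" using *[of c d] *[of d c] cd by (metis nat_neq_iff)
  then show ?thesis using cd by (simp add: prod_eq_iff)
qed

text \<open>Replacing labels by block numbers turns \<open>T\<close> into a semistandard filling;
  \<open>ind T\<close> is the indicator of all standard tableaux that arise from \<open>T\<close> by
  permuting labels inside its blocks and hence give the same filling.\<close>

definition ind :: "(nat \<times> nat \<Rightarrow> nat) \<Rightarrow> (nat \<times> nat \<Rightarrow> nat) \<Rightarrow> real" where
  "ind T T' = (if T' \<in> SYT C \<and> (\<forall>c\<in>C. block T (T' c) = block T (T c)) then 1 else 0)"

lemma ind_E: "ind T \<in> E"
  by (auto simp: E_def ind_def)

text \<open>A non-descent \<open>i\<close> shares its block with \<open>i + 1\<close>, so swapping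
  them respects the condition that defines \<open>ind T\<close>. A tableau with both labels in one
  column violates this condition, because blocks are horizontal strips.\<close>

lemma ind_fixed:
  assumes T: "T \<in> SYT C" and i: "1 \<le> i" "i < n" "i \<notin> Des_SYT C T"
  shows "act i (ind T) = ind T"
proof (subst act_fixed_iff[OF ind_E i(1,2)], intro ballI impI)
  fix T' assume T': "T' \<in> SYT C" and ne: "fst (cell T' i) \<noteq> fst (cell T' (Suc i))"
  note F' = SYT_filling[OF T']
  have b: "block T (swap_labels i T' c) = block T (T' c)" for c
    using block_Suc[OF i(3)] by (auto simp: swap_labels_def transpose_def)
  show "ind T (swap_labels i T') = ind T T'"
  proof (cases "swap_labels i T' \<in> SYT C")
    case True
    then show ?thesis using T' b by (simp add: ind_def)
  next
    case False
    let ?x = "cell T' i" and ?y = "cell T' (Suc i)"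
    have col: "snd ?x = snd ?y" using False ne swap_SYT[OF T' i(1,2)] by blast
    have xy: "?x \<in> C" "?y \<in> C" "T' ?x = i" "T' ?y = Suc i"
      using cell_in[OF F'] label_cell[OF F'] i by auto
    have "\<not> (\<forall>c\<in>C. block T (T' c) = block T (T c))"
    proof
      assume "\<forall>c\<in>C. block T (T' c) = block T (T c)"
      then have "block T (T ?x) = block T (T ?y)" using xy block_Suc[OF i(3)] by metis
      then show False using same_block_col[OF T xy(1,2) col] ne by simp
    qed
    then show ?thesis using False by (simp add: ind_def)
  qed
qed

definition invs :: "(nat \<times> nat \<Rightarrow> nat) \<Rightarrow> ((nat \<times> nat) \<times> (nat \<times> nat)) set" where
  "invs T = {(c, d) \<in> C \<times> C. T c < T d \<and> fst c < fst d}"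

lemma finite_invs: "finite (invs T)"
  unfolding invs_def using finite_C by (auto intro: finite_subset[of _ "C \<times> C"])

lemma label_card:
  assumes "T \<in> fillings" "c \<in> C"
  shows "T c = card {d \<in> C. T d \<le> T c}"
proof -
  have bij: "bij_betw T C {1..n}" using assms by (simp add: fillings_def)
  have "T ` {d \<in> C. T d \<le> T c} = {1..T c}"
  proof
    show "T ` {d \<in> C. T d \<le> T c} \<subseteq> {1..T c}" using label_in[OF assms(1)] by auto
    show "{1..T c} \<subseteq> T ` {d \<in> C. T d \<le> T c}"
    proof
      fix v assume v: "v \<in> {1..T c}"
      then have "v \<in> {1..n}" using label_in[OF assms] by auto
      then show "v \<in> T ` {d \<in> C. T d \<le> T c}"
        using cell_in[OF assms(1)] label_cell[OF assms(1)] v by (intro image_eqI[of _ _ "cell T v"]) auto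
    qed
  qed
  then have "card {1..T c} = card {d \<in> C. T d \<le> T c}"
    using bij by (metis (no_types, lifting) bij_betw_def card_image inj_on_subset mem_Collect_eq subsetI)
  then show ?thesis by simp
qed

lemma fillings_eq_of_order:
  assumes T: "T \<in> fillings" "T' \<in> fillings"
    and ord: "\<And>c d. c \<in> C \<Longrightarrow> d \<in> C \<Longrightarrow> T c < T d \<Longrightarrow> T' c < T' d"
  shows "T = T'"
proof (rule fillings_eqI[OF T])
  fix c assume c: "c \<in> C"
  have "T d \<le> T c \<longleftrightarrow> T' d \<le> T' c" if "d \<in> C" for d
  proof -
    have "T c < T d \<or> T d < T c \<or> c = d" using label_inj[OF T(1) c that] by (meson nat_neq_iff)
    then consider "T c < T d" | "T d < T c" | "c = d" by blast
    then show ?thesis by cases (use ord[OF c that] ord[OF that c] in auto)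
  qed
  then have "{d \<in> C. T d \<le> T c} = {d \<in> C. T' d \<le> T' c}" by auto
  then show "T c = T' c" using label_card[OF T(1) c] label_card[OF T(2) c] by simp
qed

text \<open>\<open>T\<close> has the fewest inversions in its class: pairs from different blocks are
  ordered alike throughout the class, and inside a block \<open>T\<close> has no inversion. This
  triangularity gives both independence and spanning.\<close>

lemma ind_invs:
  assumes T: "T \<in> SYT C" and T': "ind T T' \<noteq> 0" "T' \<noteq> T"
  shows "card (invs T) < card (invs T')"
proof -
  have T'S: "T' \<in> SYT C" and b: "\<And>c. c \<in> C \<Longrightarrow> block T (T' c) = block T (T c)"
    using T' by (auto simp: ind_def split: if_splits)
  have mono: "T' c < T' d" if "c \<in> C" "d \<in> C" "block T (T c) \<noteq> block T (T d)" "T c < T d" for c d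
    using that b block_mono[of "T c" "T d" T] block_less[of T "T' c" "T' d"] by simp
  have sub: "invs T \<subseteq> invs T'"
  proof
    fix p assume "p \<in> invs T"
    then obtain c d where p: "p = (c, d)" "c \<in> C" "d \<in> C" "T c < T d" "fst c < fst d" by (auto simp: invs_def)
    have "block T (T c) \<noteq> block T (T d)" using same_block_rows[OF T p(2,3)] p by auto
    then show "p \<in> invs T'" using mono p by (auto simp: invs_def)
  qed
  moreover have "invs T \<noteq> invs T'"
  proof
    assume eq: "invs T = invs T'"
    have "T = T'"
    proof (rule fillings_eq_of_order[OF SYT_filling[OF T] SYT_filling[OF T'S]])
      fix c d assume cd: "c \<in> C" "d \<in> C" "T c < T d"
      show "T' c < T' d"
      proof (cases "block T (T c) = block T (T d)")
        case False
        then show ?thesis using mono cd by blast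
      next
        case True
        then have le: "fst d \<le> fst c" using same_block_rows[OF T cd(1,2)] cd by simp
        show ?thesis
        proof (rule ccontr)
          assume "\<not> T' c < T' d"
          moreover have "T' c \<noteq> T' d" using label_inj[OF SYT_filling[OF T'S] cd(1,2)] cd(3) by auto
          ultimately have lt: "T' d < T' c" by linarith
          show False
          proof (cases "fst d < fst c")
            case True
            then have "(d, c) \<in> invs T'" using lt cd by (auto simp: invs_def)
            then have "T d < T c" using eq by (auto simp: invs_def)
            then show False using cd by simp
          next
            case False
            then have "fst d = fst c" using le by simp
            then show False
              using cd lt SYT_row[OF T, of "fst c" "snd d" "snd c"] SYT_row[OF T'S, of "fst c" "snd c" "snd d"]
              by (metis linorder_neqE_nat not_less_iff_gr_or_eq prod.collapse)
          qed
        qed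
      qed
    qed
    then show False using T' by simp
  qed
  ultimately show ?thesis using finite_invs by (intro psubset_card_mono) auto
qed

lemma ind_self: "T \<in> SYT C \<Longrightarrow> ind T T = 1"
  by (simp add: ind_def)

lemma ind_inj: "inj_on ind (SYT C)"
proof (rule inj_onI)
  fix T T' assume T: "T \<in> SYT C" "T' \<in> SYT C" "ind T = ind T'"
  then have "ind T T' \<noteq> 0" "ind T' T \<noteq> 0" using ind_self by (metis zero_neq_one)+
  then show "T = T'" using ind_invs[OF T(1), of T'] ind_invs[OF T(2), of T] by fastforce
qed

lemma ind_sum_zero:
  assumes s: "(\<Sum>T\<in>SYT C. a T *\<^sub>R ind T) = 0" and T: "T \<in> SYT C"
  shows "a T = 0"
proof (rule ccontr)
  assume "a T \<noteq> 0"
  then have ne: "{T \<in> SYT C. a T \<noteq> 0} \<noteq> {}" using T by auto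
  obtain T0 where T0: "T0 \<in> SYT C" "a T0 \<noteq> 0"
    and min: "\<And>T. T \<in> SYT C \<Longrightarrow> a T \<noteq> 0 \<Longrightarrow> card (invs T0) \<le> card (invs T)"
    using ne ex_min_if_finite[of "(\<lambda>T. card (invs T)) ` {T \<in> SYT C. a T \<noteq> 0}"] finite_SYT
    by (auto simp: not_less)
  have "0 = (\<Sum>T\<in>SYT C. a T * ind T T0)" using fun_cong[OF s, of T0] by (simp add: sum_fun_apply)
  also have "\<dots> = (\<Sum>T\<in>SYT C. if T = T0 then a T0 else 0)"
  proof (rule sum.cong[OF refl])
    fix T assume T: "T \<in> SYT C"
    show "a T * ind T T0 = (if T = T0 then a T0 else 0)"
      using ind_self[OF T0(1)] ind_invs[OF T, of T0] min[OF T] by (cases "a T = 0") auto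
  qed
  also have "\<dots> = a T0" using T0 finite_SYT by simp
  finally show False using T0 by simp
qed

lemma ind_independent: "independent (ind ` SYT C)"
proof (rule independent_if_scalars_zero)
  show "finite (ind ` SYT C)" using finite_SYT by simp
  fix g x assume g: "(\<Sum>x\<in>ind ` SYT C. g x *\<^sub>R x) = 0" and x: "x \<in> ind ` SYT C"
  obtain T where T: "T \<in> SYT C" "x = ind T" using x by blast
  have "(\<Sum>T\<in>SYT C. g (ind T) *\<^sub>R ind T) = 0"
    using sum.reindex[OF ind_inj, of "\<lambda>x. g x *\<^sub>R x"] g by (simp only: comp_def)
  then show "g x = 0" using T ind_sum_zero[of "\<lambda>T. g (ind T)" T] by (simp only:)
qed

definition avoiding :: "nat set \<Rightarrow> (nat \<times> nat \<Rightarrow> nat) set" where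
  "avoiding K = {T \<in> SYT C. Des_SYT C T \<inter> K = {}}"

lemma ind_U:
  assumes K: "K \<subseteq> {1..n - 1}" and T: "T \<in> avoiding K"
  shows "ind T \<in> U K"
proof -
  have "ind T \<in> V i" if i: "i \<in> K" for i
  proof -
    have "1 \<le> i" "i < n" using subsetD[OF K i] by auto
    moreover have "i \<notin> Des_SYT C T" using i T unfolding avoiding_def by blast
    ultimately have "1 \<le> i" "i < n" "i \<notin> Des_SYT C T" by auto
    then show ?thesis using T ind_fixed[of T i] ind_E by (simp add: V_def avoiding_def)
  qed
  then show ?thesis using ind_E by (simp add: U_def)
qed

text \<open>The spanning part peels off the support of \<open>f\<close> on the lowest inversion
  level \<open>N\<close>. A tableau there has no descent in \<open>K\<close>, since swapping one
  would give an equal, nonzero value with fewer inversions. Subtracting the corresponding multiples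
  of \<open>ind T\<close> raises the level.\<close>

lemma U_span:
  assumes K: "K \<subseteq> {1..n - 1}"
  shows "U K = span (ind ` avoiding K)"
proof
  show "span (ind ` avoiding K) \<subseteq> U K"
    using ind_U[OF K] subspace_U by (intro span_minimal) auto
  \<comment> \<open>Every tableau has fewer than \<open>M\<close> inversions, so the downward
    induction starts with \<open>f = 0\<close>.\<close>
  define M where "M = Suc (card (C \<times> C))"
  have lvl: "card (invs T) < M" for T
    unfolding M_def invs_def using finite_C by (intro le_imp_less_Suc card_mono) auto
  have "f \<in> span (ind ` avoiding K)" if "f \<in> U K" "\<And>T. f T \<noteq> 0 \<Longrightarrow> N \<le> card (invs T)" "N \<le> M" for f N
    using that(3,1,2)
  proof (induction N arbitrary: f rule: inc_induct)
    case base
    then have "f = 0" using lvl by (intro ext) (metis leD zero_fun_apply)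
    then show ?case by (simp only: span_zero)
  next
    case (step N)
    define L where "L = {T \<in> SYT C. card (invs T) = N \<and> f T \<noteq> 0}"
    have fE: "f \<in> E" using step U_E by blast
    have LK: "L \<subseteq> avoiding K"
    proof
      fix T assume T: "T \<in> L"
      then have TS: "T \<in> SYT C" by (simp add: L_def)
      note F = SYT_filling[OF TS]
      have False if i: "i \<in> Des_SYT C T" "i \<in> K" for i
      proof -
        have i1: "1 \<le> i" "i < n" using subsetD[OF K i(2)] by auto
        have lt: "fst (cell T i) < fst (cell T (Suc i))" using Des_iff[OF TS i1] i by blast
        have "f \<in> V i" using step.prems(1) i i1 unfolding U_def by simp
        then have "act i f = f" using i1 unfolding V_def by simp
        then have eq: "f (swap_labels i T) = f T" using act_fixed_iff[OF fE i1] TS lt by (metis less_irrefl)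
        then have nz: "f (swap_labels i T) \<noteq> 0" using T by (simp add: L_def)
        have xy: "cell T i \<in> C" "cell T (Suc i) \<in> C" "T (cell T i) = i" "T (cell T (Suc i)) = Suc i"
          using cell_in[OF F] label_cell[OF F] i1 by auto
        have "invs (swap_labels i T) \<subset> invs T"
        proof
          show "invs (swap_labels i T) \<subseteq> invs T"
          proof
            fix p assume "p \<in> invs (swap_labels i T)"
            then obtain c d where p: "p = (c, d)" "c \<in> C" "d \<in> C" "fst c < fst d"
              "transpose i (Suc i) (T c) < transpose i (Suc i) (T d)" by (auto simp: invs_def swap_labels_def)
            have "\<not> (T c = Suc i \<and> T d = i)" using p lt cell_eqI[OF F] by (metis less_asym)
            then have "T c < T d" using p(5) by (auto simp: transpose_def split: if_splits)
            then show "p \<in> invs T" using p by (auto simp: invs_def)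
          qed
          have "(cell T i, cell T (Suc i)) \<in> invs T" "(cell T i, cell T (Suc i)) \<notin> invs (swap_labels i T)"
            using xy lt by (auto simp: invs_def swap_labels_def)
          then show "invs (swap_labels i T) \<noteq> invs T" by blast
        qed
        then have "card (invs (swap_labels i T)) < card (invs T)" using finite_invs by (intro psubset_card_mono)
        then show False using step.prems(2)[OF nz] T by (simp add: L_def)
      qed
      then show "T \<in> avoiding K" using TS by (auto simp: avoiding_def)
    qed
    define g where "g = (\<Sum>T\<in>L. f T *\<^sub>R ind T)"
    have gsp: "g \<in> span (ind ` avoiding K)"
      unfolding g_def using LK by (intro span_sum span_scale span_base) auto
    have finL: "finite L" using finite_SYT by (simp add: L_def)
    have gU: "g \<in> U K" unfolding g_def
      using LK ind_U[OF K] subspace_U by (intro subspace_sum subspace_scale) auto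
    have "f - g \<in> span (ind ` avoiding K)"
    proof (rule step.IH)
      show "f - g \<in> U K" using step.prems(1) gU subspace_U subspace_diff by blast
      fix T assume nz: "(f - g) T \<noteq> 0"
      have gT: "g T = (\<Sum>T'\<in>L. f T' * ind T' T)" by (simp add: g_def sum_fun_apply)
      show "Suc N \<le> card (invs T)"
      proof (rule ccontr)
        assume c: "\<not> Suc N \<le> card (invs T)"
        have "f T' * ind T' T = (if T' = T then f T else 0)" if T': "T' \<in> L" for T'
          using ind_invs[of T' T] ind_self[of T'] T' c by (auto simp: L_def)
        then have "g T = (\<Sum>T'\<in>L. if T' = T then f T else 0)" unfolding gT by (intro sum.cong) auto
        also have "\<dots> = (if T \<in> L then f T else 0)" using finL by simp
        finally have "T \<notin> L" "f T \<noteq> 0" using nz by (auto split: if_splits)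
        moreover have "card (invs T) = N" using step.prems(2)[OF calculation(2)] c by simp
        moreover have "T \<in> SYT C" using calculation fE by (auto simp: E_def)
        ultimately show False by (simp add: L_def)
      qed
    qed
    then have "f - g + g \<in> span (ind ` avoiding K)" using gsp by (rule span_add)
    then show ?case by simp
  qed
  from this[where N = 0] show "U K \<subseteq> span (ind ` avoiding K)" by auto
qed

end

section \<open>The cyclic descent distribution of a shape without hook descent sets\<close>

lemma next_bij: "(n::nat) \<ge> 1 \<Longrightarrow> bij_betw (\<lambda>j. j mod n + 1) {1..n} {1..n}"
proof (rule bij_betw_byWitness[of _ "\<lambda>j. if j = 1 then n else j - 1"])
  assume n: "n \<ge> 1"
  show "\<forall>a\<in>{1..n}. (if a mod n + 1 = 1 then n else a mod n + 1 - 1) = a"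
  proof
    fix a assume "a \<in> {1..n}"
    then show "(if a mod n + 1 = 1 then n else a mod n + 1 - 1) = a"
      by (cases "a = n") auto
  qed
  show "\<forall>a'\<in>{1..n}. (if a' = 1 then n else a' - 1) mod n + 1 = a'"
  proof
    fix a assume a: "a \<in> {1..n}"
    then show "(if a = 1 then n else a - 1) mod n + 1 = a"
    proof (cases "a = 1")
      case False
      then have "(a - 1) mod n = a - 1" using a by (intro mod_less) auto
      then show ?thesis using False a by simp
    qed simp
  qed
  show "(\<lambda>j. j mod n + 1) ` {1..n} \<subseteq> {1..n}"
    using n mod_less_divisor[of n] by (auto simp: Suc_le_eq)
  show "(\<lambda>j. if j = 1 then n else j - 1) ` {1..n} \<subseteq> {1..n}" by auto
qed

lemma cshift_insert: "cshift n (insert a K) = insert (a mod n + 1) (cshift n K)"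
  by (simp add: cshift_def)

lemma cshift_subset: "n \<ge> 1 \<Longrightarrow> K \<subseteq> {1..n} \<Longrightarrow> cshift n K \<subseteq> {1..n}"
  using next_bij[of n] unfolding cshift_def bij_betw_def by blast

lemma cshift_surj:
  assumes "n \<ge> 1" "K \<subseteq> {1..n}"
  obtains K' where "K' \<subseteq> {1..n}" "cshift n K' = K"
  using next_bij[OF assms(1)] assms(2) unfolding bij_betw_def cshift_def
  by (metis subset_image_iff)

lemma cshift_Diff: "n \<ge> 1 \<Longrightarrow> K \<subseteq> {1..n} \<Longrightarrow> {1..n} - cshift n K = cshift n ({1..n} - K)"
  using next_bij[of n] unfolding cshift_def bij_betw_def
  by (metis (no_types, lifting) Diff_subset inj_on_image_set_diff order_refl)

lemma cshift_inj: "n \<ge> 1 \<Longrightarrow> inj_on (cshift n) (Pow {1..n})"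
  using next_bij[of n] unfolding cshift_def bij_betw_def
  by (metis inj_on_image_Pow)

text \<open>\<open>R\<close> is known to be injective on \<open>E\<close> only, so injectivity is
  asked on the span of \<open>X\<close> rather than on the whole type.\<close>

lemma dim_image_inj:
  fixes f :: "'a::real_vector \<Rightarrow> 'b::real_vector"
  assumes "linear f" "inj_on f (span X)"
  shows "dim (f ` X) = dim X"
proof -
  obtain B where B: "B \<subseteq> X" "independent B" "X \<subseteq> span B" "card B = dim X"
    using basis_exists by metis
  have sp: "span B = span X" using B by (metis span_mono span_span subset_antisym)
  have "independent (f ` B)"
    using linear_independent_injective_image[OF assms(1) B(2)] assms(2) sp by simp
  moreover have "span (f ` B) = span (f ` X)"
    using linear_span_image[OF assms(1)] sp by simp
  ultimately have "dim (f ` X) = card (f ` B)" by (metis dim_eq_card)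
  also have "\<dots> = card B"
    using inj_on_subset[OF assms(2)] B(1) span_superset by (intro card_image) blast
  finally show ?thesis using B by simp
qed

context convex_cells
begin

definition distr_prop :: "nat set \<Rightarrow> nat \<Rightarrow> nat set \<Rightarrow> bool" where
  "distr_prop K a A \<longleftrightarrow>
     U (insert a K) \<inter> span (\<Union>i\<in>A. U (insert i K)) \<subseteq> span (\<Union>i\<in>A. U (insert i (insert a K)))"

lemma span_U_avoiding:
  assumes K: "K \<subseteq> {1..n - 1}" and A: "A \<subseteq> {1..n - 1}"
  shows "span (\<Union>i\<in>A. U (insert i K)) = span (ind ` (\<Union>i\<in>A. avoiding (insert i K)))"
proof
  have U: "U (insert i K) = span (ind ` avoiding (insert i K))" if "i \<in> A" for i
    using that K A by (intro U_span) auto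
  show "span (\<Union>i\<in>A. U (insert i K)) \<subseteq> span (ind ` (\<Union>i\<in>A. avoiding (insert i K)))"
  proof (intro span_minimal subspace_span UN_least)
    fix i assume i: "i \<in> A"
    then show "U (insert i K) \<subseteq> span (ind ` (\<Union>i\<in>A. avoiding (insert i K)))"
      unfolding U[OF i] by (intro span_mono image_mono) blast
  qed
  show "span (ind ` (\<Union>i\<in>A. avoiding (insert i K))) \<subseteq> span (\<Union>i\<in>A. U (insert i K))"
  proof (rule span_mono, rule subsetI)
    fix x assume "x \<in> ind ` (\<Union>i\<in>A. avoiding (insert i K))"
    then obtain i where i: "i \<in> A" "x \<in> ind ` avoiding (insert i K)" by blast
    then have "x \<in> U (insert i K)" unfolding U[OF i(1)] by (intro span_base)
    then show "x \<in> (\<Union>i\<in>A. U (insert i K))" using i(1) by blast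
  qed
qed

text \<open>Without the index \<open>n\<close> all subspaces are spanned by parts of the one basis
  \<open>ind\<close>, so intersections and sums become intersections and unions of sets of
  tableaux.\<close>

lemma distr_linear:
  assumes K: "K \<subseteq> {1..n - 1}" and a: "a \<in> {1..n - 1}" and A: "A \<subseteq> {1..n - 1}"
  shows "distr_prop K a A"
proof -
  let ?Q = "\<Union>i\<in>A. avoiding (insert i K)" and ?P = "avoiding (insert a K)"
  have sub: "?P \<subseteq> SYT C" "?Q \<subseteq> SYT C" by (auto simp: avoiding_def)
  have "U (insert a K) \<inter> span (\<Union>i\<in>A. U (insert i K)) = span (ind ` ?P) \<inter> span (ind ` ?Q)"
    using U_span[of "insert a K"] span_U_avoiding[OF K A] K a by auto
  also have "\<dots> = span (ind ` ?P \<inter> ind ` ?Q)"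
    using sub by (intro span_Int_independent[OF ind_independent] image_mono)
  also have "ind ` ?P \<inter> ind ` ?Q = ind ` (?P \<inter> ?Q)"
    using inj_on_image_Int[OF ind_inj sub] by simp
  also have "?P \<inter> ?Q \<subseteq> (\<Union>i\<in>A. avoiding (insert i (insert a K)))" by (auto simp: avoiding_def)
  also have "span (ind ` \<dots>) = span (\<Union>i\<in>A. U (insert i (insert a K)))"
    using span_U_avoiding[of "insert a K" A] K a A by auto
  finally show ?thesis unfolding distr_prop_def by (simp add: image_mono span_mono)
qed

lemma distr_shift:
  assumes n: "n \<ge> 2" and K: "K \<subseteq> {1..n}" and a: "a \<in> {1..n}" and A: "A \<subseteq> {1..n}"
    and d: "distr_prop K a A"
  shows "distr_prop (cshift n K) (a mod n + 1) (cshift n A)"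
proof -
  have sh: "U (insert (i mod n + 1) (cshift n L)) = R ` U (insert i L)" if "i \<in> {1..n}" "L \<subseteq> {1..n}" for i L
    using U_shift[OF n, of "insert i L"] that by (simp add: cshift_insert)
  have UN: "(\<Union>i\<in>cshift n A. U (insert i (cshift n L))) = R ` (\<Union>i\<in>A. U (insert i L))" if "L \<subseteq> {1..n}" for L
  proof -
    have "U (insert (i mod n + 1) (cshift n L)) = R ` U (insert i L)" if "i \<in> A" for i
      using sh[OF _ \<open>L \<subseteq> {1..n}\<close>] A that by blast
    then show ?thesis unfolding image_UN cshift_def[of n A] by simp
  qed
  have "R ` U (insert a K) \<inter> R ` span (\<Union>i\<in>A. U (insert i K)) \<subseteq> R ` span (\<Union>i\<in>A. U (insert i (insert a K)))"
  proof
    fix v assume "v \<in> R ` U (insert a K) \<inter> R ` span (\<Union>i\<in>A. U (insert i K))"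
    then obtain x y where xy: "v = R x" "x \<in> U (insert a K)" "v = R y" "y \<in> span (\<Union>i\<in>A. U (insert i K))" by blast
    have "span (\<Union>i\<in>A. U (insert i K)) \<subseteq> E" using U_E subspace_E by (intro span_minimal) blast+
    then have "x = y" using xy R_eq_iff[OF n] U_E by blast
    then show "v \<in> R ` span (\<Union>i\<in>A. U (insert i (insert a K)))" using xy d unfolding distr_prop_def by blast
  qed
  moreover have "R ` span X = span (R ` X)" for X by (simp add: linear_span_image[OF linear_R])
  ultimately show ?thesis
    unfolding distr_prop_def using UN[OF K] UN[of "insert a K"] sh[OF a K] K a by (simp add: cshift_insert)
qed

text \<open>Any missing index can be rotated to \<open>n\<close>, where \<open>distr_linear\<close>
  applies. The number \<open>j\<close> is the missing index with \<open>n\<close> read as residue 0,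
  so that the induction counts rotations.\<close>

lemma distr_miss:
  assumes n: "n \<ge> 2" and "j < n"
  shows "K \<subseteq> {1..n} \<Longrightarrow> a \<in> {1..n} \<Longrightarrow> A \<subseteq> {1..n} \<Longrightarrow> (if j = 0 then n else j) \<notin> insert a K \<union> A \<Longrightarrow> distr_prop K a A"
  using assms(2)
proof (induction j arbitrary: K a A)
  case 0
  have "X \<subseteq> {1..n - 1}" if "X \<subseteq> {1..n}" "n \<notin> X" for X
  proof
    fix x assume "x \<in> X"
    then have "x \<in> {1..n}" "x \<noteq> n" using that by auto
    then show "x \<in> {1..n - 1}" by auto
  qed
  from this[of K] this[of "{a}"] this[of A] have "K \<subseteq> {1..n - 1}" "a \<in> {1..n - 1}" "A \<subseteq> {1..n - 1}"
    using 0 by auto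
  then show ?case by (rule distr_linear)
next
  case (Suc j)
  have n1: "n \<ge> 1" using n by simp
  obtain K' where K': "K' \<subseteq> {1..n}" "cshift n K' = K" using cshift_surj[OF n1 Suc.prems(1)] .
  obtain A' where A': "A' \<subseteq> {1..n}" "cshift n A' = A" using cshift_surj[OF n1 Suc.prems(3)] .
  have "a \<in> (\<lambda>j. j mod n + 1) ` {1..n}"
    using bij_betw_imp_surj_on[OF next_bij[OF n1]] Suc.prems(2) by (simp only:)
  then obtain a' where a': "a' \<in> {1..n}" "a' mod n + 1 = a" by (elim imageE) simp
  define e where "e = (if j = 0 then n else j)"
  have e: "e mod n + 1 = Suc j" using Suc.prems by (simp add: e_def)
  have c: "e \<in> X \<Longrightarrow> Suc j \<in> cshift n X" for X unfolding cshift_def using e by (metis imageI)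
  have "e \<notin> insert a' K' \<union> A'"
    using Suc.prems(4) e K'(2) A'(2) a'(2) c[of K'] c[of A'] by auto
  then have "distr_prop K' a' A'" using Suc.IH[of K' a' A'] K' A' a' Suc.prems by (simp add: e_def)
  then show ?case using distr_shift[OF n K'(1) a'(1) A'(1)] K' A' a' by simp
qed

text \<open>For \<open>run\<close>: the tableaux whose \<open>ind T\<close> span
  \<open>U {1..r}\<close> have descents above \<open>r\<close> only, and by \<open>hooks\<close>
  each of them misses some \<open>i\<close> between \<open>r + 1\<close> and \<open>n - 1\<close>,
  so that \<open>ind T\<close> lies in \<open>U (insert i {1..r})\<close>.\<close>

lemma subspace_family_U:
  assumes n: "n \<ge> 2"
    and hooks: "\<And>r T. 1 \<le> r \<Longrightarrow> r \<le> n \<Longrightarrow> T \<in> SYT C \<Longrightarrow> Des_SYT C T \<noteq> {r..n - 1}"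
  shows "subspace_family n U"
proof
  show "subspace (U K)" for K by (rule subspace_U)
  show "U (insert i K) \<subseteq> U K" for i K by (rule U_insert)
  have "U {} = span (ind ` avoiding {})" by (rule U_span) simp
  moreover have "finite (ind ` avoiding {})" using finite_SYT by (simp add: avoiding_def)
  ultimately show "\<exists>W. finite W \<and> U {} \<subseteq> span W" by blast
  show "U (insert a K) \<inter> span (\<Union>i\<in>A. U (insert i K)) \<subseteq> span (\<Union>i\<in>A. U (insert i (insert a K)))"
    if "K \<subseteq> {1..n}" "a \<in> {1..n}" "A \<subseteq> {1..n}" "insert a K \<union> A \<noteq> {1..n}" for K a A
  proof -
    have "insert a K \<union> A \<subset> {1..n}" using that by blast
    then obtain e where e: "e \<in> {1..n}" "e \<notin> insert a K \<union> A" by blast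
    define j where "j = (if e = n then 0 else e)"
    have j: "j < n" "(if j = 0 then n else j) = e" using e n by (auto simp: j_def)
    then have "distr_prop K a A" using distr_miss[OF n j(1) that(1,2,3)] e by simp
    then show ?thesis by (simp add: distr_prop_def)
  qed
  show "U {1..r} \<subseteq> span (\<Union>i\<in>{1..n} - {1..r}. U (insert i {1..r}))" if r: "r \<le> n" for r
  proof (cases "r = n")
    case True
    have "avoiding {1..n - 1} = {}"
    proof (rule ccontr)
      assume "avoiding {1..n - 1} \<noteq> {}"
      then obtain T where T: "T \<in> SYT C" "Des_SYT C T \<inter> {1..n - 1} = {}" unfolding avoiding_def by blast
      then have "Des_SYT C T = {}" using Des_subset[of T] by blast
      \<comment> \<open>\<open>{n..n - 1}\<close> is empty, so the case \<open>r = n\<close> of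
        \<open>hooks\<close> excludes tableaux without descents.\<close>
      then show False using hooks[of n T] T n by simp
    qed
    then have "U {1..n - 1} = {0}" using U_span[of "{1..n - 1}"] by simp
    moreover have "U {1..n} \<subseteq> U {1..n - 1}" unfolding U_def by auto
    ultimately show ?thesis using True span_zero by auto
  next
    case False
    then have K: "{1..r} \<subseteq> {1..n - 1}" using r by auto
    have "ind T \<in> (\<Union>i\<in>{1..n} - {1..r}. U (insert i {1..r}))" if T: "T \<in> avoiding {1..r}" for T
    proof -
      have "Des_SYT C T \<noteq> {r + 1..n - 1}" using hooks[of "r + 1" T] False r T by (simp add: avoiding_def)
      moreover have "Des_SYT C T \<subseteq> {r + 1..n - 1}"
      proof
        fix d assume "d \<in> Des_SYT C T"
        then have "d \<in> {1..n - 1}" "d \<notin> {1..r}" using Des_subset T unfolding avoiding_def by blast+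
        then show "d \<in> {r + 1..n - 1}" by auto
      qed
      ultimately obtain i where i: "i \<in> {r + 1..n - 1}" "i \<notin> Des_SYT C T" by blast
      then have "T \<in> avoiding (insert i {1..r})" using T by (auto simp: avoiding_def)
      then have "ind T \<in> U (insert i {1..r})" using K i by (intro ind_U) auto
      moreover have "i \<in> {1..n} - {1..r}" using i by auto
      ultimately show ?thesis by blast
    qed
    then show ?thesis unfolding U_span[OF K] by (intro span_mono) blast
  qed
qed

lemma dim_U:
  assumes K: "K \<subseteq> {1..n - 1}"
  shows "dim (U K) = card (avoiding K)"
proof -
  have sub: "avoiding K \<subseteq> SYT C" by (auto simp: avoiding_def)
  have "dim (U K) = card (ind ` avoiding K)"
    unfolding U_span[OF K] using ind_independent sub
    by (intro dim_span_eq_card_independent) (meson image_mono independent_mono)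
  also have "\<dots> = card (avoiding K)"
    using ind_inj sub by (intro card_image) (meson inj_on_subset)
  finally show ?thesis .
qed

lemma dim_UN_U:
  assumes K: "K \<subseteq> {1..n - 1}" and A: "A \<subseteq> {1..n - 1}"
  shows "dim (\<Union>i\<in>A. U (insert i K)) = card (\<Union>i\<in>A. avoiding (insert i K))"
proof -
  let ?Q = "\<Union>i\<in>A. avoiding (insert i K)"
  have sub: "?Q \<subseteq> SYT C" by (auto simp: avoiding_def)
  have "dim (\<Union>i\<in>A. U (insert i K)) = dim (span (\<Union>i\<in>A. U (insert i K)))" by simp
  also have "\<dots> = card (ind ` ?Q)"
    unfolding span_U_avoiding[OF K A] using ind_independent sub
    by (intro dim_span_eq_card_independent) (meson image_mono independent_mono)
  also have "\<dots> = card ?Q"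
    using ind_inj sub by (intro card_image) (meson inj_on_subset)
  finally show ?thesis .
qed

text \<open>\<open>m J\<close> is the \<open>excess\<close> of the complement of \<open>J\<close>,
  and \<open>R\<close> makes it rotation invariant. In \<open>excess_add\<close> with
  \<open>a = n\<close> the two remaining dimensions count the tableaux with descent set inside
  \<open>D\<close>, and those among them that miss an element of \<open>D\<close>; the difference
  counts descent set exactly \<open>D\<close>.\<close>

theorem cyclic_distribution_exists:
  assumes n: "n \<ge> 2"
    and hooks: "\<And>r T. 1 \<le> r \<Longrightarrow> r \<le> n \<Longrightarrow> T \<in> SYT C \<Longrightarrow> Des_SYT C T \<noteq> {r..n - 1}"
  obtains m :: "nat set \<Rightarrow> nat" where
    "\<And>J. J \<subseteq> {1..n} \<Longrightarrow> m (cshift n J) = m J"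
    "\<And>D. D \<subseteq> {1..n - 1} \<Longrightarrow> m D + m (insert n D) = card {T \<in> SYT C. Des_SYT C T = D}"
proof -
  interpret sf: subspace_family n U using subspace_family_U assms by blast
  have n1: "n \<ge> 1" using n by simp
  define m where "m J = sf.excess ({1..n} - J)" for J
  have inj: "inj_on R (span X)" if "X \<subseteq> E" for X
    using R_bij[OF n] span_minimal[OF that subspace_E] unfolding bij_betw_def by (meson inj_on_subset)
  have ex: "sf.excess (cshift n K) = sf.excess K" if K: "K \<subseteq> {1..n}" for K
  proof -
    have "(\<Union>i\<in>{1..n} - cshift n K. U (insert i (cshift n K))) = R ` (\<Union>i\<in>{1..n} - K. U (insert i K))"
    proof -
      have "U (insert (i mod n + 1) (cshift n K)) = R ` U (insert i K)" if "i \<in> {1..n} - K" for i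
        using U_shift[OF n, of "insert i K"] that K by (simp add: cshift_insert)
      then show ?thesis
        unfolding cshift_Diff[OF n1 K] image_UN cshift_def[of n "{1..n} - K"] by simp
    qed
    moreover have "dim (R ` X) = dim X" if "X \<subseteq> E" for X
      using dim_image_inj[OF linear_R inj[OF that]] .
    moreover have "(\<Union>i\<in>{1..n} - K. U (insert i K)) \<subseteq> E" using U_E by blast
    ultimately show ?thesis unfolding sf.excess_def using U_shift[OF n K] U_E by simp
  qed
  show thesis
  proof (rule that)
    fix J assume "J \<subseteq> {1..n}"
    then show "m (cshift n J) = m J"
      unfolding m_def using cshift_Diff[OF n1] ex[of "{1..n} - J"] by simp
  next
    fix D assume D: "D \<subseteq> {1..n - 1}"
    define K where "K = {1..n - 1} - D"
    have K: "K \<subseteq> {1..n - 1}" by (auto simp: K_def)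
    have e1: "{1..n} - D = insert n K"
    proof -
      have "{1..n} = insert n {1..n - 1}" using n by auto
      moreover have "n \<notin> D" using D n by auto
      ultimately show ?thesis by (auto simp: K_def)
    qed
    moreover have "n \<notin> K" using n by (auto simp: K_def)
    ultimately have e2: "{1..n} - insert n D = K" by blast
    have A: "D = {1..n} - insert n K" using e1 D n by force
    have K': "K \<subseteq> {1..n}" using K by force
    have "sf.excess K + sf.excess (insert n K) + dim (\<Union>i\<in>D. U (insert i K)) = dim (U K)"
      using K' n \<open>n \<notin> K\<close> A by (intro sf.excess_add) auto
    then have eq: "m D + m (insert n D) + card (\<Union>i\<in>D. avoiding (insert i K)) = card (avoiding K)"
      unfolding m_def e1 e2 dim_U[OF K] dim_UN_U[OF K D] by simp
    have fin: "finite (avoiding K)" using finite_SYT by (simp add: avoiding_def)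
    have un: "avoiding K = {T \<in> SYT C. Des_SYT C T = D} \<union> (\<Union>i\<in>D. avoiding (insert i K))"
    proof -
      have "Des_SYT C T \<inter> K = {} \<longleftrightarrow> Des_SYT C T \<subseteq> D" for T
        using Des_subset[of T] D unfolding K_def by blast
      then show ?thesis unfolding avoiding_def by auto
    qed
    moreover have "{T \<in> SYT C. Des_SYT C T = D} \<inter> (\<Union>i\<in>D. avoiding (insert i K)) = {}"
      unfolding avoiding_def by auto
    moreover have "finite {T \<in> SYT C. Des_SYT C T = D}" "finite (\<Union>i\<in>D. avoiding (insert i K))"
      using fin unfolding un by simp_all
    ultimately have "card (avoiding K) = card {T \<in> SYT C. Des_SYT C T = D} + card (\<Union>i\<in>D. avoiding (insert i K))"
      unfolding un by (intro card_Un_disjoint)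
    then show "m D + m (insert n D) = card {T \<in> SYT C. Des_SYT C T = D}" using eq by simp
  qed
qed

end

section \<open>Robinson-Schensted insertion\<close>

definition count_below :: "nat \<Rightarrow> nat list \<Rightarrow> nat" where
  "count_below x r = length (takeWhile (\<lambda>y. y < x) r)"

text \<open>The second component is the index of the row that gains a cell; the recording tableau
  and reverse insertion are built on it.\<close>

fun ins :: "nat \<Rightarrow> nat list list \<Rightarrow> nat list list \<times> nat" where
  "ins x [] = ([[x]], 0)"
| "ins x (r # rs) = (let k = count_below x r in
     if k = length r then ((r @ [x]) # rs, 0)
     else let (rs', i) = ins (r ! k) rs in (r[k := x] # rs', Suc i))"

definition dominates :: "nat list \<Rightarrow> nat list \<Rightarrow> bool" where
  "dominates r s \<longleftrightarrow> length s \<le> length r \<and> (\<forall>j<length s. r ! j < s ! j)"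

fun tab :: "nat list list \<Rightarrow> bool" where
  "tab [] \<longleftrightarrow> True"
| "tab (r # rs) \<longleftrightarrow> r \<noteq> [] \<and> sorted_wrt (<) r \<and> tab rs \<and> (rs \<noteq> [] \<longrightarrow> dominates r (hd rs))"

lemma count_below_le: "count_below x r \<le> length r"
  by (simp add: count_below_def length_takeWhile_le)

lemma nth_lt_count_below: "j < count_below x r \<Longrightarrow> r ! j < x"
  unfolding count_below_def by (metis nth_mem set_takeWhileD takeWhile_nth)

lemma nth_ge_count_below:
  assumes "sorted_wrt (<) r" "count_below x r \<le> j" "j < length r" "x \<notin> set r"
  shows "x < r ! j"
proof -
  have k: "count_below x r < length r" using assms by simp
  then have "\<not> r ! count_below x r < x"
    unfolding count_below_def by (metis nth_length_takeWhile)
  then have "x < r ! count_below x r" using assms(4) k by (metis linorder_neqE_nat nth_mem)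
  also have "r ! count_below x r \<le> r ! j"
    using assms sorted_wrt_nth_less[of "(<)" r "count_below x r" j] by (cases "count_below x r = j") auto
  finally show ?thesis .
qed

lemma count_below_eqI:
  assumes "sorted_wrt (<) r" "x \<notin> set r" "k \<le> length r"
    "\<And>j. j < k \<Longrightarrow> r ! j < x" "k < length r \<Longrightarrow> x < r ! k"
  shows "count_below x r = k"
proof (rule antisym)
  show "count_below x r \<le> k"
    using assms(3,5) nth_lt_count_below[of k x r] count_below_le[of x r]
    by (metis leI le_less_trans less_asym order_less_le_trans)
  show "k \<le> count_below x r"
    using assms nth_ge_count_below[of r x "count_below x r"] by (metis leI le_less_trans less_asym order_refl order_less_le_trans)
qed

lemma sorted_wrt_list_update:
  assumes "sorted_wrt (<) r" "k < length r" "\<And>j. j < k \<Longrightarrow> r ! j < x" "\<And>j. k < j \<Longrightarrow> j < length r \<Longrightarrow> x < r ! j"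
  shows "sorted_wrt (<) (r[k := (x::nat)])"
  using assms unfolding sorted_wrt_iff_nth_less by (auto simp: nth_list_update)

lemma distinct_bump:
  assumes "distinct (concat (r # rs))" "z \<in> set r"
  shows "distinct (z # concat rs)"
proof -
  have "distinct (concat rs)" "set r \<inter> set (concat rs) = {}" using assms(1) by (simp_all del: set_concat)
  then show ?thesis using assms(2) by (simp del: set_concat) blast
qed

lemma ins_mset: "mset (concat (fst (ins x P))) = add_mset x (mset (concat P))"
proof (induction x P rule: ins.induct)
  case (2 x r rs)
  let ?k = "count_below x r"
  show ?case
  proof (cases "?k = length r")
    case False
    then have k: "?k < length r" using count_below_le[of x r] by simp
    have "mset (r[?k := x]) = add_mset x (mset r - {#r ! ?k#})" using k by (simp add: mset_update)
    moreover have "r ! ?k \<in># mset r" using k by simp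
    ultimately show ?thesis using 2[OF refl False] False
      by (auto simp: Let_def split: prod.splits)
  qed (simp add: Let_def)
qed simp

lemma ins_neq_Nil: "fst (ins x P) \<noteq> []"
  by (cases P) (auto simp: Let_def split: prod.splits)

definition first_row :: "nat list list \<Rightarrow> nat list" where
  "first_row P = (if P = [] then [] else hd P)"

lemma first_row_ins:
  "hd (fst (ins x P)) = (let r = first_row P; k = count_below x r in if k = length r then r @ [x] else r[k := x])"
  by (cases P) (auto simp: Let_def first_row_def count_below_def split: prod.splits)

lemma sorted_first_row: "tab P \<Longrightarrow> sorted_wrt (<) (first_row P)"
  by (cases P) (auto simp: first_row_def)

lemma set_first_row: "set (first_row P) \<subseteq> set (concat P)"
  by (cases P) (auto simp: first_row_def)

lemma dominates_first_row: "tab (r # rs) \<Longrightarrow> dominates r (first_row rs)"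
  by (auto simp: first_row_def dominates_def)

text \<open>The bumping path moves weakly left: the entry below the bumped \<open>y\<close>, if any,
  exceeds \<open>y\<close>, so \<open>y\<close> lands at a position \<open>count_below y s\<close>
  not beyond \<open>?k\<close>, under an entry smaller than \<open>y\<close>.\<close>

lemma ins_tab:
  assumes "tab P" "distinct (x # concat P)"
  shows "tab (fst (ins x P))"
  using assms
proof (induction x P rule: ins.induct)
  case (2 x r rs)
  let ?k = "count_below x r"
  have srt: "sorted_wrt (<) r" and x: "x \<notin> set r" using 2 by auto
  show ?case
  proof (cases "?k = length r")
    case True
    then have "\<And>j. j < length r \<Longrightarrow> r ! j < x" using nth_lt_count_below[of _ x r] by simp
    then have "sorted_wrt (<) (r @ [x])" using srt by (auto simp: sorted_wrt_append in_set_conv_nth)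
    moreover have "dominates (r @ [x]) s" if "dominates r s" for s
      using that by (auto simp: dominates_def nth_append)
    ultimately show ?thesis using 2(2) True by (auto simp: Let_def)
  next
    case False
    then have k: "?k < length r" using count_below_le[of x r] by simp
    define y where "y = r ! ?k"
    define s where "s = first_row rs"
    have xy: "x < y" using nth_ge_count_below[OF srt _ k x] by (simp add: y_def)
    have y: "distinct (y # concat rs)" using 2(3) k by (intro distinct_bump[of r]) (auto simp: y_def)
    have tab': "tab (fst (ins y rs))" using 2(1)[OF refl False] 2(2) y by (simp add: y_def)
    have srt': "sorted_wrt (<) (r[?k := x])"
      using srt k nth_lt_count_below[of _ x r] nth_ge_count_below[OF srt _ _ x] by (intro sorted_wrt_list_update) auto
    have ys: "y \<notin> set s" using y set_first_row[of rs] by (auto simp: s_def)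
    have ss: "sorted_wrt (<) s" using sorted_first_row 2(2) by (simp add: s_def)
    have dom: "dominates r s" using dominates_first_row[OF 2(2)] by (simp add: s_def)
    have k': "count_below y s \<le> ?k"
    proof (rule ccontr)
      assume "\<not> count_below y s \<le> ?k"
      then have "s ! ?k < y" "?k < length s" using nth_lt_count_below[of ?k y s] count_below_le[of y s] by auto
      then show False using dom by (auto simp: dominates_def y_def)
    qed
    have lt: "r[?k := x] ! count_below y s < y"
      using k' xy k sorted_wrt_nth_less[OF srt, of "count_below y s" ?k] by (cases "count_below y s = ?k") (auto simp: y_def)
    have le: "r[?k := x] ! j \<le> r ! j" if "j < length r" for j
      using that xy k by (cases "j = ?k") (auto simp: y_def)
    have les: "r[?k := x] ! j < s ! j" if "j < length s" for j
      using le[of j] that dom by (fastforce simp: dominates_def)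
    have lens: "length s \<le> length r" using dom by (simp add: dominates_def)
    have "dominates (r[?k := x]) (hd (fst (ins y rs)))"
    proof (cases "count_below y s = length s")
      case True
      then have eq: "hd (fst (ins y rs)) = s @ [y]" by (simp add: first_row_ins s_def Let_def)
      show ?thesis unfolding eq dominates_def
      proof (intro conjI allI impI)
        show "length (s @ [y]) \<le> length (r[?k := x])" using True k' k by simp
        fix j assume "j < length (s @ [y])"
        then show "r[?k := x] ! j < (s @ [y]) ! j"
          using les[of j] lt True by (cases "j = length s") (auto simp: nth_append)
      qed
    next
      case False
      then have eq: "hd (fst (ins y rs)) = s[count_below y s := y]" by (simp add: first_row_ins s_def Let_def)
      show ?thesis unfolding eq dominates_def
      proof (intro conjI allI impI)
        show "length (s[count_below y s := y]) \<le> length (r[?k := x])" using lens by simp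
        fix j assume "j < length (s[count_below y s := y])"
        then show "r[?k := x] ! j < s[count_below y s := y] ! j"
          using les[of j] lt by (cases "j = count_below y s") auto
      qed
    qed
    then show ?thesis using False tab' srt' k by (auto simp: Let_def y_def split: prod.splits)
  qed
qed simp

lemma ins_shape:
  assumes "tab P" "distinct (x # concat P)" "ins x P = (P', i)"
  shows "i \<le> length P \<and> i < length P' \<and>
    map length P' = (if i < length P then (map length P)[i := Suc (length (P ! i))] else map length P @ [1])"
  using assms
proof (induction x P arbitrary: P' i rule: ins.induct)
  case (2 x r rs)
  let ?k = "count_below x r"
  show ?case
  proof (cases "?k = length r")
    case True
    then show ?thesis using 2 by (auto simp: Let_def)
  next
    case False
    then have k: "?k < length r" using count_below_le[of x r] by simp
    obtain rs' i' where e: "ins (r ! ?k) rs = (rs', i')" by (metis prod.exhaust)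
    have d: "distinct (r ! ?k # concat rs)" using 2(3) k by (intro distinct_bump[of r]) auto
    have "P' = r[?k := x] # rs'" "i = Suc i'" using 2(4) e False by (auto simp: Let_def)
    then show ?thesis using 2(1)[OF refl False _ d e] 2(2) by auto
  qed
qed auto

lemma ins_inj:
  assumes "tab P" "distinct (x # concat P)" "tab P'" "distinct (x' # concat P')" "ins x P = ins x' P'"
  shows "x = x' \<and> P = P'"
  using assms
proof (induction x P arbitrary: x' P' rule: ins.induct)
  case (1 x)
  then show ?case by (cases P') (auto simp: Let_def split: if_splits prod.splits)
next
  case (2 x r rs)
  let ?k = "count_below x r"
  obtain r' rs' where P': "P' = r' # rs'"
    using 2 by (cases P') (auto simp: Let_def split: if_splits prod.splits)
  let ?k' = "count_below x' r'"
  show ?case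
  proof (cases "?k = length r")
    case True
    then have "?k' = length r'" using 2(6) P' by (auto simp: Let_def split: if_splits prod.splits)
    then show ?thesis using True 2(6) P' by (auto simp: Let_def)
  next
    case False
    then have F': "?k' \<noteq> length r'" using 2(6) P' by (auto simp: Let_def split: if_splits prod.splits)
    have k: "?k < length r" "?k' < length r'"
      using False F' count_below_le[of x r] count_below_le[of x' r'] by auto
    have eq: "ins (r ! ?k) rs = ins (r' ! ?k') rs'" "r[?k := x] = r'[?k' := x']"
      using 2(6) P' False F' by (auto simp: Let_def split: prod.splits)
    have "distinct (r ! ?k # concat rs)" "distinct (r' ! ?k' # concat rs')"
      using 2(3) 2(5) P' k distinct_bump[of r rs "r ! ?k"] distinct_bump[of r' rs' "r' ! ?k'"] by auto
    then have rs: "r ! ?k = r' ! ?k'" "rs = rs'"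
      using 2(1)[OF refl False _ _ _ _ eq(1)] 2(2,4) P' by auto
    \<comment> \<open>In the new row exactly the entries up to position
      \<open>count_below x r\<close> are smaller than the bumped entry, so the position of the bump
      can be read off from the result.\<close>
    have *: "count_below (r ! count_below x r) (r[count_below x r := x]) = Suc (count_below x r)"
      if srt: "sorted_wrt (<) r" and x: "x \<notin> set r" and k: "count_below x r < length r" for x r
    proof (rule count_below_eqI)
      let ?k = "count_below x r"
      have xk: "x < r ! ?k" using nth_ge_count_below[OF srt _ k x] by simp
      show "sorted_wrt (<) (r[?k := x])"
        using srt k nth_lt_count_below[of _ x r] nth_ge_count_below[OF srt _ _ x] by (intro sorted_wrt_list_update) auto
      have "distinct r" using srt strict_sorted_iff by blast
      then show "r ! ?k \<notin> set (r[?k := x])"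
        using k xk by (auto simp: in_set_conv_nth nth_list_update nth_eq_iff_index_eq split: if_splits)
      show "r[?k := x] ! j < r ! ?k" if "j < Suc ?k" for j
        using that k xk sorted_wrt_nth_less[OF srt, of j ?k] by (auto simp: nth_list_update less_Suc_eq)
      show "r ! ?k < r[?k := x] ! Suc ?k" if "Suc ?k < length (r[?k := x])"
        using that sorted_wrt_nth_less[OF srt, of ?k "Suc ?k"] by simp
    qed (use k in simp)
    have "Suc ?k = Suc ?k'"
      using *[of r x] *[of r' x'] rs eq(2) 2(2-5) P' k by auto
    then have kk: "?k = ?k'" by simp
    then have "x = x'" using eq(2) k by (metis nth_list_update_eq)
    moreover have "r = r'"
      using eq(2) kk rs by (metis list_update_id list_update_overwrite)
    ultimately show ?thesis using rs P' by simp
  qed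
qed

text \<open>Reverse bumping: an entry \<open>y\<close> pushed up from below replaces the last entry
  of \<open>r\<close> smaller than \<open>y\<close>, which is pushed out in turn. The condition on
  \<open>i\<close> says that the last cell of row \<open>i\<close> is a corner, so that it can be
  removed.\<close>

lemma ins_surj:
  assumes "tab P" "distinct (concat P)" "i < length P" "Suc i < length P \<longrightarrow> length (P ! Suc i) < length (P ! i)"
  shows "\<exists>P0 x. tab P0 \<and> distinct (x # concat P0) \<and> ins x P0 = (P, i)"
  using assms
proof (induction P arbitrary: i)
  case (Cons r rs)
  have srt: "sorted_wrt (<) r" and ne: "r \<noteq> []" and tabrs: "tab rs" using Cons.prems by auto
  show ?case
  proof (cases i)
    case 0
    define b x where "b = butlast r" "x = last r"
    have r: "r = b @ [x]" using ne by (simp add: b_x_def)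
    have bx: "\<forall>z\<in>set b. z < x" "sorted_wrt (<) b" using srt unfolding r by (auto simp: sorted_wrt_append)
    have cb: "count_below x b = length b" unfolding count_below_def using bx by (metis takeWhile_eq_all_conv)
    show ?thesis
    proof (cases "b = []")
      case True
      have "rs = []" using Cons.prems(1,4) 0 True r by (cases rs) auto
      then show ?thesis using True r 0 by (intro exI[of _ "[]"] exI[of _ x]) auto
    next
      case False
      have "dominates b (hd rs)" if "rs \<noteq> []"
      proof -
        have "length (hd rs) < length r" using Cons.prems(4) 0 that by (cases rs) auto
        then show ?thesis using Cons.prems(1) that r by (auto simp: dominates_def nth_append)
      qed
      then have "tab (b # rs)" using False bx tabrs by auto
      moreover have "distinct (x # concat (b # rs))" using Cons.prems(2) r by auto
      moreover have "ins x (b # rs) = (r # rs, i)" using cb r 0 by (simp add: Let_def)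
      ultimately show ?thesis by blast
    qed
  next
    case (Suc i')
    have "\<exists>P0 x. tab P0 \<and> distinct (x # concat P0) \<and> ins x P0 = (rs, i')"
      using Cons.IH[of i'] Cons.prems Suc by auto
    then obtain Q y where Q: "tab Q" "distinct (y # concat Q)" "ins y Q = (rs, i')" by blast
    define q where "q = first_row Q"
    define k' where "k' = count_below y q"
    have rsne: "rs \<noteq> []" using ins_neq_Nil[of y Q] Q(3) by auto
    define s where "s = hd rs"
    have dom: "dominates r s" using Cons.prems(1) rsne by (simp add: s_def)
    have s: "s = (if k' = length q then q @ [y] else q[k' := y])"
      using first_row_ins[of y Q] Q(3) by (simp add: s_def q_def k'_def Let_def)
    have k'le: "k' \<le> length q" by (simp add: k'_def count_below_le)
    have sk': "k' < length s" "s ! k' = y" using k'le by (auto simp: s nth_append)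
    have qs: "sorted_wrt (<) q" "y \<notin> set q" using sorted_first_row[OF Q(1)] Q(2) set_first_row[of Q] by (auto simp: q_def)
    have lens: "length q \<le> length s" "length s \<le> length r" using dom by (auto simp: s dominates_def)
    have rk': "r ! k' < y" "k' < length r" using dom sk' by (auto simp: dominates_def)
    have "mset (concat rs) = add_mset y (mset (concat Q))" using ins_mset[of y Q] Q(3) by simp
    then have yrs: "set (concat rs) = insert y (set (concat Q))" by (metis set_mset_add_mset_insert set_mset_mset)
    have yr: "y \<notin> set r" using Cons.prems(2) yrs by auto
    \<comment> \<open>The subtraction is safe: the entry of \<open>r\<close> above the place
      \<open>k'\<close> of \<open>y\<close> is smaller than \<open>y\<close>, so
      \<open>count_below y r\<close> exceeds \<open>k'\<close>.\<close>
    define k where "k = count_below y r - 1"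
    have "k' < count_below y r"
      using nth_ge_count_below[OF srt _ rk'(2) yr] rk'(1) by (meson leI less_asym)
    then have kk: "count_below y r = Suc k" "k' \<le> k" by (auto simp: k_def)
    have klen: "k < length r" using kk count_below_le[of y r] by simp
    define x where "x = r ! k"
    have xy: "x < y" using nth_lt_count_below[of k y r] kk by (simp add: x_def)
    have gt: "y < r ! j" if "k < j" "j < length r" for j
      using nth_ge_count_below[OF srt _ that(2) yr] that kk by simp
    define r0 where "r0 = r[k := y]"
    have dr: "distinct r" using srt strict_sorted_iff by blast
    have srt0: "sorted_wrt (<) r0" unfolding r0_def
      using srt klen xy gt sorted_wrt_nth_less[OF srt, of _ k]
      by (intro sorted_wrt_list_update) (auto simp: x_def intro: less_trans)
    have set0: "set r0 \<subseteq> insert y (set r)" "x \<notin> set r0"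
      using set_update_subset_insert[of r k y] dr klen xy
      by (auto simp: r0_def x_def in_set_conv_nth nth_list_update nth_eq_iff_index_eq split: if_splits)
    have "count_below x r0 = k"
      using srt0 set0(2) klen xy sorted_wrt_nth_less[OF srt, of _ k]
      by (intro count_below_eqI) (auto simp: r0_def x_def nth_list_update)
    then have "ins x (r0 # Q) = (r0[k := x] # rs, Suc i')"
      using klen Q(3) by (simp add: Let_def r0_def)
    moreover have "r0[k := x] = r" by (simp add: r0_def x_def)
    ultimately have "ins x (r0 # Q) = (r # rs, i)" using Suc by simp
    moreover have "tab (r0 # Q)"
    proof -
      have "dominates r0 q" unfolding dominates_def
      proof (intro conjI allI impI)
        show "length q \<le> length r0" using lens by (simp add: r0_def)
        fix j assume j: "j < length q"
        then have rj: "r ! j < s ! j" using dom lens by (simp add: dominates_def)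
        show "r0 ! j < q ! j"
        proof (cases "j = k")
          case True
          then have "k' < length q" using j kk by simp
          then have "y < q ! j" using nth_ge_count_below[OF qs(1) _ j qs(2)] True kk by (simp add: k'_def)
          then show ?thesis using True klen by (simp add: r0_def)
        next
          case False
          show ?thesis
          proof (cases "j = k'")
            case True
            then have "y < q ! j" using nth_ge_count_below[OF qs(1) _ j qs(2)] by (simp add: k'_def)
            then show ?thesis using True False rk' by (simp add: r0_def)
          next
            case F2: False
            have "s ! j = q ! j" using F2 j by (simp add: s nth_append)
            then show ?thesis using rj False by (simp add: r0_def)
          qed
        qed
      qed
      then show ?thesis using srt0 Q(1) ne by (auto simp: r0_def q_def first_row_def split: if_splits)
    qed
    moreover have "distinct (x # concat (r0 # Q))"
    proof -
      have "distinct r0" using srt0 strict_sorted_iff by blast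
      moreover have dj: "set r \<inter> set (concat rs) = {}" using Cons.prems(2) by (simp del: set_concat)
      then have "set r0 \<inter> set (concat Q) = {}" using set0(1) yrs Q(2) by (auto simp del: set_concat)
      moreover have "x \<in> set r" using klen by (simp add: x_def)
      then have "x \<notin> set (concat Q)" using dj yrs by (auto simp del: set_concat)
      ultimately show ?thesis using set0(2) Q(2) by (simp del: set_concat)
    qed
    ultimately show ?thesis by blast
  qed
qed simp

text \<open>The row bumping lemma. If both insertions bump an entry from the row, the bumped entries
  are in the same relative order as \<open>x\<close> and \<open>x'\<close>, so the question passes
  to the next row; it is decided where one of the paths ends.\<close>

lemma ins_row_order:
  assumes "tab P" "distinct (x # x' # concat P)" "ins x P = (P', i)" "ins x' P' = (P'', i')"
  shows "i < i' \<longleftrightarrow> x' < x"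
  using assms
proof (induction P arbitrary: x x' P' P'' i i')
  case Nil
  then show ?case
    by (cases "x < x'") (auto simp: Let_def count_below_def split: prod.splits if_splits)
next
  case (Cons r rs)
  let ?k = "count_below x r"
  have srt: "sorted_wrt (<) r" and x: "x \<notin> set r" "x' \<notin> set r" "x \<noteq> x'" using Cons.prems by auto
  show ?case
  proof (cases "?k = length r")
    case True
    then have P': "P' = (r @ [x]) # rs" "i = 0" using Cons.prems(3) by (auto simp: Let_def)
    have "\<And>j. j < length r \<Longrightarrow> r ! j < x" using nth_lt_count_below[of _ x r] True by simp
    then have rx: "\<forall>z\<in>set r. z < x" by (auto simp: in_set_conv_nth)
    show ?thesis
    proof (cases "x < x'")
      case True
      then have "takeWhile (\<lambda>y. y < x') (r @ [x]) = r @ [x]"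
        using rx by (subst takeWhile_eq_all_conv) (auto intro: less_trans)
      then have "count_below x' (r @ [x]) = length (r @ [x])" by (simp add: count_below_def)
      then have "i' = 0" using Cons.prems(4) P' by (auto simp: Let_def)
      then show ?thesis using P' True by simp
    next
      case False
      have "count_below x' (r @ [x]) \<noteq> length (r @ [x])"
        using nth_lt_count_below[of "length r" x' "r @ [x]"] False by auto
      then have "0 < i'" using Cons.prems(4) P' by (auto simp: Let_def split: prod.splits)
      then show ?thesis using P' False x by simp
    qed
  next
    case False
    then have k: "?k < length r" using count_below_le[of x r] by simp
    define y where "y = r ! ?k"
    obtain rs1 i1 where e1: "ins y rs = (rs1, i1)" by (metis prod.exhaust)
    define r1 where "r1 = r[?k := x]"
    have P': "P' = r1 # rs1" "i = Suc i1" using Cons.prems(3) e1 False by (auto simp: Let_def y_def r1_def)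
    have xy: "x < y" using nth_ge_count_below[OF srt _ k x(1)] by (simp add: y_def)
    have srt1: "sorted_wrt (<) r1" unfolding r1_def
      using srt k nth_lt_count_below[of _ x r] nth_ge_count_below[OF srt _ _ x(1)] by (intro sorted_wrt_list_update) auto
    have x'r1: "x' \<notin> set r1" using x set_update_subset_insert[of r ?k x] by (auto simp: r1_def)
    let ?k' = "count_below x' r1"
    have r1k: "r1 ! ?k = x" using k by (simp add: r1_def)
    have len: "length r1 = length r" by (simp add: r1_def)
    have dr: "distinct r" using srt strict_sorted_iff by blast
    show ?thesis
    proof (cases "x < x'")
      case True
      have kk: "?k < ?k'"
        using nth_ge_count_below[OF srt1 _ _ x'r1, of ?k] r1k k len True by (intro ccontr[of "?k < ?k'"]) (simp add: not_less)
      show ?thesis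
      proof (cases "?k' = length r1")
        case True
        then have "i' = 0" using Cons.prems(4) P' by (auto simp: Let_def)
        then show ?thesis using P' \<open>x < x'\<close> by simp
      next
        case F: False
        then have k': "?k' < length r" using count_below_le[of x' r1] len by simp
        define y' where "y' = r1 ! ?k'"
        have y'r: "y' = r ! ?k'" using kk by (simp add: y'_def r1_def)
        obtain rs2 i2 where e2: "ins y' rs1 = (rs2, i2)" by (metis prod.exhaust)
        have i': "i' = Suc i2" using Cons.prems(4) P' e2 F by (auto simp: Let_def y'_def)
        have yy: "y < y'" using sorted_wrt_nth_less[OF srt kk k'] by (simp add: y_def y'r)
        have "y \<in> set r" "y' \<in> set r" using k k' by (auto simp: y_def y'r)
        then have "distinct (y # y' # concat rs)"
          using Cons.prems(2) yy distinct_bump[of r rs y] distinct_bump[of r rs y'] by simp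
        then have "i1 < i2 \<longleftrightarrow> y' < y" using Cons.IH[OF _ _ e1 e2] Cons.prems(1) by simp
        then show ?thesis using i' P' yy \<open>x < x'\<close> by simp
      qed
    next
      case F: False
      then have lt: "x' < x" using x by simp
      have kk: "?k' \<le> ?k" using nth_lt_count_below[of ?k x' r1] r1k lt by (intro ccontr[of "?k' \<le> ?k"]) simp
      then have F': "?k' \<noteq> length r1" using k len by simp
      define y' where "y' = r1 ! ?k'"
      obtain rs2 i2 where e2: "ins y' rs1 = (rs2, i2)" by (metis prod.exhaust)
      have i': "i' = Suc i2" using Cons.prems(4) P' e2 F' by (auto simp: Let_def y'_def)
      have "y' \<le> x" using kk r1k sorted_wrt_nth_less[OF srt1, of ?k' ?k] k len by (cases "?k' = ?k") (auto simp: y'_def)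
      then have yy: "y' < y" using xy by simp
      have "y' \<in> set r1" using kk k len by (simp add: y'_def)
      then have "y' \<in> insert x (set r)" using set_update_subset_insert[of r ?k x] by (auto simp: r1_def)
      moreover have "y \<in> set r" using k by (simp add: y_def)
      ultimately have "distinct (y # y' # concat rs)"
        using Cons.prems(2) yy distinct_bump[of r rs y] distinct_bump[of r rs y'] by auto
      then have "i1 < i2 \<longleftrightarrow> y' < y" using Cons.IH[OF _ _ e1 e2] Cons.prems(1) by simp
      then show ?thesis using i' P' yy lt by simp
    qed
  qed
qed

section \<open>Knuth equivalence and recording tableaux\<close>

inductive knuth :: "nat list \<Rightarrow> nat list \<Rightarrow> bool" where
  acb: "a < b \<Longrightarrow> b < c \<Longrightarrow> knuth (u @ [a, c, b] @ v) (u @ [c, a, b] @ v)"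
| bac: "a < b \<Longrightarrow> b < c \<Longrightarrow> knuth (u @ [b, a, c] @ v) (u @ [b, c, a] @ v)"

definition knuth_step :: "nat list \<Rightarrow> nat list \<Rightarrow> bool" where
  "knuth_step u v \<longleftrightarrow> knuth u v \<or> knuth v u"

abbreviation knuth_equiv :: "nat list \<Rightarrow> nat list \<Rightarrow> bool" (infix "\<approx>k" 50) where
  "u \<approx>k v \<equiv> knuth_step\<^sup>*\<^sup>* u v"

lemma knuth_equiv_sym: "u \<approx>k v \<Longrightarrow> v \<approx>k u"
proof (induction rule: rtranclp_induct)
  case (step v w)
  then have "knuth_step w v" by (auto simp: knuth_step_def)
  then show ?case using step.IH by (rule converse_rtranclp_into_rtranclp)
qed simp

lemma knuth_append: "knuth u v \<Longrightarrow> knuth (p @ u @ q) (p @ v @ q)"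
proof (induction rule: knuth.induct)
  case (acb a b c u v)
  then show ?case using knuth.acb[of a b c "p @ u" "v @ q"] by simp
next
  case (bac a b c u v)
  then show ?case using knuth.bac[of a b c "p @ u" "v @ q"] by simp
qed

lemma knuth_equiv_append: "u \<approx>k v \<Longrightarrow> p @ u @ q \<approx>k p @ v @ q"
proof (induction rule: rtranclp_induct)
  case (step v w)
  then have "knuth_step (p @ v @ q) (p @ w @ q)" unfolding knuth_step_def using knuth_append by blast
  then show ?case using step.IH by (rule rtranclp.rtrancl_into_rtrancl[rotated])
qed simp

lemma knuth_row_right:
  assumes "x < y" "sorted_wrt (<) (y # b)"
  shows "y # b @ [x] \<approx>k y # x # b"
  using assms(2)
proof (induction b rule: rev_induct)
  case (snoc z b)
  define w where "w = last (y # b)"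
  have e: "y # b = butlast (y # b) @ [w]" by (simp add: w_def)
  have srt: "sorted_wrt (<) (y # b)" "\<forall>t\<in>set (y # b). t < z" using snoc.prems by (auto simp: sorted_wrt_append)
  have "w \<in> set (y # b)" by (metis e in_set_conv_decomp)
  then have w: "x < w" "w < z" using srt assms(1) by auto
  have k: "knuth (butlast (y # b) @ [w, x, z] @ []) (butlast (y # b) @ [w, z, x] @ [])"
    using w by (intro knuth.bac)
  have eqs: "butlast (y # b) @ [w, x, z] @ [] = y # b @ [x] @ [z]" "butlast (y # b) @ [w, z, x] @ [] = y # (b @ [z]) @ [x]"
    using e by (metis append.assoc append_Cons append_Nil append_Nil2)+
  have "knuth_step (y # (b @ [z]) @ [x]) (y # b @ [x] @ [z])"
    using k unfolding eqs knuth_step_def by blast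
  moreover have "[] @ (y # b @ [x]) @ [z] \<approx>k [] @ (y # x # b) @ [z]"
    by (rule knuth_equiv_append[OF snoc.IH[OF srt(1)]])
  ultimately show ?case by (simp add: converse_rtranclp_into_rtranclp)
qed simp

lemma knuth_row_left:
  assumes "sorted_wrt (<) (a @ [x])" "x < y"
  shows "a @ [y, x] \<approx>k y # a @ [x]"
  using assms
proof (induction a arbitrary: x rule: rev_induct)
  case (snoc w a)
  then have w: "w < x" "sorted_wrt (<) (a @ [w])" "w < y" by (auto simp: sorted_wrt_append)
  have "knuth (a @ [w, y, x] @ []) (a @ [y, w, x] @ [])" using w snoc.prems by (intro knuth.acb)
  then have "knuth_step ((a @ [w]) @ [y, x]) (a @ [y, w] @ [x])" by (simp add: knuth_step_def)
  moreover have "[] @ (a @ [y, w]) @ [x] \<approx>k [] @ (y # a @ [w]) @ [x]"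
    by (rule knuth_equiv_append[OF snoc.IH[OF w(2,3)]])
  ultimately show ?case by (simp add: converse_rtranclp_into_rtranclp)
qed simp

text \<open>One row of an insertion as Knuth moves: appended to the row, \<open>x\<close> travels
  left through \<open>b\<close> until it stands next to \<open>y\<close>, which then travels left
  through \<open>a\<close> and leaves the row at the front.\<close>

lemma knuth_row:
  assumes "sorted_wrt (<) (a @ x # b)" "sorted_wrt (<) (a @ y # b)" "x < y"
  shows "y # a @ x # b \<approx>k a @ (y # b) @ [x]"
proof -
  have "a @ (y # b @ [x]) @ [] \<approx>k a @ (y # x # b) @ []"
    using assms by (intro knuth_equiv_append knuth_row_right) (auto simp: sorted_wrt_append)
  moreover have "[] @ (a @ [y, x]) @ b \<approx>k [] @ (y # a @ [x]) @ b"
    using assms by (intro knuth_equiv_append knuth_row_left) (auto simp: sorted_wrt_append)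
  ultimately have "a @ (y # b) @ [x] \<approx>k y # a @ x # b" by simp
  then show ?thesis by (rule knuth_equiv_sym)
qed

definition word :: "nat list list \<Rightarrow> nat list" where
  "word P = concat (rev P)"

lemma word_Cons: "word (r # rs) = word rs @ r"
  by (simp add: word_def)

lemma word_ins:
  assumes "tab P" "distinct (x # concat P)"
  shows "word (fst (ins x P)) \<approx>k word P @ [x]"
  using assms
proof (induction x P rule: ins.induct)
  case (2 x r rs)
  let ?k = "count_below x r"
  have srt: "sorted_wrt (<) r" and x: "x \<notin> set r" using 2 by auto
  show ?case
  proof (cases "?k = length r")
    case True
    then show ?thesis by (simp add: Let_def word_Cons)
  next
    case False
    then have k: "?k < length r" using count_below_le[of x r] by simp
    define y where "y = r ! ?k"
    define a b where "a = take ?k r" and "b = drop (Suc ?k) r"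
    have r: "r = a @ y # b" "r[?k := x] = a @ x # b"
      using k id_take_nth_drop[OF k] upd_conv_take_nth_drop[OF k] by (auto simp: a_def b_def y_def)
    have xy: "x < y" using nth_ge_count_below[OF srt _ k x] by (simp add: y_def)
    have srt': "sorted_wrt (<) (a @ x # b)" unfolding r(2)[symmetric]
      using srt k nth_lt_count_below[of _ x r] nth_ge_count_below[OF srt _ _ x] by (intro sorted_wrt_list_update) auto
    have d: "distinct (y # concat rs)" using 2(3) k by (intro distinct_bump[of r]) (auto simp: y_def)
    have "word (fst (ins y rs)) \<approx>k word rs @ [y]" using 2(1)[OF refl False] 2(2) d by (simp add: y_def)
    from knuth_equiv_append[OF this, of "[]" "a @ x # b"]
    have 1: "word (fst (ins y rs)) @ (a @ x # b) \<approx>k word rs @ y # a @ x # b" by simp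
    have "y # a @ x # b \<approx>k a @ (y # b) @ [x]" using knuth_row[OF srt' _ xy] srt r by simp
    from knuth_equiv_append[OF this, of "word rs" "[]"]
    have 2: "word rs @ y # a @ x # b \<approx>k word rs @ (a @ (y # b) @ [x])" by simp
    from rtranclp_trans[OF 1 2] have "word (fst (ins y rs)) @ (a @ x # b) \<approx>k word (r # rs) @ [x]" by (simp add: word_Cons r)
    moreover have "word (fst (ins x (r # rs))) = word (fst (ins y rs)) @ (a @ x # b)"
      using False r(2) by (auto simp: Let_def word_Cons y_def split: prod.splits)
    ultimately show ?thesis by simp
  qed
qed (simp add: word_def)

section \<open>The Robinson-Schensted map and its recording tableau\<close>

definition rs_step :: "nat list list \<times> (nat \<times> nat \<Rightarrow> nat) \<Rightarrow> nat \<Rightarrow> nat list list \<times> (nat \<times> nat \<Rightarrow> nat)" where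
  "rs_step s x = (case s of (P, Q) \<Rightarrow> (case ins x P of (P', i) \<Rightarrow>
     (P', Q((i, length (P' ! i) - 1) := Suc (length (concat P))))))"

definition rs :: "nat list \<Rightarrow> nat list list \<times> (nat \<times> nat \<Rightarrow> nat)" where
  "rs u = foldl rs_step ([], \<lambda>_. 0) u"

lemma rs_Nil: "rs [] = ([], \<lambda>_. 0)"
  by (simp add: rs_def)

lemma rs_snoc: "rs (u @ [x]) = rs_step (rs u) x"
  by (simp add: rs_def)

lemma fst_rs_snoc: "fst (rs (u @ [x])) = fst (ins x (fst (rs u)))"
  by (simp add: rs_snoc rs_step_def split: prod.splits)

definition shp :: "nat list list \<Rightarrow> (nat \<times> nat) set" where
  "shp P = {(i, j). i < length P \<and> j < length (P ! i)}"

lemma cells_shape: "cells (map length P, []) = shp P"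
  by (auto simp: cells_def shp_def part_row_def)

lemma shp_eq: "shp P = (\<Union>i<length P. {i} \<times> {..<length (P ! i)})"
  by (auto simp: shp_def)

lemma finite_shp: "finite (shp P)"
  by (simp add: shp_eq)

lemma card_shp: "card (shp P) = length (concat P)"
proof -
  have "card (shp P) = (\<Sum>i<length P. length (P ! i))"
    unfolding shp_eq by (subst card_UN_disjoint) (auto simp: card_cartesian_product)
  then show ?thesis by (simp add: length_concat sum_list_sum_nth atLeast0LessThan)
qed

lemma rs_mset: "mset (concat (fst (rs u))) = mset u"
  by (induction u rule: rev_induct) (auto simp: rs_Nil fst_rs_snoc ins_mset)

lemma rs_tab: "distinct u \<Longrightarrow> tab (fst (rs u)) \<and> distinct (concat (fst (rs u)))"
proof (induction u rule: rev_induct)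
  case (snoc x u)
  have "mset (concat (fst (rs u))) = mset u" by (rule rs_mset)
  then have "set (concat (fst (rs u))) = set u" by (metis set_mset_mset)
  then have d: "distinct (x # concat (fst (rs u)))" using snoc by simp
  have "mset (concat (fst (rs (u @ [x])))) = mset (u @ [x])" by (rule rs_mset)
  then have "distinct (concat (fst (rs (u @ [x]))))" using snoc.prems by (metis mset_eq_imp_distinct_iff)
  moreover have "tab (fst (rs (u @ [x])))" unfolding fst_rs_snoc using ins_tab[OF _ d] snoc by simp
  ultimately show ?case by blast
qed (simp add: rs_Nil)

lemma rs_distinct: "distinct (x # u) \<Longrightarrow> distinct (x # concat (fst (rs u)))"
  using rs_tab[of u] rs_mset[of u] by (metis distinct.simps(2) set_mset_mset)

lemma word_rs: "distinct u \<Longrightarrow> word (fst (rs u)) \<approx>k u"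
proof (induction u rule: rev_induct)
  case (snoc x u)
  have d: "distinct (x # concat (fst (rs u)))" using snoc by (intro rs_distinct) simp
  have 1: "word (fst (rs (u @ [x]))) \<approx>k word (fst (rs u)) @ [x]"
    unfolding fst_rs_snoc using rs_tab[of u] snoc by (intro word_ins d) simp
  have "[] @ word (fst (rs u)) @ [x] \<approx>k [] @ u @ [x]"
    using snoc by (intro knuth_equiv_append) simp
  then have 2: "word (fst (rs u)) @ [x] \<approx>k u @ [x]" by simp
  show ?case by (rule rtranclp_trans[OF 1 2])
qed (simp add: rs_Nil word_def)

lemma rs_eq_knuth_equiv:
  assumes "distinct u" "distinct v" "fst (rs u) = fst (rs v)"
  shows "u \<approx>k v"
  using word_rs[OF assms(1)] word_rs[OF assms(2)] knuth_equiv_sym assms(3) by (metis rtranclp_trans)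

lemma shp_ins:
  assumes "tab P" "distinct (x # concat P)" "ins x P = (P', i)"
  shows "shp P' = insert (i, length (P' ! i) - 1) (shp P)" "(i, length (P' ! i) - 1) \<notin> shp P"
proof -
  have i: "i \<le> length P" "i < length P'"
    and m: "map length P' = (if i < length P then (map length P)[i := Suc (length (P ! i))] else map length P @ [1])"
    using ins_shape[OF assms] by auto
  have "length P' = length (map length P')" by simp
  also have "\<dots> = (if i < length P then length P else Suc (length P))" unfolding m by simp
  finally have len: "length P' = (if i < length P then length P else Suc (length P))" .
  have row: "length (P' ! j) = (if j = i then (if i < length P then Suc (length (P ! i)) else 1) else length (P ! j))"
    if "j < length P'" for j
  proof -
    have "length (P' ! j) = map length P' ! j" using that by simp
    also have "\<dots> = (if j = i then (if i < length P then Suc (length (P ! i)) else 1) else length (P ! j))"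
      unfolding m using that len i by (auto simp: nth_append)
    finally show ?thesis .
  qed
  show "(i, length (P' ! i) - 1) \<notin> shp P" using row[OF i(2)] by (auto simp: shp_def)
  have "(a, b) \<in> shp P' \<longleftrightarrow> (a, b) \<in> insert (i, length (P' ! i) - 1) (shp P)" for a b
  proof (cases "a = i")
    case True
    then show ?thesis using row[OF i(2)] i by (auto simp: shp_def split: if_splits)
  next
    case False
    then have "a < length P' \<longleftrightarrow> a < length P" using len i by auto
    then show ?thesis using False row[of a] by (auto simp: shp_def)
  qed
  then show "shp P' = insert (i, length (P' ! i) - 1) (shp P)" by auto
qed

lemma tab_row_le: "tab P \<Longrightarrow> i \<le> j \<Longrightarrow> j < length P \<Longrightarrow> length (P ! j) \<le> length (P ! i)"
proof (induction P arbitrary: i j)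
  case (Cons r rs)
  have hd: "length (rs ! 0) \<le> length r" if "rs \<noteq> []"
    using Cons.prems(1) that by (simp add: dominates_def hd_conv_nth)
  show ?case
  proof (cases j)
    case (Suc j')
    show ?thesis
    proof (cases i)
      case 0
      then show ?thesis using Cons Suc hd Cons.IH[of 0 j'] by (cases rs) force+
    next
      case (Suc i')
      then show ?thesis using Cons.IH[of i' j'] Cons.prems \<open>j = Suc j'\<close> by simp
    qed
  qed (use Cons in simp)
qed simp

lemma tab_row_pos: "tab P \<Longrightarrow> i < length P \<Longrightarrow> 0 < length (P ! i)"
proof (induction P arbitrary: i)
  case (Cons r rs)
  then show ?case by (cases i) auto
qed simp

lemma tab_partition: "tab P \<Longrightarrow> is_partition (map length P)"
  unfolding is_partition_def sorted_wrt_iff_nth_less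
  using tab_row_le[of P] tab_row_pos[of P] by (force simp: in_set_conv_nth)

lemma SYT_zero: "T \<in> SYT C \<Longrightarrow> c \<notin> C \<Longrightarrow> T c = 0"
  unfolding SYT_def by blast

lemma SYT_label_le: "T \<in> SYT C \<Longrightarrow> T c \<le> card C"
proof (cases "c \<in> C")
  case True
  assume "T \<in> SYT C"
  then have "bij_betw T C {1..card C}" by (simp add: SYT_def)
  from bij_betw_apply[OF this True] show ?thesis by simp
qed (simp add: SYT_zero)

lemma SYT_extend:
  assumes "finite C" "T \<in> SYT C" "c \<notin> C"
    "\<And>d. d \<in> C \<Longrightarrow> \<not> (fst d = fst c \<and> snd c < snd d)" "\<And>d. d \<in> C \<Longrightarrow> \<not> (snd d = snd c \<and> fst c < fst d)"
  shows "T(c := Suc (card C)) \<in> SYT (insert c C)"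
proof -
  let ?T = "T(c := Suc (card C))"
  have bij: "bij_betw T C {1..card C}" using assms(2) by (simp add: SYT_def)
  then have "bij_betw ?T C {1..card C}" using assms(3) by (subst bij_betw_cong[of _ _ T]) auto
  then have "bij_betw ?T (insert c C) (insert (Suc (card C)) {1..card C})"
    using notIn_Un_bij_betw[of c C ?T "{1..card C}"] assms(3) by simp
  then have "bij_betw ?T (insert c C) {1..card (insert c C)}"
    using assms(1,3) by (simp add: atLeastAtMostSuc_conv)
  moreover have le: "T d \<le> card C" if "d \<in> C" for d using bij that unfolding bij_betw_def by auto
  have "?T (i, j) < ?T (i', j')"
    if h: "(i, j) \<in> insert c C" "(i', j') \<in> insert c C" "i = i' \<and> j < j' \<or> j = j' \<and> i < i'" for i j i' j'
  proof -
    consider "(i, j) \<in> C" "(i', j') \<in> C" | "(i, j) \<in> C" "(i', j') = c" | "(i, j) = c" "(i', j') \<in> C" | "(i, j) = c" "(i', j') = c"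
      using h(1,2) by blast
    then show ?thesis
    proof cases
      case 1
      then have "T (i, j) < T (i', j')" using assms(2) h(3) unfolding SYT_def by blast
      then show ?thesis using 1 assms(3) by auto
    next
      case 2
      then show ?thesis using le[of "(i, j)"] assms(3) by auto
    next
      case 3
      then show ?thesis using assms(4,5)[of "(i', j')"] h(3) by auto
    next
      case 4
      then show ?thesis using h(3) by auto
    qed
  qed
  ultimately show ?thesis using assms(2) unfolding SYT_def by auto
qed

lemma SYT_restrict:
  assumes "finite C" "c \<notin> C" "T \<in> SYT (insert c C)" "T c = Suc (card C)"
  shows "T(c := 0) \<in> SYT C"
proof -
  let ?T = "T(c := 0)"
  have bij: "bij_betw T (insert c C) {1..Suc (card C)}" using assms by (simp add: SYT_def)
  have "T ` C = T ` (insert c C - {c})" using assms(2) by simp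
  also have "\<dots> = T ` insert c C - T ` {c}"
    using bij unfolding bij_betw_def by (intro inj_on_image_set_diff[of _ "insert c C"]) auto
  also have "\<dots> = {1..Suc (card C)} - {Suc (card C)}"
    using bij_betw_imp_surj_on[OF bij] assms(4) by simp
  finally have "bij_betw T C ({1..Suc (card C)} - {Suc (card C)})"
    using bij unfolding bij_betw_def by (auto intro: inj_on_subset)
  moreover have "{1..Suc (card C)} - {Suc (card C)} = {1..card C}" by auto
  ultimately have "bij_betw ?T C {1..card C}" using assms(2) by (subst bij_betw_cong[of _ _ T]) auto
  moreover have "?T d = 0" if "d \<notin> C" for d using SYT_zero[OF assms(3), of d] that by auto
  moreover have "?T (i, j) < ?T (i', j')"
    if "(i, j) \<in> C" "(i', j') \<in> C" "i = i' \<and> j < j' \<or> j = j' \<and> i < i'" for i j i' j'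
  proof -
    have "T (i, j) < T (i', j')" using assms(3) that unfolding SYT_def by blast
    then show ?thesis using that assms(2) by auto
  qed
  ultimately show ?thesis unfolding SYT_def by auto
qed

lemma rs_SYT: "distinct u \<Longrightarrow> snd (rs u) \<in> SYT (shp (fst (rs u)))"
proof (induction u rule: rev_induct)
  case Nil
  then show ?case by (simp add: rs_Nil shp_def SYT_def bij_betw_def)
next
  case (snoc x u)
  obtain P Q where PQ: "rs u = (P, Q)" by (metis prod.exhaust)
  obtain P' i where I: "ins x P = (P', i)" by (metis prod.exhaust)
  have d: "distinct (x # concat P)" using rs_distinct[of x u] snoc PQ by simp
  have tab: "tab P" using rs_tab[of u] snoc PQ by simp
  let ?c = "(i, length (P' ! i) - 1)"
  have tab': "tab P'" using ins_tab[OF tab d] I by simp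
  have i: "i < length P'" using ins_shape[OF tab d I] by simp
  have Q: "Q \<in> SYT (shp P)" using snoc PQ by simp
  note sh = shp_ins[OF tab d I]
  have "Q(?c := Suc (card (shp P))) \<in> SYT (insert ?c (shp P))"
  proof (rule SYT_extend[OF finite_shp Q sh(2)])
    fix e assume "e \<in> shp P"
    then have e: "e \<in> shp P'" using sh(1) by blast
    then show "\<not> (fst e = fst ?c \<and> snd ?c < snd e)" by (auto simp: shp_def)
    show "\<not> (snd e = snd ?c \<and> fst ?c < fst e)"
    proof
      assume a: "snd e = snd ?c \<and> fst ?c < fst e"
      obtain p q where pq: "e = (p, q)" by (metis prod.exhaust)
      have f: "i < p" "p < length P'" "length (P' ! i) - 1 < length (P' ! p)" using a e pq by (auto simp: shp_def)
      have "length (P' ! p) \<le> length (P' ! i)" using tab_row_le[OF tab', of i p] f by simp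
      then have "length (P' ! p) = length (P' ! i)" using f(3) by simp
      have "(i, length (P' ! i) - 1) \<notin> shp P" by (rule sh(2))
      moreover have "(p, length (P' ! i) - 1) \<in> shp P" using \<open>e \<in> shp P\<close> a pq by simp
      then have "p < length P" "length (P' ! i) - 1 < length (P ! p)" by (auto simp: shp_def)
      then have "(i, length (P' ! i) - 1) \<in> shp P" using tab_row_le[OF tab, of i p] f(1) by (simp add: shp_def)
      ultimately show False by simp
    qed
  qed
  moreover have "rs (u @ [x]) = (P', Q(?c := Suc (card (shp P))))"
    using PQ I by (simp add: rs_snoc rs_step_def card_shp)
  ultimately show ?case by (simp only: fst_conv snd_conv sh(1))
qed

lemma length_rs: "length (concat (fst (rs u))) = length u"
  using rs_mset[of u] by (metis size_mset)

text \<open>The largest label of a standard tableau sits in a corner, which tells where reverse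
  insertion has to start. Removing it reduces both halves to words with one letter less, by
  \<open>ins_inj\<close> for injectivity and \<open>ins_surj\<close> for surjectivity.\<close>

lemma rs_bij:
  assumes "tab P" "distinct (concat P)"
  shows "bij_betw (\<lambda>u. snd (rs u)) {u. distinct u \<and> fst (rs u) = P} (SYT (shp P))"
  using assms
proof (induction "length (concat P)" arbitrary: P)
  case 0
  then have P: "P = []" by (cases P) auto
  have "u = []" if "fst (rs u) = []" for u using length_rs[of u] that by simp
  then have "{u. distinct u \<and> fst (rs u) = P} = {[]}" using P by (auto simp: rs_Nil)
  moreover have "SYT (shp P) = {\<lambda>_. 0}" using P by (auto simp: SYT_def shp_def bij_betw_def)
  ultimately show ?case by (simp add: bij_betw_def rs_Nil)
next
  case (Suc m)
  have split: "\<exists>v x Pv Qv i. u = v @ [x] \<and> distinct v \<and> tab Pv \<and> distinct (x # concat Pv) \<and> rs v = (Pv, Qv) \<and>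
      ins x Pv = (P, i) \<and> snd (rs u) = Qv((i, length (P ! i) - 1) := Suc m) \<and>
      (i, length (P ! i) - 1) \<notin> shp Pv \<and> length (concat Pv) = m \<and> Qv \<in> SYT (shp Pv)"
    if u: "distinct u" "fst (rs u) = P" for u
  proof -
    have "length u = Suc m" using length_rs[of u] u Suc.hyps(2) by simp
    then obtain v x where vx: "u = v @ [x]" by (metis append_butlast_last_id list.size(3) nat.distinct(1))
    obtain Pv Qv where PQ: "rs v = (Pv, Qv)" by (metis prod.exhaust)
    obtain P' i where I: "ins x Pv = (P', i)" by (metis prod.exhaust)
    have dv: "distinct v" "distinct (x # v)" using u vx by auto
    have t: "tab Pv" using rs_tab[OF dv(1)] PQ by simp
    have d: "distinct (x # concat Pv)" using rs_distinct[OF dv(2)] PQ by simp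
    have len: "length (concat Pv) = m" using length_rs[of v] PQ \<open>length u = Suc m\<close> vx by simp
    have r: "rs u = (P', Qv((i, length (P' ! i) - 1) := Suc m))"
      using PQ I len by (simp add: vx rs_snoc rs_step_def)
    then have "P' = P" using u by simp
    then show ?thesis
      using vx dv t d PQ I r len shp_ins(2)[OF t d I] rs_SYT[OF dv(1)]
      by (intro exI[of _ v] exI[of _ x] exI[of _ Pv] exI[of _ Qv] exI[of _ i]) auto
  qed
  show ?case
    unfolding bij_betw_def
  proof
    show "inj_on (\<lambda>u. snd (rs u)) {u. distinct u \<and> fst (rs u) = P}"
    proof (rule inj_onI, clarify)
      fix u u' assume u: "distinct u" "P = fst (rs u)" and u': "distinct u'" "fst (rs u') = fst (rs u)"
        and eq: "snd (rs u) = snd (rs u')"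
      obtain v x Pv Qv i where a: "u = v @ [x]" "distinct v" "tab Pv" "distinct (x # concat Pv)" "rs v = (Pv, Qv)"
        "ins x Pv = (P, i)" "snd (rs u) = Qv((i, length (P ! i) - 1) := Suc m)"
        "(i, length (P ! i) - 1) \<notin> shp Pv" "length (concat Pv) = m" "Qv \<in> SYT (shp Pv)"
        using split[OF u(1)] u(2) by metis
      obtain v' x' Pv' Qv' i' where b: "u' = v' @ [x']" "distinct v'" "tab Pv'" "distinct (x' # concat Pv')" "rs v' = (Pv', Qv')"
        "ins x' Pv' = (P, i')" "snd (rs u') = Qv'((i', length (P ! i') - 1) := Suc m)"
        "(i', length (P ! i') - 1) \<notin> shp Pv'" "length (concat Pv') = m" "Qv' \<in> SYT (shp Pv')"
        using split[OF u'(1)] u' u(2) by metis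
      have le: "Qv c \<le> m" "Qv' c \<le> m" for c
      proof -
        show "Qv c \<le> m" "Qv' c \<le> m"
          using a(9,10) b(9,10) card_shp[of Pv] card_shp[of Pv'] SYT_label_le[OF a(10), of c] SYT_label_le[OF b(10), of c] by simp_all
      qed
      have "snd (rs u) (i, length (P ! i) - 1) = Suc m" using a(7) by simp
      then have "(Qv'((i', length (P ! i') - 1) := Suc m)) (i, length (P ! i) - 1) = Suc m" using eq b(7) by simp
      then have ii: "i = i'" using le(2)[of "(i, length (P ! i) - 1)"] by (auto split: if_splits)
      then have xx: "x = x'" "Pv = Pv'"
        using ins_inj[OF a(3,4) b(3,4)] a(6) b(6) by auto
      have "Qv = Qv'"
      proof
        fix c
        have "Qv (i, length (P ! i) - 1) = 0" "Qv' (i, length (P ! i) - 1) = 0"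
          using a(8,10) b(8,10) ii SYT_zero by auto
        then show "Qv c = Qv' c" using fun_cong[OF eq, of c] a(7) b(7) ii
          by (cases "c = (i, length (P ! i) - 1)") auto
      qed
      moreover have "bij_betw (\<lambda>u. snd (rs u)) {u. distinct u \<and> fst (rs u) = Pv} (SYT (shp Pv))"
        using Suc.hyps(1)[of Pv] a by auto
      ultimately have "v = v'"
        using a(2,5) b(2,5) xx unfolding bij_betw_def inj_on_def by auto
      then show "u = u'" using a(1) b(1) xx by simp
    qed
    show "(\<lambda>u. snd (rs u)) ` {u. distinct u \<and> fst (rs u) = P} = SYT (shp P)"
    proof
      show "(\<lambda>u. snd (rs u)) ` {u. distinct u \<and> fst (rs u) = P} \<subseteq> SYT (shp P)"
        using rs_SYT by auto
      show "SYT (shp P) \<subseteq> (\<lambda>u. snd (rs u)) ` {u. distinct u \<and> fst (rs u) = P}"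
      proof
        fix T assume T: "T \<in> SYT (shp P)"
        have bij: "bij_betw T (shp P) {1..Suc m}" using T card_shp[of P] Suc.hyps(2) by (simp add: SYT_def)
        have "Suc m \<in> T ` shp P" using bij_betw_imp_surj_on[OF bij] by simp
        then obtain c where c: "c \<in> shp P" "T c = Suc m" by (metis imageE)
        obtain i j where ij: "c = (i, j)" by (metis prod.exhaust)
        have le: "T d \<le> Suc m" if "d \<in> shp P" for d using bij_betw_apply[OF bij that] by simp
        have i: "i < length P" "j < length (P ! i)" using c ij by (auto simp: shp_def)
        have j: "j = length (P ! i) - 1"
        proof (rule ccontr)
          assume "j \<noteq> length (P ! i) - 1"
          then have d: "(i, Suc j) \<in> shp P" using i by (auto simp: shp_def)
          then have "T (i, j) < T (i, Suc j)" using T c ij unfolding SYT_def by blast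
          then show False using le[OF d] c ij by simp
        qed
        have corner: "Suc i < length P \<longrightarrow> length (P ! Suc i) < length (P ! i)"
        proof (intro impI, rule ccontr)
          assume s: "Suc i < length P" "\<not> length (P ! Suc i) < length (P ! i)"
          then have d: "(Suc i, j) \<in> shp P" using i by (auto simp: shp_def)
          then have "T (i, j) < T (Suc i, j)" using T c ij unfolding SYT_def by blast
          then show False using le[OF d] c ij by simp
        qed
        obtain P0 x where P0: "tab P0" "distinct (x # concat P0)" "ins x P0 = (P, i)"
          using ins_surj[OF Suc.prems i(1) corner] by blast
        have sh: "shp P = insert c (shp P0)" "c \<notin> shp P0" using shp_ins[OF P0] ij j by auto
        have "mset (concat P) = add_mset x (mset (concat P0))" using ins_mset[of x P0] P0(3) by simp
        then have "length (concat P) = Suc (length (concat P0))" by (metis size_add_mset size_mset)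
        then have len: "length (concat P0) = m" using Suc.hyps(2) by simp
        have "T(c := 0) \<in> SYT (shp P0)"
          using SYT_restrict[OF finite_shp sh(2)] T sh(1) c len card_shp[of P0] by simp
        moreover have "bij_betw (\<lambda>u. snd (rs u)) {u. distinct u \<and> fst (rs u) = P0} (SYT (shp P0))"
          using Suc.hyps(1)[of P0] len P0 by auto
        ultimately have "T(c := 0) \<in> (\<lambda>u. snd (rs u)) ` {u. distinct u \<and> fst (rs u) = P0}"
          by (simp add: bij_betw_def)
        then obtain v where v: "distinct v" "fst (rs v) = P0" "T(c := 0) = snd (rs v)" by blast
        have "set v = set (concat P0)" using rs_mset[of v] v(2) by (metis set_mset_mset)
        then have dv: "distinct (v @ [x])" using v P0(2) by simp
        have rv: "rs v = (P0, T(c := 0))" using v by (simp add: prod_eq_iff)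
        have "rs (v @ [x]) = (P, (T(c := 0))(c := Suc m))"
          using P0(3) len ij j by (simp add: rs_snoc rs_step_def rv)
        moreover have "(T(c := 0))(c := Suc m) = T" using c by auto
        ultimately have "rs (v @ [x]) = (P, T)" by simp
        then show "T \<in> (\<lambda>u. snd (rs u)) ` {u. distinct u \<and> fst (rs u) = P}"
          using dv by (intro image_eqI[of _ _ "v @ [x]"]) auto
      qed
    qed
  qed
qed

definition desl :: "nat list \<Rightarrow> nat set" where
  "desl u = {i \<in> {1..length u - 1}. u ! (i - 1) > u ! i}"

lemma desl_snoc2: "desl (v @ [z, x]) = desl (v @ [z]) \<union> (if z > x then {Suc (length v)} else {})"
proof -
  have "i \<in> desl (v @ [z, x]) \<longleftrightarrow> i \<in> desl (v @ [z]) \<union> (if z > x then {Suc (length v)} else {})" for i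
  proof (cases "i = Suc (length v)")
    case True
    then show ?thesis by (auto simp: desl_def nth_append)
  next
    case False
    then show ?thesis by (auto simp: desl_def nth_append)
  qed
  then show ?thesis by blast
qed

lemma Des_SYT_extend:
  assumes "finite C" "T \<in> SYT C" "c \<notin> C" "e \<in> C" "T e = card C"
  shows "Des_SYT (insert c C) (T(c := Suc (card C))) = Des_SYT C T \<union> (if fst e < fst c then {card C} else {})"
proof -
  let ?T = "T(c := Suc (card C))"
  have bij: "bij_betw T C {1..card C}" using assms(2) by (simp add: SYT_def)
  have le: "T d \<le> card C" if "d \<in> C" for d using bij_betw_apply[OF bij that] by simp
  have inj: "d = d'" if "d \<in> C" "d' \<in> C" "T d = T d'" for d d'
    using bij that unfolding bij_betw_def inj_on_def by blast
  have pos: "card C \<ge> 1" using assms(1,4) by (metis One_nat_def Suc_leI card_gt_0_iff empty_iff)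
  have "k \<in> Des_SYT (insert c C) ?T \<longleftrightarrow> k \<in> Des_SYT C T \<union> (if fst e < fst c then {card C} else {})" for k
  proof (cases "k = card C")
    case True
    have "k \<notin> Des_SYT C T" using True pos by (auto simp: Des_SYT_def)
    moreover have "k \<in> Des_SYT (insert c C) ?T \<longleftrightarrow> fst e < fst c"
    proof
      assume "k \<in> Des_SYT (insert c C) ?T"
      then obtain a b where ab: "a \<in> insert c C" "b \<in> insert c C" "?T a = k" "?T b = k + 1" "fst a < fst b"
        unfolding Des_SYT_def by blast
      have "b = c" using ab(2,4) le[of b] True by (cases "b = c") auto
      moreover have "a = e" using ab(1,3) assms(3,4,5) inj[of a e] True by (cases "a = c") auto
      ultimately show "fst e < fst c" using ab(5) by simp
    next
      assume "fst e < fst c"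
      moreover have "?T e = k" "?T c = k + 1" using assms True by auto
      ultimately show "k \<in> Des_SYT (insert c C) ?T"
        unfolding Des_SYT_def using assms True pos by auto
    qed
    ultimately show ?thesis using True by auto
  next
    case False
    have "k \<in> Des_SYT (insert c C) ?T \<longleftrightarrow> k \<in> Des_SYT C T"
    proof
      assume "k \<in> Des_SYT (insert c C) ?T"
      then obtain a b where ab: "a \<in> insert c C" "b \<in> insert c C" "?T a = k" "?T b = k + 1" "fst a < fst b"
        unfolding Des_SYT_def by blast
      have k: "1 \<le> k" "k \<le> card C"
        using \<open>k \<in> Des_SYT (insert c C) ?T\<close> assms(1,3) unfolding Des_SYT_def by auto
      have "a \<noteq> c" "b \<noteq> c" using ab(3,4) k False by auto
      then show "k \<in> Des_SYT C T" using ab k False unfolding Des_SYT_def by auto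
    next
      assume "k \<in> Des_SYT C T"
      then obtain a b where ab: "a \<in> C" "b \<in> C" "T a = k" "T b = k + 1" "fst a < fst b"
        and k: "1 \<le> k" "k \<le> card C - 1" unfolding Des_SYT_def by auto
      have "a \<noteq> c" "b \<noteq> c" using ab(1,2) assms(3) by auto
      then have "?T a = k" "?T b = k + 1" using ab by auto
      then show "k \<in> Des_SYT (insert c C) ?T" using ab k assms(1,3) unfolding Des_SYT_def by auto
    qed
    then show ?thesis using False by auto
  qed
  then show ?thesis by blast
qed

text \<open>By \<open>ins_row_order\<close> the new cell lies strictly below the previous one
  exactly when the word has just descended, and earlier descents are untouched by adding a larger
  label.\<close>

lemma Des_rs: "distinct u \<Longrightarrow> Des_SYT (shp (fst (rs u))) (snd (rs u)) = desl u"
proof (induction u rule: rev_induct)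
  case Nil
  then show ?case by (auto simp: rs_Nil Des_SYT_def desl_def shp_def)
next
  case (snoc x u)
  obtain P Q where PQ: "rs u = (P, Q)" by (metis prod.exhaust)
  obtain P' i where I: "ins x P = (P', i)" by (metis prod.exhaust)
  have d: "distinct (x # concat P)" using rs_distinct[of x u] snoc PQ by simp
  have t: "tab P" using rs_tab[of u] snoc PQ by simp
  let ?c = "(i, length (P' ! i) - 1)"
  note sh = shp_ins[OF t d I]
  have Q: "Q \<in> SYT (shp P)" using rs_SYT[of u] snoc PQ by simp
  have lenP: "length (concat P) = length u" using length_rs[of u] PQ by simp
  have r: "rs (u @ [x]) = (P', Q(?c := Suc (card (shp P))))"
    using PQ I by (simp add: rs_snoc rs_step_def card_shp)
  show ?case
  proof (cases u rule: rev_cases)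
    case Nil
    then have "card (shp P') = 1" using sh finite_shp[of P] lenP card_shp[of P] by simp
    then show ?thesis using r Nil by (simp add: Des_SYT_def desl_def)
  next
    case (snoc v z)
    obtain Pv Qv where PQv: "rs v = (Pv, Qv)" by (metis prod.exhaust)
    obtain P1 i1 where I1: "ins z Pv = (P1, i1)" by (metis prod.exhaust)
    have dis: "distinct (z # v)" "distinct v" "distinct (z # x # v)" "distinct (x # v)" using snoc.prems snoc by auto
    have dv: "distinct (z # concat Pv)" "distinct (x # concat Pv)" using rs_distinct[OF dis(1)] rs_distinct[OF dis(4)] PQv by auto
    have tv: "tab Pv" using rs_tab[of v] dis PQv by simp
    have r1: "rs u = (P1, Qv((i1, length (P1 ! i1) - 1) := Suc (card (shp Pv))))"
      using PQv I1 snoc by (simp add: rs_snoc rs_step_def card_shp)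
    then have P1: "P1 = P" and Qe: "Q = Qv((i1, length (P ! i1) - 1) := Suc (card (shp Pv)))" using PQ by auto
    let ?e = "(i1, length (P ! i1) - 1)"
    have sh1: "shp P = insert ?e (shp Pv)" "?e \<notin> shp Pv" using shp_ins[OF tv dv(1) I1] P1 by auto
    have "Q ?e = card (shp P)" using Qe sh1 finite_shp[of Pv] by simp
    then have "Des_SYT (insert ?c (shp P)) (Q(?c := Suc (card (shp P)))) =
        Des_SYT (shp P) Q \<union> (if fst ?e < fst ?c then {card (shp P)} else {})"
      using sh1(1) by (intro Des_SYT_extend[OF finite_shp Q sh(2)]) auto
    moreover have "Des_SYT (shp P) Q = desl u" using snoc.IH snoc.prems PQ by simp
    moreover have "i1 < i \<longleftrightarrow> x < z"
    proof (rule ins_row_order[OF tv _ I1])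
      show "distinct (z # x # concat Pv)" using dv dis by simp
      show "ins x P1 = (P', i)" using I P1 by simp
    qed
    moreover have "card (shp P) = Suc (length v)" using card_shp[of P] lenP snoc by simp
    ultimately have "Des_SYT (shp P') (Q(?c := Suc (card (shp P)))) = desl (v @ [z, x])"
      unfolding desl_snoc2 sh(1) using snoc by (simp only: fst_conv)
    moreover have "u @ [x] = v @ [z, x]" using snoc by simp
    ultimately show ?thesis using r by (simp only: fst_conv snd_conv)
  qed
qed

lemma finite_partitions_of: "finite (partitions_of n)"
proof -
  have "partitions_of n \<subseteq> {xs. set xs \<subseteq> {..n} \<and> length xs \<le> n}"
  proof
    fix xs assume "xs \<in> partitions_of n"
    then have xs: "0 \<notin> set xs" "sum_list xs = n" by (auto simp: partitions_of_def is_partition_def)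
    have "length xs \<le> sum_list xs" using xs(1)
      by (induction xs) (auto simp: Suc_le_eq)
    moreover have "set xs \<subseteq> {..n}" using member_le_sum_list[of _ xs] xs(2) by auto
    ultimately show "xs \<in> {xs. set xs \<subseteq> {..n} \<and> length xs \<le> n}" using xs(2) by simp
  qed
  then show ?thesis using finite_lists_length_le[of "{..n}" n] finite_subset by blast
qed

section \<open>Descents of skew tableaux\<close>

context convex_cells
begin

definition bound :: nat where
  "bound = Suc (\<Sum>c\<in>C. fst c + snd c)"

lemma bound: "c \<in> C \<Longrightarrow> fst c < bound" "c \<in> C \<Longrightarrow> snd c < bound"
  using member_le_sum[of c C "\<lambda>c. fst c + snd c"] finite_C by (auto simp: bound_def)

text \<open>
  \<open>place\<close> numbers the cells from the bottom row up, left to right; in \<open>word_of T\<close> an adjacent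
  Knuth move then is a swap of two consecutive labels of \<open>T\<close> that keeps it standard.
\<close>

definition place :: "nat \<times> nat \<Rightarrow> nat" where
  "place c = (bound - fst c) * bound + snd c"

lemma place_less:
  assumes "c \<in> C" "d \<in> C"
  shows "place c < place d \<longleftrightarrow> fst d < fst c \<or> (fst c = fst d \<and> snd c < snd d)"
proof -
  have *: "place c < place d" if cd: "c \<in> C" "d \<in> C" "fst d < fst c" for c d
  proof -
    have "Suc (bound - fst c) \<le> bound - fst d" using that bound(1)[of c] by linarith
    then have "Suc (bound - fst c) * bound \<le> (bound - fst d) * bound" by (rule mult_le_mono1)
    moreover have "place c < Suc (bound - fst c) * bound" using bound(2)[OF cd(1)] by (simp add: place_def)
    ultimately show ?thesis by (simp add: place_def)
  qed
  consider "fst d < fst c" | "fst c < fst d" | "fst c = fst d" by linarith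
  then show ?thesis
  proof cases
    case 1
    then show ?thesis using *[OF assms] by simp
  next
    case 2
    then show ?thesis using *[OF assms(2,1)] by simp
  next
    case 3
    then show ?thesis by (simp add: place_def)
  qed
qed

lemma place_inj: "c \<in> C \<Longrightarrow> d \<in> C \<Longrightarrow> place c = place d \<Longrightarrow> c = d"
  using place_less[of c d] place_less[of d c] by (metis linorder_neqE_nat less_irrefl prod_eqI)

text \<open>The inverse, as a permutation, of the reading word: positions are labels and letters
  stand for cells, so descents of \<open>T\<close> become positional descents.\<close>

definition word_of :: "(nat \<times> nat \<Rightarrow> nat) \<Rightarrow> nat list" where
  "word_of T = map (\<lambda>k. place (cell T (Suc k))) [0..<n]"

lemma length_word_of [simp]: "length (word_of T) = n"
  by (simp add: word_of_def)

lemma nth_word_of: "k < n \<Longrightarrow> word_of T ! k = place (cell T (Suc k))"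
  by (simp add: word_of_def)

lemma word_of_inj:
  assumes T: "T \<in> fillings" and T': "T' \<in> fillings" and eq: "word_of T = word_of T'"
  shows "T = T'"
proof (rule fillings_eqI[OF T T'])
  fix c assume c: "c \<in> C"
  obtain k where k: "T c = Suc k" "k < n" using label_in[OF T c] by (cases "T c") auto
  have "place (cell T (Suc k)) = place (cell T' (Suc k))" using nth_word_of[OF k(2)] eq by metis
  then have "cell T (Suc k) = cell T' (Suc k)"
    using place_inj cell_in[OF T, of "Suc k"] cell_in[OF T', of "Suc k"] k by simp
  then have "cell T' (T c) = c" using cell_label[OF T c] k by simp
  then show "T c = T' c" using label_cell[OF T', of "T c"] label_in[OF T c] by simp
qed

lemma distinct_word_of:
  assumes "T \<in> fillings"
  shows "distinct (word_of T)"
proof -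
  have "Suc k = Suc l" if "k < n" "l < n" "place (cell T (Suc k)) = place (cell T (Suc l))" for k l
  proof -
    have "cell T (Suc k) = cell T (Suc l)"
      using place_inj cell_in[OF assms, of "Suc k"] cell_in[OF assms, of "Suc l"] that by simp
    moreover have "T (cell T (Suc k)) = Suc k" "T (cell T (Suc l)) = Suc l"
      using label_cell[OF assms] that(1,2) by simp_all
    ultimately show ?thesis by metis
  qed
  then show ?thesis by (auto simp: word_of_def distinct_map inj_on_def)
qed

lemma desl_word_of:
  assumes T: "T \<in> SYT C"
  shows "desl (word_of T) = Des_SYT C T"
proof -
  note F = SYT_filling[OF T]
  have "i \<in> desl (word_of T) \<longleftrightarrow> i \<in> Des_SYT C T" if i: "i \<in> {1..n - 1}" for i
  proof -
    have i1: "1 \<le> i" "i < n" using i by auto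
    have c: "cell T i \<in> C" "cell T (Suc i) \<in> C" using cell_in[OF F] i1 by auto
    have "i \<in> desl (word_of T) \<longleftrightarrow> place (cell T (Suc i)) < place (cell T i)"
      using i1 nth_word_of[of "i - 1" T] nth_word_of[of i T] by (auto simp: desl_def)
    also have "\<dots> \<longleftrightarrow> fst (cell T i) < fst (cell T (Suc i))"
      using T i1 by (cases rule: SYT_adjacent_cases) (auto simp: place_less[OF c(2,1)] axial_def content_def)
    finally show ?thesis using Des_iff[OF T i1] by blast
  qed
  moreover have "desl (word_of T) \<subseteq> {1..n - 1}" by (auto simp: desl_def)
  ultimately show ?thesis using Des_subset[of T] by blast
qed

lemma word_of_swap:
  assumes "T \<in> fillings" "1 \<le> i" "i < n"
  shows "word_of (swap_labels i T) = (word_of T)[i - 1 := word_of T ! i, i := word_of T ! (i - 1)]"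
proof (rule nth_equalityI)
  fix k assume "k < length (word_of (swap_labels i T))"
  then have k: "k < n" by simp
  have "cell (swap_labels i T) (Suc k) = cell T (transpose i (Suc i) (Suc k))"
    using cell_swap[OF assms, of "Suc k"] k by simp
  then show "word_of (swap_labels i T) ! k = (word_of T)[i - 1 := word_of T ! i, i := word_of T ! (i - 1)] ! k"
    using k assms by (auto simp: nth_word_of nth_list_update transpose_def)
qed simp

text \<open>Row neighbours are consecutive in the order of \<open>place\<close>, so nothing fits
  between them. If \<open>i\<close> and \<open>i + 1\<close> were column neighbours, the cell of
  \<open>w\<close> would lie to the right of the lower or to the left of the upper one, and the
  fourth corner of the resulting rectangle would need a label that is already taken.\<close>

lemma knuth_swap_SYT:
  assumes T: "T \<in> SYT C" and i: "1 \<le> i" "i < n" and w: "w \<in> {1..n}" "w = i - 1 \<or> w = Suc (Suc i)"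
    and btw: "(place (cell T i) < place (cell T w) \<and> place (cell T w) < place (cell T (Suc i))) \<or>
      (place (cell T (Suc i)) < place (cell T w) \<and> place (cell T w) < place (cell T i))"
  shows "swap_labels i T \<in> SYT C"
proof (rule swap_SYT[OF T i])
  note F = SYT_filling[OF T]
  obtain a b where x: "cell T i = (a, b)" by (metis prod.exhaust)
  obtain a' b' where y: "cell T (Suc i) = (a', b')" by (metis prod.exhaust)
  obtain p q where z: "cell T w = (p, q)" by (metis prod.exhaust)
  have xC: "(a, b) \<in> C" "T (a, b) = i" using cell_in[OF F, of i] label_cell[OF F, of i] i x by auto
  have yC: "(a', b') \<in> C" "T (a', b') = Suc i" using cell_in[OF F, of "Suc i"] label_cell[OF F, of "Suc i"] i y by auto
  have zC: "(p, q) \<in> C" "T (p, q) = w" using cell_in[OF F, of w] label_cell[OF F, of w] w z by auto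
  note pl = place_less[OF xC(1) zC(1)] place_less[OF zC(1) xC(1)] place_less[OF yC(1) zC(1)] place_less[OF zC(1) yC(1)]
  show "fst (cell T i) \<noteq> fst (cell T (Suc i))"
  proof
    assume e: "fst (cell T i) = fst (cell T (Suc i))"
    then have "axial T i = 1" using axial_eq_1[OF T i] by simp
    then have "b' = Suc b" "a = a'" using e x y by (auto simp: axial_def content_def)
    then show False using btw pl x y z by auto
  qed
  show "snd (cell T i) \<noteq> snd (cell T (Suc i))"
  proof
    assume e: "snd (cell T i) = snd (cell T (Suc i))"
    have "a' = Suc a \<and> b' = b"
      using T i by (cases rule: SYT_adjacent_cases) (use e x y in \<open>auto simp: axial_def content_def\<close>)
    then have ab: "a' = Suc a" "b' = b" by auto
    then have "(p = Suc a \<and> b < q) \<or> (p = a \<and> q < b)" using btw pl x y z by auto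
    then show False
    proof
      assume pq: "p = Suc a \<and> b < q"
      then have m: "(a, q) \<in> C" using convex[OF xC(1) zC(1), of a q] by auto
      have "T (a', b') < T (p, q)" using SYT_row[OF T, of "Suc a" b q] pq ab yC zC by simp
      then have "w = Suc (Suc i)" using w yC zC by auto
      moreover have "T (a, b) < T (a, q)" "T (a, q) < T (p, q)"
        using SYT_row[OF T xC(1) m] SYT_col[OF T m, of p] pq zC by auto
      ultimately have "T (a, q) = T (a', b')" using xC yC zC by simp
      then show False using label_inj[OF F m yC(1)] ab by simp
    next
      assume pq: "p = a \<and> q < b"
      then have m: "(Suc a, q) \<in> C" using convex[OF zC(1) yC(1), of "Suc a" q] ab by auto
      have "T (p, q) < T (a, b)" using SYT_row[OF T, of a q b] pq xC zC by simp
      then have "w = i - 1" using w xC zC by auto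
      moreover have "T (p, q) < T (Suc a, q)" "T (Suc a, q) < T (a', b')"
        using SYT_col[OF T zC(1), of "Suc a"] SYT_row[OF T m, of b] pq m ab yC by auto
      ultimately have "T (Suc a, q) = T (a, b)" using xC yC zC i by simp
      then show False using label_inj[OF F m xC(1)] by simp
    qed
  qed
qed

lemma knuth_step_word_of:
  assumes T: "T \<in> SYT C" and k: "knuth_step (word_of T) v"
  shows "v \<in> word_of ` SYT C"
proof -
  note F = SYT_filling[OF T]
  have swap: "v \<in> word_of ` SYT C"
    if u: "word_of T = p @ [l1, l2] @ q" and v: "v = p @ [l2, l1] @ q"
      and w: "(p \<noteq> [] \<and> (l1 < last p \<and> last p < l2 \<or> l2 < last p \<and> last p < l1)) \<or>
              (q \<noteq> [] \<and> (l1 < hd q \<and> hd q < l2 \<or> l2 < hd q \<and> hd q < l1))" for p q l1 l2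
  proof -
    let ?i = "Suc (length p)"
    have len: "n = length p + 2 + length q" using arg_cong[OF u, of length] by simp
    have i: "1 \<le> ?i" "?i < n" using len by auto
    have l1: "l1 = place (cell T ?i)" using nth_word_of[of "length p" T] len u by (simp add: nth_append)
    have l2: "l2 = place (cell T (Suc ?i))" using nth_word_of[of "Suc (length p)" T] len u by (simp add: nth_append)
    have "swap_labels ?i T \<in> SYT C"
      using w
    proof
      assume h: "p \<noteq> [] \<and> (l1 < last p \<and> last p < l2 \<or> l2 < last p \<and> last p < l1)"
      then have "last p = word_of T ! (length p - 1)" using u by (simp add: nth_append last_conv_nth)
      also have "\<dots> = place (cell T (length p))" using nth_word_of[of "length p - 1" T] len h by simp
      finally show ?thesis using h l1 l2 len by (intro knuth_swap_SYT[OF T i, of "length p"]) (auto simp: Suc_le_eq)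
    next
      assume h: "q \<noteq> [] \<and> (l1 < hd q \<and> hd q < l2 \<or> l2 < hd q \<and> hd q < l1)"
      then have "hd q = word_of T ! (length p + 2)" using u by (simp add: nth_append hd_conv_nth)
      also have "\<dots> = place (cell T (Suc (Suc ?i)))" using nth_word_of[of "length p + 2" T] len h by simp
      finally show ?thesis using h l1 l2 len
        by (intro knuth_swap_SYT[OF T i, of "Suc (Suc ?i)"]) (auto simp: Suc_le_eq)
    qed
    moreover have "word_of (swap_labels ?i T) = v"
      using word_of_swap[OF F i] u v by (simp add: list_update_append nth_append)
    ultimately show ?thesis by blast
  qed
  have "knuth (word_of T) v \<or> knuth v (word_of T)" using k by (simp add: knuth_step_def)
  then show ?thesis
  proof
    assume "knuth (word_of T) v"
    then show ?thesis
    proof cases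
      case (acb a b c p q)
      then show ?thesis using swap[of p a c "b # q"] by simp
    next
      case (bac a b c p q)
      then show ?thesis using swap[of "p @ [b]" a c q] by simp
    qed
  next
    assume "knuth v (word_of T)"
    then show ?thesis
    proof cases
      case (acb a b c p q)
      then show ?thesis using swap[of p c a "b # q"] by simp
    next
      case (bac a b c p q)
      then show ?thesis using swap[of "p @ [b]" c a q] by simp
    qed
  qed
qed

lemma knuth_equiv_word_of:
  assumes "u \<approx>k v" "u \<in> word_of ` SYT C"
  shows "v \<in> word_of ` SYT C"
  using assms by (induction rule: rtranclp_induct) (use knuth_step_word_of in auto)

text \<open>The words of standard tableaux of \<open>C\<close> are closed under Knuth moves, so they
  form a union of full fibres of the insertion tableau, and \<open>rs_bij\<close> with
  \<open>Des_rs\<close> gives each fibre the descent distribution of a straight shape. The witness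
  counts insertion tableaux by shape; for skew diagrams these are the Littlewood-Richardson
  coefficients.\<close>

theorem skew_des_decomposition:
  obtains c :: "nat list \<Rightarrow> nat" where
    "\<And>D. card {T \<in> SYT C. Des_SYT C T = D} =
       (\<Sum>\<nu>\<in>partitions_of n. c \<nu> * card {T \<in> SYT (cells (\<nu>, [])). Des_SYT (cells (\<nu>, [])) T = D})"
proof -
  define W where "W = word_of ` SYT C"
  define PP where "PP = (\<lambda>u. fst (rs u)) ` W"
  define c where "c \<nu> = card {P \<in> PP. map length P = \<nu>}" for \<nu> :: "nat list"
  have finW: "finite W" using finite_SYT by (simp add: W_def)
  have finPP: "finite PP" using finW by (simp add: PP_def)
  have Wd: "distinct u \<and> length u = n" if "u \<in> W" for u
    using that distinct_word_of SYT_filling by (auto simp: W_def)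
  have cls: "{u \<in> W. fst (rs u) = P} = {u. distinct u \<and> fst (rs u) = P}" if P: "P \<in> PP" for P
  proof -
    obtain u0 where u0: "u0 \<in> W" "fst (rs u0) = P" using P by (auto simp: PP_def)
    have "u \<in> W" if "distinct u" "fst (rs u) = P" for u
      using knuth_equiv_word_of[OF rs_eq_knuth_equiv[of u0 u]] u0 that Wd by (auto simp: W_def)
    then show ?thesis using Wd by blast
  qed
  have PPt: "tab P \<and> distinct (concat P) \<and> length (concat P) = n" if "P \<in> PP" for P
    using that rs_tab length_rs Wd by (auto simp: PP_def)
  have part: "map length P \<in> partitions_of n" if "P \<in> PP" for P
    using PPt[OF that] tab_partition[of P] by (simp add: partitions_of_def length_concat)
  have finpart: "finite (map length ` PP)" using finPP by simp
  have main: "card {T \<in> SYT C. Des_SYT C T = D} =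
       (\<Sum>\<nu>\<in>partitions_of n. c \<nu> * card {T \<in> SYT (cells (\<nu>, [])). Des_SYT (cells (\<nu>, [])) T = D})"
    if finp: "finite (partitions_of n)" for D
  proof -
    define g where "g \<nu> = card {T \<in> SYT (cells (\<nu>, [])). Des_SYT (cells (\<nu>, [])) T = D}" for \<nu> :: "nat list"
    have "bij_betw word_of {T \<in> SYT C. Des_SYT C T = D} {u \<in> W. desl u = D}"
      unfolding bij_betw_def W_def using word_of_inj SYT_filling desl_word_of
      by (auto simp: inj_on_def)
    then have "card {T \<in> SYT C. Des_SYT C T = D} = card {u \<in> W. desl u = D}" by (rule bij_betw_same_card)
    also have "{u \<in> W. desl u = D} = (\<Union>P\<in>PP. {u \<in> W. fst (rs u) = P \<and> desl u = D})" by (auto simp: PP_def)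
    also have "card \<dots> = (\<Sum>P\<in>PP. card {u \<in> W. fst (rs u) = P \<and> desl u = D})"
      using finPP finW by (intro card_UN_disjoint) auto
    also have "\<dots> = (\<Sum>P\<in>PP. g (map length P))"
    proof (rule sum.cong[OF refl])
      fix P assume P: "P \<in> PP"
      have bij: "bij_betw (\<lambda>u. snd (rs u)) {u. distinct u \<and> fst (rs u) = P} (SYT (shp P))"
        using rs_bij PPt[OF P] by blast
      have eq: "{u \<in> W. fst (rs u) = P \<and> desl u = D} = {u \<in> {u. distinct u \<and> fst (rs u) = P}. desl u = D}"
        using cls[OF P] by blast
      have "bij_betw (\<lambda>u. snd (rs u)) {u \<in> {u. distinct u \<and> fst (rs u) = P}. desl u = D} {T \<in> SYT (shp P). Des_SYT (shp P) T = D}"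
        unfolding bij_betw_def
      proof
        show "inj_on (\<lambda>u. snd (rs u)) {u \<in> {u. distinct u \<and> fst (rs u) = P}. desl u = D}"
          using bij_betw_imp_inj_on[OF bij] by (rule inj_on_subset) blast
        have im: "(\<lambda>u. snd (rs u)) ` {u. distinct u \<and> fst (rs u) = P} = SYT (shp P)"
          using bij by (simp add: bij_betw_def)
        have ds: "Des_SYT (shp P) (snd (rs u)) = desl u" if "distinct u" "fst (rs u) = P" for u
          using Des_rs[of u] that by simp
        show "(\<lambda>u. snd (rs u)) ` {u \<in> {u. distinct u \<and> fst (rs u) = P}. desl u = D} = {T \<in> SYT (shp P). Des_SYT (shp P) T = D}"
          unfolding im[symmetric] using ds by auto
      qed
      then show "card {u \<in> W. fst (rs u) = P \<and> desl u = D} = g (map length P)"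
        unfolding eq g_def cells_shape by (rule bij_betw_same_card)
    qed
    also have "\<dots> = (\<Sum>\<nu>\<in>partitions_of n. \<Sum>P\<in>{P \<in> PP. map length P = \<nu>}. g (map length P))"
      using sum.group[OF finPP finp, of "map length" "\<lambda>P. g (map length P)"] part by (auto simp: image_subset_iff)
    also have "\<dots> = (\<Sum>\<nu>\<in>partitions_of n. c \<nu> * g \<nu>)"
      unfolding c_def by (intro sum.cong refl) simp
    finally show ?thesis unfolding g_def .
  qed
  show thesis using that[of c] main[OF finite_partitions_of] by blast
qed

end

section \<open>Standardization and Schur coefficients\<close>

lemma part_row_mono: "is_partition \<mu> \<Longrightarrow> i \<le> j \<Longrightarrow> part_row \<mu> j \<le> part_row \<mu> i"
  unfolding is_partition_def part_row_def sorted_wrt_iff_nth_less by (cases "i = j") auto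

lemma convex_cells_skew:
  assumes "valid_skew s"
  shows "convex_cells (cells s)"
proof -
  obtain la \<mu> where s: "s = (la, \<mu>)" by (metis prod.exhaust)
  have p: "is_partition la" "is_partition \<mu>" using assms by (auto simp: s valid_skew_def)
  have nth: "la ! j \<le> la ! i" if "i \<le> j" "j < length la" for i j
    using p(1) that unfolding is_partition_def sorted_wrt_iff_nth_less by (cases "i = j") auto
  show ?thesis
  proof
    have "cells s \<subseteq> {..<length la} \<times> {..<la ! 0}"
      using nth[of 0] by (auto simp: s cells_def) (metis less_le_trans le0)
    then show "finite (cells s)" using finite_subset by blast
    fix a b a' b' x y
    assume h: "(a, b) \<in> cells s" "(a', b') \<in> cells s" "a \<le> x" "x \<le> a'" "b \<le> y" "y \<le> b'"
    have "part_row \<mu> x \<le> part_row \<mu> a" "la ! a' \<le> la ! x"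
      using part_row_mono[OF p(2)] nth h by (auto simp: s cells_def)
    then show "(x, y) \<in> cells s" using h by (auto simp: s cells_def)
  qed
qed

lemma valid_skew_straight: "is_partition la \<Longrightarrow> valid_skew (la, [])"
  by (simp add: valid_skew_def is_partition_def)

lemma cells_straight: "cells (la, []) = {(i, j). i < length la \<and> j < la ! i}"
  by (auto simp: cells_def part_row_def)

lemma card_cells_straight: "card (cells (la, [])) = sum_list la"
proof -
  have "cells (la, []) = (\<Union>i<length la. {i} \<times> {..<la ! i})" by (auto simp: cells_straight)
  then have "card (cells (la, [])) = (\<Sum>i<length la. la ! i)"
    by (simp, subst card_UN_disjoint) (auto simp: card_cartesian_product)
  then show ?thesis by (simp add: sum_list_sum_nth atLeast0LessThan)
qed

definition asc :: "nat \<Rightarrow> nat list \<Rightarrow> nat set" where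
  "asc n w = {j \<in> {1..n - 1}. w ! (j - 1) < w ! j}"

context convex_cells
begin

lemma rows_no_descent:
  assumes T: "T \<in> SYT C" and "1 \<le> u" "u \<le> v" "v \<le> n"
    and nd: "\<And>d. d \<in> Des_SYT C T \<Longrightarrow> u \<le> d \<Longrightarrow> d < v \<Longrightarrow> False"
  shows "fst (cell T v) \<le> fst (cell T u)"
  using assms(3,4,5)
proof (induction v rule: dec_induct)
  case (step v)
  have "v \<notin> Des_SYT C T" using step.prems(2)[of v] step.hyps by auto
  then have "fst (cell T (Suc v)) \<le> fst (cell T v)" using Des_iff[OF T, of v] step assms(2) by auto
  moreover have "fst (cell T v) \<le> fst (cell T u)" using step.IH step.prems by (meson Suc_leD less_SucI)
  ultimately show ?case by simp
qed simp

text \<open>With descent set \<open>{r..n - 1}\<close> the labels up to \<open>r\<close> stay in the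
  first row, where 1 is, and from \<open>r\<close> on the rows strictly increase. But
  \<open>(1, 0)\<close> and \<open>(1, 1)\<close> would carry two labels above \<open>r\<close> in
  one row.\<close>

lemma no_hook_word:
  assumes C: "(0, 0) \<in> C" "(1, 1) \<in> C" and T: "T \<in> SYT C" and r: "1 \<le> r" "r \<le> n"
  shows "Des_SYT C T \<noteq> {r..n - 1}"
proof
  assume D: "Des_SYT C T = {r..n - 1}"
  note F = SYT_filling[OF T]
  have C10: "(1, 0) \<in> C" using convex[OF C] by simp
  have "T (0, 0) \<le> T c" if "c \<in> C" for c using SYT_le[OF T C(1), of "fst c" "snd c"] that by simp
  moreover have "1 \<in> {1..n}" using r by simp
  ultimately have "T (0, 0) \<le> 1" using cell_in[OF F] label_cell[OF F] by metis
  then have "T (0, 0) = 1" using label_in[OF F C(1)] by simp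
  then have c1: "cell T 1 = (0, 0)" using cell_eqI[OF F C(1)] by simp
  have small: "fst (cell T k) = 0" if "1 \<le> k" "k \<le> r" for k
    using rows_no_descent[OF T, of 1 k] that r D c1 by auto
  have strict: "fst (cell T k) < fst (cell T l)" if "r \<le> k" "k < l" "l \<le> n" for k l
  proof -
    have "Suc k \<le> l" using that by simp
    then show ?thesis using that(3)
    proof (induction l rule: dec_induct)
      case base
      then show ?case using Des_iff[OF T, of k] D that(1) r by auto
    next
      case (step l)
      then have "fst (cell T l) < fst (cell T (Suc l))" using Des_iff[OF T, of l] D that(1) r by auto
      then show ?case using step by simp
    qed
  qed
  let ?v = "T (1, 1)" and ?w = "T (1, 0)"
  have vw: "?w < ?v" using SYT_row[OF T C10 C(2)] by simp
  have vn: "?v \<in> {1..n}" "?w \<in> {1..n}" using label_in[OF F] C C10 by auto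
  have cv: "cell T ?v = (1, 1)" "cell T ?w = (1, 0)" using cell_label[OF F] C C10 by auto
  have "r < ?w" using small[of ?w] vn cv by (metis atLeastAtMost_iff fst_conv leI one_neq_zero)
  then show False using strict[of ?w ?v] vw vn cv by simp
qed

lemma descent_between:
  assumes T: "T \<in> SYT C" and cd: "c \<in> C" "d \<in> C" "T c < T d" "fst c < fst d"
  obtains e where "e \<in> Des_SYT C T" "T c \<le> e" "e < T d"
proof -
  note F = SYT_filling[OF T]
  have "\<exists>e. e \<in> Des_SYT C T \<and> T c \<le> e \<and> e < T d"
  proof (rule ccontr)
    assume "\<not> ?thesis"
    then have "fst (cell T (T d)) \<le> fst (cell T (T c))"
      using label_in[OF F] cd by (intro rows_no_descent[OF T]) auto
    then show False using cell_label[OF F] cd by simp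
  qed
  then show thesis using that by blast
qed

definition labels_by :: "nat list \<Rightarrow> (nat \<times> nat \<Rightarrow> nat) \<Rightarrow> nat \<times> nat \<Rightarrow> nat" where
  "labels_by w T = (\<lambda>c. if c \<in> C then w ! (T c - 1) else 0)"

text \<open>Lexicographic by value and then by column, as \<open>bound\<close> exceeds every column
  index: standardization numbers equal values from left to right.\<close>

definition key :: "(nat \<times> nat \<Rightarrow> nat) \<Rightarrow> nat \<times> nat \<Rightarrow> nat" where
  "key S c = S c * bound + snd c"

lemma key_less: "c \<in> C \<Longrightarrow> S c < S d \<Longrightarrow> key S c < key S d"
proof -
  assume c: "c \<in> C" "S c < S d"
  have "Suc (S c) * bound \<le> S d * bound" using c(2) by (intro mult_le_mono1) simp
  then show ?thesis using bound(2)[OF c(1)] by (simp add: key_def)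
qed

definition rank_filling :: "(nat \<times> nat \<Rightarrow> nat) \<Rightarrow> nat \<times> nat \<Rightarrow> nat" where
  "rank_filling k c = (if c \<in> C then card {d \<in> C. k d \<le> k c} else 0)"

lemma rank_filling_less:
  assumes "c \<in> C" "d \<in> C" "k c < k d"
  shows "rank_filling k c < rank_filling k d"
proof -
  have "{e \<in> C. k e \<le> k c} \<subset> {e \<in> C. k e \<le> k d}" using assms by force
  then have "card {e \<in> C. k e \<le> k c} < card {e \<in> C. k e \<le> k d}"
    using finite_C by (intro psubset_card_mono) auto
  then show ?thesis using assms by (simp add: rank_filling_def)
qed

lemma rank_filling_bij:
  assumes "inj_on k C"
  shows "rank_filling k \<in> fillings"
proof -
  have "inj_on (rank_filling k) C"
  proof (rule inj_onI)
    fix c d assume cd: "c \<in> C" "d \<in> C" "rank_filling k c = rank_filling k d"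
    then have "k c = k d" using rank_filling_less[of c d k] rank_filling_less[of d c k] by (metis linorder_neqE_nat nat_less_le)
    then show "c = d" using assms cd by (auto simp: inj_on_def)
  qed
  moreover have "rank_filling k ` C \<subseteq> {1..n}"
  proof
    fix v assume "v \<in> rank_filling k ` C"
    then obtain c where c: "c \<in> C" "v = card {d \<in> C. k d \<le> k c}" by (auto simp: rank_filling_def)
    have "v \<le> n" unfolding c(2) using finite_C by (intro card_mono) auto
    have "c \<in> {d \<in> C. k d \<le> k c}" using c(1) by simp
    then have "{d \<in> C. k d \<le> k c} \<noteq> {}" by (metis empty_iff)
    moreover have "finite {d \<in> C. k d \<le> k c}" using finite_C by simp
    ultimately have "0 < v" unfolding c(2) by (intro card_gt_0_iff[THEN iffD2] conjI)
    then show "v \<in> {1..n}" using \<open>v \<le> n\<close> by simp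
  qed
  ultimately have "rank_filling k ` C = {1..n}"
    by (intro card_subset_eq) (auto simp: card_image)
  then show ?thesis using \<open>inj_on (rank_filling k) C\<close> by (auto simp: fillings_def bij_betw_def rank_filling_def)
qed

lemma image_mset_cells:
  assumes T: "T \<in> fillings"
  shows "image_mset f (mset_set C) = mset (map (\<lambda>k. f (cell T (Suc k))) [0..<n])"
proof -
  have "bij_betw (\<lambda>k. cell T (Suc k)) {..<n} C"
  proof (rule bij_betw_byWitness[of _ "\<lambda>c. T c - 1"])
    show "(\<lambda>c. T c - 1) ` C \<subseteq> {..<n}" using label_in[OF T] by fastforce
  qed (use label_cell[OF T] cell_label[OF T] cell_in[OF T] label_in[OF T] in \<open>auto simp: Suc_le_eq\<close>)
  then have "mset_set C = image_mset (\<lambda>k. cell T (Suc k)) (mset_set {..<n})"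
    by (simp add: bij_betw_def image_mset_mset_set)
  also have "mset_set {..<n} = mset [0..<n]" by (simp add: lessThan_atLeast0)
  finally have "image_mset f (mset_set C) = image_mset f (image_mset (\<lambda>k. cell T (Suc k)) (mset [0..<n]))"
    by (rule arg_cong)
  then show ?thesis by (simp only: image_mset.compositionality comp_def mset_map)
qed

text \<open>The inverse ranks the cells by \<open>key\<close>. Having \<open>Des_SYT C T\<close>
  inside \<open>asc n w\<close> means that the sorted word jumps at every descent, which makes
  columns strict; conversely, equal values form a horizontal strip and numbering it from left to
  right creates no descent.\<close>

lemma standardization:
  assumes w: "sorted w" "length w = n" "0 \<notin> set w"
  shows "bij_betw (labels_by w) {T \<in> SYT C. Des_SYT C T \<subseteq> asc n w}
    {S \<in> SSYT C. image_mset S (mset_set C) = mset w}"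
proof -
  have mono: "w ! (a - 1) \<le> w ! (b - 1)" if "a \<le> b" "b \<in> {1..n}" for a b
    using that w by (intro sorted_nth_mono) auto
  have strict: "w ! (a - 1) < w ! (b - 1)" if "e \<in> asc n w" "a \<le> e" "e < b" "b \<in> {1..n}" for a b e
  proof -
    have "e \<in> {1..n}" using that(1) by (auto simp: asc_def)
    then have "w ! (a - 1) \<le> w ! (e - 1)" using mono[of a e] that(2) by blast
    also have "\<dots> < w ! (Suc e - 1)" using that by (simp add: asc_def)
    also have "\<dots> \<le> w ! (b - 1)" using mono[of "Suc e" b] that by auto
    finally show ?thesis .
  qed
  show ?thesis
    unfolding bij_betw_def
  proof
    show "inj_on (labels_by w) {T \<in> SYT C. Des_SYT C T \<subseteq> asc n w}"
    proof (rule inj_onI)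
      fix T T' assume T: "T \<in> {T \<in> SYT C. Des_SYT C T \<subseteq> asc n w}" and T': "T' \<in> {T \<in> SYT C. Des_SYT C T \<subseteq> asc n w}"
        and eq: "labels_by w T = labels_by w T'"
      have S: "T \<in> SYT C" "T' \<in> SYT C" and D: "Des_SYT C T \<subseteq> asc n w" "Des_SYT C T' \<subseteq> asc n w" using T T' by auto
      note F = SYT_filling[OF S(1)] SYT_filling[OF S(2)]
      have e: "w ! (T c - 1) = w ! (T' c - 1)" if "c \<in> C" for c
        using fun_cong[OF eq, of c] that by (simp add: labels_by_def)
      have rows: "fst d \<le> fst c" if "U \<in> SYT C" "Des_SYT C U \<subseteq> asc n w" "c \<in> C" "d \<in> C" "U c < U d" "w ! (U c - 1) = w ! (U d - 1)" for U c d
      proof (rule ccontr)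
        assume "\<not> fst d \<le> fst c"
        then have "fst c < fst d" by simp
        from descent_between[OF that(1,3,4,5) this]
        obtain e where "e \<in> Des_SYT C U" "U c \<le> e" "e < U d" .
        then have "w ! (U c - 1) < w ! (U d - 1)"
          using strict[of e "U c" "U d"] that(2,4) label_in[OF SYT_filling[OF that(1)]] by blast
        then show False using that(6) by simp
      qed
      show "T = T'"
      proof (rule fillings_eq_of_order[OF F])
        fix c d assume cd: "c \<in> C" "d \<in> C" "T c < T d"
        show "T' c < T' d"
        proof (rule ccontr)
          assume "\<not> T' c < T' d"
          moreover have "T' c \<noteq> T' d" using label_inj[OF F(2) cd(1,2)] cd(3) by auto
          ultimately have lt: "T' d < T' c" by linarith
          have "w ! (T c - 1) \<le> w ! (T d - 1)" using mono[of "T c" "T d"] cd label_in[OF F(1)] by simp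
          moreover have "w ! (T' d - 1) \<le> w ! (T' c - 1)" using mono[of "T' d" "T' c"] lt cd label_in[OF F(2)] by simp
          \<comment> \<open>Opposite orders in \<open>T\<close> and \<open>T'\<close> are possible
            only for equal values. The absence of descents among these then confines the two cells
            to one row, where both tableaux increase.\<close>
          ultimately have eqv: "w ! (T c - 1) = w ! (T d - 1)" "w ! (T' d - 1) = w ! (T' c - 1)" using e cd by auto
          have "fst d \<le> fst c" using rows[OF S(1) D(1) cd eqv(1)] .
          moreover have "fst c \<le> fst d" using rows[OF S(2) D(2) cd(2,1) lt eqv(2)] .
          ultimately have f: "fst c = fst d" by simp
          then have "snd c \<noteq> snd d" using cd by (metis less_irrefl prod_eqI)
          then show False
            using cd lt f SYT_row[OF S(1), of "fst c" "snd d" "snd c"] SYT_row[OF S(2), of "fst c" "snd c" "snd d"]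
            by (metis linorder_neqE_nat not_less_iff_gr_or_eq prod.collapse)
        qed
      qed
    qed
    show "labels_by w ` {T \<in> SYT C. Des_SYT C T \<subseteq> asc n w} = {S \<in> SSYT C. image_mset S (mset_set C) = mset w}"
    proof (intro equalityI subsetI)
      fix S assume "S \<in> labels_by w ` {T \<in> SYT C. Des_SYT C T \<subseteq> asc n w}"
      then obtain T where T: "T \<in> SYT C" "Des_SYT C T \<subseteq> asc n w" "S = labels_by w T" by blast
      note F = SYT_filling[OF T(1)]
      have S: "S c = w ! (T c - 1)" if "c \<in> C" for c using T(3) that by (simp add: labels_by_def)
      have pos: "S c \<ge> 1" if "c \<in> C" for c
      proof -
        have "T c - 1 < length w" using label_in[OF F that] w(2) by auto
        then have "S c \<in> set w" using S[OF that] by simp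
        then show ?thesis using w(3) by (metis One_nat_def Suc_leI neq0_conv)
      qed
      have row: "S (i, j) \<le> S (i, j')" if "(i, j) \<in> C" "(i, j') \<in> C" "j < j'" for i j j'
        using SYT_row[OF T(1) that] mono[of "T (i, j)" "T (i, j')"] label_in[OF F] that S by simp
      have col: "S (i, j) < S (i', j)" if "(i, j) \<in> C" "(i', j) \<in> C" "i < i'" for i i' j
      proof -
        have lt: "T (i, j) < T (i', j)" using SYT_col[OF T(1) that] .
        have "fst (i, j) < fst (i', j)" using that(3) by simp
        from descent_between[OF T(1) that(1,2) lt this]
        obtain e where "e \<in> Des_SYT C T" "T (i, j) \<le> e" "e < T (i', j)" .
        then show ?thesis using strict[of e "T (i, j)" "T (i', j)"] T(2) label_in[OF F that(2)] S that by auto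
      qed
      have "S \<in> SSYT C" unfolding SSYT_def using pos row col T(3) by (auto simp: labels_by_def)
      moreover have "image_mset S (mset_set C) = mset w"
      proof -
        have "map (\<lambda>k. S (cell T (Suc k))) [0..<n] = w"
        proof (rule nth_equalityI)
          fix k assume "k < length (map (\<lambda>k. S (cell T (Suc k))) [0..<n])"
          then have k: "k < n" by simp
          then have "S (cell T (Suc k)) = w ! k"
            using S[of "cell T (Suc k)"] cell_in[OF F, of "Suc k"] label_cell[OF F, of "Suc k"] by simp
          then show "map (\<lambda>k. S (cell T (Suc k))) [0..<n] ! k = w ! k" using k by simp
        qed (use w in simp)
        then show ?thesis using image_mset_cells[OF F, of S] by simp
      qed
      ultimately show "S \<in> {S \<in> SSYT C. image_mset S (mset_set C) = mset w}" by simp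
    next
      fix S assume "S \<in> {S \<in> SSYT C. image_mset S (mset_set C) = mset w}"
      then have S: "S \<in> SSYT C" and M: "image_mset S (mset_set C) = mset w" by auto
      have row: "S (i, j) \<le> S (i, j')" if "(i, j) \<in> C" "(i, j') \<in> C" "j < j'" for i j j'
        using S that unfolding SSYT_def by blast
      have col: "S (i, j) < S (i', j)" if "(i, j) \<in> C" "(i', j) \<in> C" "i < i'" for i i' j
        using S that unfolding SSYT_def by blast
      have keq: "S c = S d \<and> snd c = snd d" if "c \<in> C" "d \<in> C" "key S c = key S d" for c d
      proof -
        have "S c = S d" using key_less[OF that(1), of S d] key_less[OF that(2), of S c] that(3)
          by (metis less_irrefl linorder_neqE_nat)
        then show ?thesis using that(3) by (simp add: key_def)
      qed
      have inj: "inj_on (key S) C"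
      proof (rule inj_onI)
        fix c d assume cd: "c \<in> C" "d \<in> C" "key S c = key S d"
        then have e: "S c = S d" "snd c = snd d" using keq by blast+
        have "fst c = fst d"
          using col[of "fst c" "snd c" "fst d"] col[of "fst d" "snd c" "fst c"] cd e
          by (metis less_irrefl linorder_neqE_nat prod.collapse)
        then show "c = d" using e by (simp add: prod_eq_iff)
      qed
      define T where "T = rank_filling (key S)"
      have F: "T \<in> fillings" unfolding T_def using rank_filling_bij[OF inj] .
      have ord: "T c < T d" if "c \<in> C" "d \<in> C" "key S c < key S d" for c d
        unfolding T_def using rank_filling_less that by blast
      have ord': "key S c \<le> key S d" if "c \<in> C" "d \<in> C" "T c \<le> T d" for c d
        using ord[of d c] that by (meson leD leI)
      have Sle: "S c \<le> S d" if "c \<in> C" "d \<in> C" "T c \<le> T d" for c d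
        using ord'[OF that] key_less[OF that(2), of S c] by (meson leD leI)
      have "T (i, j) < T (i', j')" if "(i, j) \<in> C" "(i', j') \<in> C" "i = i' \<and> j < j' \<or> j = j' \<and> i < i'" for i j i' j'
      proof (rule ord[OF that(1,2)])
        show "key S (i, j) < key S (i', j')"
          using that(3)
        proof
          assume h: "i = i' \<and> j < j'"
          then have "S (i, j) \<le> S (i', j')" using row that by blast
          then have "S (i, j) * bound + j < S (i', j') * bound + j'"
            using h by (intro add_le_less_mono mult_le_mono1) auto
          then show ?thesis by (simp only: key_def snd_conv)
        next
          assume h: "j = j' \<and> i < i'"
          then have "S (i, j) < S (i', j')" using col that by blast
          then show ?thesis using key_less[OF that(1)] by blast
        qed
      qed
      then have T: "T \<in> SYT C" using F unfolding SYT_def fillings_def by blast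
      have "sorted (map (\<lambda>k. S (cell T (Suc k))) [0..<n])"
      proof (clarsimp simp: sorted_iff_nth_mono)
        fix k l assume "k \<le> l" "l < n"
        then show "S (cell T (Suc k)) \<le> S (cell T (Suc l))"
          using Sle[of "cell T (Suc k)" "cell T (Suc l)"] cell_in[OF F] label_cell[OF F] by simp
      qed
      moreover have "mset (map (\<lambda>k. S (cell T (Suc k))) [0..<n]) = mset w" using image_mset_cells[OF F, of S] M by simp
      ultimately have wl: "w = map (\<lambda>k. S (cell T (Suc k))) [0..<n]"
        using w(1) by (metis properties_for_sort)
      have wv: "w ! (v - 1) = S (cell T v)" if "v \<in> {1..n}" for v
        using that by (cases v) (auto simp: wl)
      have "S = labels_by w T"
      proof
        fix c
        show "S c = labels_by w T c"
        proof (cases "c \<in> C")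
          case True
          then show ?thesis using wv[OF label_in[OF F True]] cell_label[OF F True] by (simp add: labels_by_def)
        next
          case False
          then have "S c = 0" using S unfolding SSYT_def by blast
          then show ?thesis using False by (simp add: labels_by_def)
        qed
      qed
      moreover have "Des_SYT C T \<subseteq> asc n w"
      proof
        fix e assume e: "e \<in> Des_SYT C T"
        then have "e \<in> {1..n - 1}" using Des_subset by blast
        then have e1: "1 \<le> e" "e < n" by auto
        obtain a b where x: "cell T e = (a, b)" by (metis prod.exhaust)
        obtain a' b' where y: "cell T (Suc e) = (a', b')" by (metis prod.exhaust)
        have C: "(a, b) \<in> C" "(a', b') \<in> C" "T (a, b) = e" "T (a', b') = Suc e"
          using cell_in[OF F, of e] cell_in[OF F, of "Suc e"] label_cell[OF F, of e] label_cell[OF F, of "Suc e"] e1 x y by auto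
        have lt: "a < a'" using Des_iff[OF T e1] e x y by simp
        have le: "S (a, b) \<le> S (a', b')" using Sle C by simp
        have "S (a, b) \<noteq> S (a', b')"
        proof
          assume eq: "S (a, b) = S (a', b')"
          have "key S (a, b) \<le> key S (a', b')" using ord' C by simp
          then have "b \<le> b'" using eq by (simp add: key_def)
          \<comment> \<open>The cell \<open>(a, b')\<close> lies above \<open>(a', b')\<close>, so a
            descent between equal values would contradict strictness of that column.\<close>
          then have m: "(a, b') \<in> C" using convex[OF C(1,2)] lt by simp
          have "S (a, b) \<le> S (a, b')" using row[OF C(1) m] \<open>b \<le> b'\<close> by (cases "b = b'") auto
          also have "\<dots> < S (a', b')" using col[OF m C(2) lt] .
          finally show False using eq by simp
        qed
        then have "S (cell T e) < S (cell T (Suc e))" using le x y by simp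
        then show "e \<in> asc n w" using wv[of e] wv[of "Suc e"] e1 by (simp add: asc_def)
      qed
      ultimately show "S \<in> labels_by w ` {T \<in> SYT C. Des_SYT C T \<subseteq> asc n w}" using T by blast
    qed
  qed
qed

end

section \<open>Quasisymmetric coefficients and descent counts\<close>

lemma fundamental_qsym_eq:
  assumes "D \<subseteq> {1..n - 1}"
  shows "fundamental_qsym n D M =
    (if size M = n \<and> 0 \<notin># M \<and> D \<subseteq> asc n (sorted_list_of_multiset M) then 1 else 0)"
proof -
  let ?w = "sorted_list_of_multiset M"
  have eq: "w = ?w" if "sorted w" "mset w = M" for w
    using that sorted_list_of_multiset_mset[of w] sorted_sort_id[of w] by metis
  have "{w. length w = n \<and> sorted w \<and> 0 \<notin> set w \<and> mset w = M \<and> (\<forall>j\<in>D. w ! (j - 1) < w ! j)} =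
    (if size M = n \<and> 0 \<notin># M \<and> D \<subseteq> asc n ?w then {?w} else {})"
  proof -
    have len: "length ?w = size M" by (metis mset_sorted_list_of_multiset size_mset)
    have st: "set ?w = set_mset M" by simp
    have "D \<subseteq> asc n ?w \<longleftrightarrow> (\<forall>j\<in>D. ?w ! (j - 1) < ?w ! j)" using assms by (auto simp: asc_def)
    then show ?thesis using eq len st by (auto simp: sorted_sorted_list_of_multiset; metis eq)
  qed
  then show ?thesis unfolding fundamental_qsym_def by simp
qed

lemma schur_eq:
  assumes p: "\<nu> \<in> partitions_of n"
  shows "schur \<nu> M = (if size M = n \<and> 0 \<notin># M
    then card {T \<in> SYT (cells (\<nu>, [])). Des_SYT (cells (\<nu>, [])) T \<subseteq> asc n (sorted_list_of_multiset M)} else 0)"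
proof -
  let ?C = "cells (\<nu>, [])" and ?w = "sorted_list_of_multiset M"
  have \<nu>: "is_partition \<nu>" "sum_list \<nu> = n" using p by (auto simp: partitions_of_def)
  interpret convex_cells ?C using convex_cells_skew[OF valid_skew_straight[OF \<nu>(1)]] .
  have n: "card ?C = n" using card_cells_straight \<nu> by simp
  show ?thesis
  proof (cases "size M = n \<and> 0 \<notin># M")
    case True
    have "length ?w = size M" by (metis mset_sorted_list_of_multiset size_mset)
    then have "bij_betw (labels_by ?w) {T \<in> SYT ?C. Des_SYT ?C T \<subseteq> asc n ?w}
      {S \<in> SSYT ?C. image_mset S (mset_set ?C) = M}"
      using standardization[of ?w] True n by (simp add: sorted_sorted_list_of_multiset)
    from bij_betw_same_card[OF this] show ?thesis
      unfolding schur_def using True by (simp only: if_True simp_thms)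
  next
    case False
    have "{S \<in> SSYT ?C. image_mset S (mset_set ?C) = M} = {}"
    proof (rule ccontr)
      assume "\<not> ?thesis"
      then obtain S where S: "S \<in> SSYT ?C" "image_mset S (mset_set ?C) = M" by blast
      have "size M = n" using S(2) n by (metis size_image_mset size_mset_set)
      moreover have "0 \<notin># M"
      proof
        assume "0 \<in># M"
        then obtain c where "c \<in> ?C" "S c = 0" using S(2) finite_C by auto
        then show False using S(1) unfolding SSYT_def by force
      qed
      ultimately show False using False by blast
    qed
    then have "schur \<nu> M = 0" unfolding schur_def by (simp only: card.empty)
    then show ?thesis using False by auto
  qed
qed

lemma card_subset_sum:
  assumes "finite A" "finite I"
  shows "card {x \<in> A. h x \<subseteq> I} = (\<Sum>D\<in>Pow I. card {x \<in> A. h x = D})"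
proof -
  have "{x \<in> A. h x \<subseteq> I} = (\<Union>D\<in>Pow I. {x \<in> A. h x = D})" by auto
  then show ?thesis using assms by (simp, subst card_UN_disjoint) auto
qed

lemma subset_sums_eq:
  fixes f g :: "'a set \<Rightarrow> real"
  assumes "finite X" "\<And>I. I \<subseteq> X \<Longrightarrow> (\<Sum>D\<in>Pow I. f D) = (\<Sum>D\<in>Pow I. g D)" "D \<subseteq> X"
  shows "f D = g D"
  using assms(3)
proof (induction "card D" arbitrary: D rule: less_induct)
  case less
  have fin: "finite D" using less.prems assms(1) finite_subset by blast
  have P: "Pow D = insert D (Pow D - {D})" by auto
  have "(\<Sum>D'\<in>Pow D - {D}. f D') = (\<Sum>D'\<in>Pow D - {D}. g D')"
  proof (rule sum.cong[OF refl])
    fix D' assume "D' \<in> Pow D - {D}"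
    then have "D' \<subset> D" by auto
    then show "f D' = g D'" using less fin psubset_card_mono[of D D'] by auto
  qed
  moreover have "sum h (Pow D) = h D + (\<Sum>D'\<in>Pow D - {D}. h D')" for h :: "'a set \<Rightarrow> real"
    using fin by (subst P) (subst sum.insert, auto)
  ultimately show ?case using assms(2)[OF less.prems] by simp
qed

definition des_count :: "nat list \<Rightarrow> nat set \<Rightarrow> nat" where
  "des_count \<nu> D = card {T \<in> SYT (cells (\<nu>, [])). Des_SYT (cells (\<nu>, [])) T = D}"

lemma finite_SYT_straight: "\<nu> \<in> partitions_of n \<Longrightarrow> finite (SYT (cells (\<nu>, [])))"
  using convex_cells.finite_SYT[OF convex_cells_skew[OF valid_skew_straight]] by (auto simp: partitions_of_def)

lemma Des_perm_subset: "Des_perm n \<pi> \<subseteq> {1..n - 1}"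
  by (auto simp: Des_perm_def)

lemma sum_fundamental_qsym:
  assumes "finite A"
  shows "(\<Sum>\<pi>\<in>A. real (fundamental_qsym n (Des_perm n \<pi>) M)) =
    (if size M = n \<and> 0 \<notin># M then real (card {\<pi> \<in> A. Des_perm n \<pi> \<subseteq> asc n (sorted_list_of_multiset M)}) else 0)"
proof (cases "size M = n \<and> 0 \<notin># M")
  case True
  then have "(\<Sum>\<pi>\<in>A. real (fundamental_qsym n (Des_perm n \<pi>) M)) =
    (\<Sum>\<pi>\<in>A. if Des_perm n \<pi> \<subseteq> asc n (sorted_list_of_multiset M) then 1 else 0)"
    using fundamental_qsym_eq[OF Des_perm_subset, of n] by (intro sum.cong) auto
  also have "\<dots> = real (card {\<pi> \<in> A. Des_perm n \<pi> \<subseteq> asc n (sorted_list_of_multiset M)})"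
    using assms by (simp add: sum.If_cases Int_def)
  finally show ?thesis using True by simp
next
  case False
  then show ?thesis using fundamental_qsym_eq[OF Des_perm_subset, of n] by (intro sum.neutral[THEN trans]) auto
qed

text \<open>Supplies enough monomials: every set of positions is an ascent set, so comparing the
  coefficients of all monomials yields all subset sums.\<close>

lemma asc_realize:
  assumes "I \<subseteq> {1..n - 1}"
  obtains M where "size M = n" "0 \<notin># M" "asc n (sorted_list_of_multiset M) = I"
proof -
  \<comment> \<open>The letter at 0-based position \<open>k\<close> steps up exactly at the
    \<open>k\<close> in \<open>I\<close>, which matches the convention of \<open>asc\<close>;
    \<open>Suc\<close> keeps the letters positive.\<close>
  define w where "w = map (\<lambda>k. Suc (card {d \<in> I. d \<le> k})) [0..<n]"
  have finI: "finite I" using assms finite_subset by blast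
  have w: "sorted w" "length w = n" "0 \<notin> set w"
    using finI by (auto simp: w_def sorted_iff_nth_mono intro!: card_mono)
  have "asc n w = I"
  proof -
    have "w ! (j - 1) < w ! j \<longleftrightarrow> j \<in> I" if j: "j \<in> {1..n - 1}" for j
    proof -
      have jn: "j - 1 < n" "j < n" using j by auto
      have "{d \<in> I. d \<le> j} = (if j \<in> I then insert j {d \<in> I. d \<le> j - 1} else {d \<in> I. d \<le> j - 1})"
        using j by (auto simp: le_diff_conv2 elim: le_neq_implies_less)
          (metis Suc_pred' Suc_leI le_neq_implies_less less_Suc_eq_le not_less0 not_gr_zero le_antisym not_less_eq_eq)+
      then have "card {d \<in> I. d \<le> j} = card {d \<in> I. d \<le> j - 1} + (if j \<in> I then 1 else 0)"
        using finI j by auto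
      then show ?thesis using jn by (simp add: w_def)
    qed
    then show ?thesis using assms by (auto simp: asc_def)
  qed
  moreover have "sorted_list_of_multiset (mset w) = w" using w(1) by (simp add: sorted_sort_id)
  ultimately show thesis using that[of "mset w"] w by simp
qed

text \<open>On both sides the coefficient at \<open>M\<close> sees only the descent sets contained
  in the ascent set of \<open>M\<close>. All subsets of \<open>{1..n - 1}\<close> occur as such
  ascent sets, and subset sums determine their summands.\<close>

lemma schur_positive_iff:
  assumes fin: "finite A"
  shows "(\<forall>M. (\<Sum>\<pi>\<in>A. real (fundamental_qsym n (Des_perm n \<pi>) M)) = (\<Sum>la\<in>partitions_of n. c la * real (schur la M)))
    \<longleftrightarrow> (\<forall>D\<subseteq>{1..n - 1}. real (card {\<pi> \<in> A. Des_perm n \<pi> = D}) = (\<Sum>la\<in>partitions_of n. c la * real (des_count la D)))"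
proof -
  let ?X = "{1..n - 1}"
  define f where "f D = real (card {\<pi> \<in> A. Des_perm n \<pi> = D})" for D
  define g where "g D = (\<Sum>la\<in>partitions_of n. c la * real (des_count la D))" for D
  have F: "real (card {\<pi> \<in> A. Des_perm n \<pi> \<subseteq> I}) = (\<Sum>D\<in>Pow I. f D)" if "finite I" for I
    using card_subset_sum[OF fin that, of "Des_perm n"] by (simp add: f_def)
  have G: "(\<Sum>la\<in>partitions_of n. c la * real (card {T \<in> SYT (cells (la, [])). Des_SYT (cells (la, [])) T \<subseteq> I})) = (\<Sum>D\<in>Pow I. g D)"
    if "finite I" for I
  proof -
    have "(\<Sum>D\<in>Pow I. g D) = (\<Sum>la\<in>partitions_of n. \<Sum>D\<in>Pow I. c la * real (des_count la D))"
      unfolding g_def by (rule sum.swap)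
    also have "\<dots> = (\<Sum>la\<in>partitions_of n. c la * real (card {T \<in> SYT (cells (la, [])). Des_SYT (cells (la, [])) T \<subseteq> I}))"
      using card_subset_sum[OF finite_SYT_straight that]
      by (intro sum.cong refl) (simp add: des_count_def sum_distrib_left)
    finally show ?thesis by simp
  qed
  have step: "(\<Sum>\<pi>\<in>A. real (fundamental_qsym n (Des_perm n \<pi>) M)) = (\<Sum>la\<in>partitions_of n. c la * real (schur la M))
    \<longleftrightarrow> (size M = n \<and> 0 \<notin># M \<longrightarrow>
       (\<Sum>D\<in>Pow (asc n (sorted_list_of_multiset M)). f D) = (\<Sum>D\<in>Pow (asc n (sorted_list_of_multiset M)). g D))" for M
  proof -
    have fa: "finite (asc n (sorted_list_of_multiset M))" by (simp add: asc_def)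
    have "(\<Sum>la\<in>partitions_of n. c la * real (schur la M)) =
      (if size M = n \<and> 0 \<notin># M then \<Sum>D\<in>Pow (asc n (sorted_list_of_multiset M)). g D else 0)"
      unfolding G[OF fa, symmetric] using schur_eq[of _ n M] by (cases "size M = n \<and> 0 \<notin># M") auto
    then show ?thesis unfolding sum_fundamental_qsym[OF fin] F[OF fa]
      by (cases "size M = n \<and> 0 \<notin># M") auto
  qed
  have "(\<forall>M. (\<Sum>\<pi>\<in>A. real (fundamental_qsym n (Des_perm n \<pi>) M)) = (\<Sum>la\<in>partitions_of n. c la * real (schur la M)))
    \<longleftrightarrow> (\<forall>I\<subseteq>?X. (\<Sum>D\<in>Pow I. f D) = (\<Sum>D\<in>Pow I. g D))"
  proof
    assume h: "\<forall>M. (\<Sum>\<pi>\<in>A. real (fundamental_qsym n (Des_perm n \<pi>) M)) = (\<Sum>la\<in>partitions_of n. c la * real (schur la M))"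
    show "\<forall>I\<subseteq>?X. (\<Sum>D\<in>Pow I. f D) = (\<Sum>D\<in>Pow I. g D)"
    proof (intro allI impI)
      fix I assume "I \<subseteq> ?X"
      then obtain M where M: "size M = n" "0 \<notin># M" "asc n (sorted_list_of_multiset M) = I" by (rule asc_realize)
      then show "(\<Sum>D\<in>Pow I. f D) = (\<Sum>D\<in>Pow I. g D)" using h step[of M] by simp
    qed
  next
    assume "\<forall>I\<subseteq>?X. (\<Sum>D\<in>Pow I. f D) = (\<Sum>D\<in>Pow I. g D)"
    moreover have "asc n w \<subseteq> ?X" for w by (auto simp: asc_def)
    ultimately show "\<forall>M. (\<Sum>\<pi>\<in>A. real (fundamental_qsym n (Des_perm n \<pi>) M)) = (\<Sum>la\<in>partitions_of n. c la * real (schur la M))"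
      unfolding step by blast
  qed
  also have "\<dots> \<longleftrightarrow> (\<forall>D\<subseteq>?X. f D = g D)"
  proof
    assume h: "\<forall>I\<subseteq>?X. (\<Sum>D\<in>Pow I. f D) = (\<Sum>D\<in>Pow I. g D)"
    show "\<forall>D\<subseteq>?X. f D = g D" using subset_sums_eq[of ?X f g] h by blast
  next
    assume h: "\<forall>D\<subseteq>?X. f D = g D"
    show "\<forall>I\<subseteq>?X. (\<Sum>D\<in>Pow I. f D) = (\<Sum>D\<in>Pow I. g D)"
      using h by (intro allI impI sum.cong) auto
  qed
  finally show ?thesis unfolding f_def g_def .
qed

text \<open>
  The content of the superstandard tableau; the Kostka matrix is unitriangular in these contents,
  hence Schur coefficients of an integral function are integers.
\<close>

definition super_content :: "nat list \<Rightarrow> nat multiset" where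
  "super_content la = image_mset (\<lambda>c. Suc (fst c)) (mset_set (cells (la, [])))"

text \<open>Partial sums of the parts, so that comparison for all \<open>t\<close> is dominance
  order.\<close>

definition rows_below :: "nat list \<Rightarrow> nat \<Rightarrow> nat" where
  "rows_below la t = card {c \<in> cells (la, []). fst c < t}"

lemma finite_cells_straight: "is_partition la \<Longrightarrow> finite (cells (la, []))"
  using convex_cells.finite_C[OF convex_cells_skew[OF valid_skew_straight]] by blast

lemma SSYT_row_bound:
  assumes "is_partition \<nu>" "S \<in> SSYT (cells (\<nu>, []))" "(i, j) \<in> cells (\<nu>, [])"
  shows "Suc i \<le> S (i, j)"
  using assms(3)
proof (induction i)
  case 0
  then show ?case using assms(2) unfolding SSYT_def by auto
next
  case (Suc i)
  interpret convex_cells "cells (\<nu>, [])" using convex_cells_skew[OF valid_skew_straight[OF assms(1)]] .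
  have "(0, j) \<in> cells (\<nu>, [])"
  proof -
    have "\<nu> ! Suc i \<le> \<nu> ! 0" using assms(1) Suc.prems
      by (auto simp: is_partition_def sorted_wrt_iff_nth_less cells_straight)
    then show ?thesis using Suc.prems by (auto simp: cells_straight)
  qed
  then have c: "(i, j) \<in> cells (\<nu>, [])" using convex[OF _ Suc.prems, of 0 j i j] by simp
  then have "S (i, j) < S (Suc i, j)" using assms(2) Suc.prems unfolding SSYT_def by blast
  then show ?case using Suc.IH[OF c] by simp
qed

text \<open>Column strictness forces the entries at most \<open>t\<close> into the first
  \<open>t\<close> rows, and the content prescribes how many of them there are.\<close>

lemma schur_super_content_dominance:
  assumes \<nu>: "is_partition \<nu>" and la: "is_partition la" and nz: "schur \<nu> (super_content la) \<noteq> 0"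
  shows "rows_below la t \<le> rows_below \<nu> t"
proof -
  let ?C = "cells (\<nu>, [])" and ?D = "cells (la, [])"
  have "{S \<in> SSYT ?C. image_mset S (mset_set ?C) = super_content la} \<noteq> {}"
    using nz unfolding schur_def by (metis card.empty)
  then obtain S where S: "S \<in> SSYT ?C" "image_mset S (mset_set ?C) = super_content la" by blast
  have fin: "finite ?C" "finite ?D" using finite_cells_straight \<nu> la by auto
  have cnt: "size (filter_mset (\<lambda>v. v \<le> t) (image_mset f (mset_set X))) = card {c \<in> X. f c \<le> t}" if "finite X" for f and X :: "(nat \<times> nat) set"
    using that by (simp add: filter_mset_image_mset)
  have "rows_below la t = size (filter_mset (\<lambda>v. v \<le> t) (super_content la))"
    unfolding super_content_def cnt[OF fin(2)] rows_below_def by (simp add: Suc_le_eq)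
  also have "\<dots> = card {c \<in> ?C. S c \<le> t}" unfolding S(2)[symmetric] cnt[OF fin(1)] ..
  also have "\<dots> \<le> rows_below \<nu> t"
    unfolding rows_below_def
  proof (rule card_mono)
    show "{c \<in> ?C. S c \<le> t} \<subseteq> {c \<in> ?C. fst c < t}"
      using SSYT_row_bound[OF \<nu> S(1)] by (force simp: Suc_le_eq)
  qed (use fin in simp)
  finally show ?thesis .
qed

text \<open>The lower bound \<open>Suc (fst c)\<close> must be attained in every cell, because the
  content already prescribes the sum of all entries.\<close>

lemma schur_super_content_self:
  assumes la: "is_partition la"
  shows "schur la (super_content la) = 1"
proof -
  let ?C = "cells (la, [])"
  have fin: "finite ?C" using finite_cells_straight la by auto
  define S0 where "S0 c = (if c \<in> ?C then Suc (fst c) else 0)" for c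
  have "{S \<in> SSYT ?C. image_mset S (mset_set ?C) = super_content la} = {S0}"
  proof (intro equalityI subsetI)
    fix S assume "S \<in> {S \<in> SSYT ?C. image_mset S (mset_set ?C) = super_content la}"
    then have S: "S \<in> SSYT ?C" "image_mset S (mset_set ?C) = super_content la" by auto
    have le: "Suc (fst c) \<le> S c" if "c \<in> ?C" for c using SSYT_row_bound[OF la S(1), of "fst c" "snd c"] that by simp
    have "(\<Sum>c\<in>?C. S c) = sum_mset (image_mset S (mset_set ?C))" by (simp add: sum_unfold_sum_mset)
    also have "\<dots> = (\<Sum>c\<in>?C. Suc (fst c))" unfolding S(2) super_content_def by (simp add: sum_unfold_sum_mset)
    finally have sum: "(\<Sum>c\<in>?C. S c) = (\<Sum>c\<in>?C. Suc (fst c))" .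
    have "S c = Suc (fst c)" if "c \<in> ?C" for c
    proof (rule ccontr)
      assume "S c \<noteq> Suc (fst c)"
      then have "Suc (fst c) < S c" using le[OF that] by simp
      then have "(\<Sum>c\<in>?C. Suc (fst c)) < (\<Sum>c\<in>?C. S c)" using le that fin by (intro sum_strict_mono_ex1) auto
      then show False using sum by simp
    qed
    moreover have "S c = 0" if "c \<notin> ?C" for c using S(1) that unfolding SSYT_def by blast
    ultimately have "S = S0" by (intro ext) (simp add: S0_def)
    then show "S \<in> {S0}" by simp
  next
    fix S assume "S \<in> {S0}"
    moreover have "S0 \<in> SSYT ?C" unfolding SSYT_def S0_def by auto
    moreover have "image_mset S0 (mset_set ?C) = super_content la"
      unfolding super_content_def using fin by (intro image_mset_cong) (simp add: S0_def)
    ultimately show "S \<in> {S \<in> SSYT ?C. image_mset S (mset_set ?C) = super_content la}" by simp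
  qed
  then show ?thesis unfolding schur_def by simp
qed

lemma rows_below_inj:
  assumes la: "la \<in> partitions_of n" and \<nu>: "\<nu> \<in> partitions_of n"
    and eq: "\<And>t. t \<le> n \<Longrightarrow> rows_below la t = rows_below \<nu> t"
  shows "la = \<nu>"
proof -
  have len: "length \<mu> \<le> n" "0 \<notin> set \<mu>" "is_partition \<mu>" if "\<mu> \<in> partitions_of n" for \<mu>
  proof -
    have m: "0 \<notin> set \<mu>" "sum_list \<mu> = n" using that by (auto simp: partitions_of_def is_partition_def)
    have "length \<mu> \<le> sum_list \<mu>" using m(1) by (induction \<mu>) (auto simp: Suc_le_eq)
    then show "length \<mu> \<le> n" using m(2) by simp
    show "0 \<notin> set \<mu>" "is_partition \<mu>" using that by (auto simp: partitions_of_def is_partition_def)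
  qed
  have row: "rows_below \<mu> (Suc t) = rows_below \<mu> t + part_row \<mu> t" if "\<mu> \<in> partitions_of n" for \<mu> t
  proof -
    have fin: "finite (cells (\<mu>, []))" using finite_cells_straight len(3)[OF that] by blast
    have "{c \<in> cells (\<mu>, []). fst c < Suc t} = {c \<in> cells (\<mu>, []). fst c < t} \<union> {t} \<times> {..<part_row \<mu> t}"
      by (auto simp: cells_straight part_row_def less_Suc_eq)
    moreover have "{c \<in> cells (\<mu>, []). fst c < t} \<inter> {t} \<times> {..<part_row \<mu> t} = {}" by auto
    ultimately show ?thesis unfolding rows_below_def using fin by (simp add: card_Un_disjoint card_cartesian_product)
  qed
  have pr: "part_row la t = part_row \<nu> t" if "t < n" for t
    using row[OF la, of t] row[OF \<nu>, of t] eq[of t] eq[of "Suc t"] that by simp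
  have pos: "t < length \<mu> \<longleftrightarrow> 0 < part_row \<mu> t" if "\<mu> \<in> partitions_of n" for \<mu> t
    using len(2)[OF that] by (auto simp: part_row_def) (metis neq0_conv nth_mem)
  have iff: "t < length la \<longleftrightarrow> t < length \<nu>" for t
  proof (cases "t < n")
    case True
    then show ?thesis using pos[OF la] pos[OF \<nu>] pr by simp
  next
    case False
    then show ?thesis using len(1)[OF la] len(1)[OF \<nu>] by simp
  qed
  then have L: "length la = length \<nu>" by (metis linorder_neqE_nat less_irrefl)
  show ?thesis
  proof (rule nth_equalityI[OF L])
    fix t assume t: "t < length la"
    then have "t < n" using len(1)[OF la] by simp
    then show "la ! t = \<nu> ! t" using pr[of t] t L by (simp add: part_row_def)
  qed
qed

text \<open>Back substitution along dominance order: the coefficient at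
  \<open>super_content la\<close> involves \<open>c la\<close> with factor 1 and otherwise only
  partitions strictly above \<open>la\<close>. The measure decreases upwards;
  \<open>Suc n * n\<close> bounds the sum of the \<open>n + 1\<close> values
  \<open>rows_below la t\<close>.\<close>

lemma schur_coeffs_integral:
  fixes c :: "nat list \<Rightarrow> real"
  assumes N: "\<And>M. (\<Sum>la\<in>partitions_of n. c la * real (schur la M)) \<in> \<int>"
  shows "la \<in> partitions_of n \<Longrightarrow> c la \<in> \<int>"
proof (induction la rule: measure_induct_rule[where f = "\<lambda>la. Suc n * n - (\<Sum>t\<le>n. rows_below la t)"])
  case (less la)
  have rb: "rows_below \<mu> t \<le> n" if "\<mu> \<in> partitions_of n" for \<mu> t
  proof -
    have "finite (cells (\<mu>, []))" using that finite_cells_straight by (auto simp: partitions_of_def)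
    then have "rows_below \<mu> t \<le> card (cells (\<mu>, []))" unfolding rows_below_def by (intro card_mono) auto
    then show ?thesis using that card_cells_straight[of \<mu>] by (simp add: partitions_of_def)
  qed
  have tot: "(\<Sum>t\<le>n. rows_below \<mu> t) \<le> Suc n * n" if "\<mu> \<in> partitions_of n" for \<mu>
    using sum_bounded_above[of "{..n}" "rows_below \<mu>" n] rb[OF that] by simp
  have p: "is_partition \<mu>" if "\<mu> \<in> partitions_of n" for \<mu> using that by (simp add: partitions_of_def)
  let ?M = "super_content la"
  have int: "c \<nu> * real (schur \<nu> ?M) \<in> \<int>" if \<nu>: "\<nu> \<in> partitions_of n" "\<nu> \<noteq> la" for \<nu>
  proof (cases "schur \<nu> ?M = 0")
    case False
    have le: "rows_below la t \<le> rows_below \<nu> t" for t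
      using schur_super_content_dominance[OF p[OF \<nu>(1)] p[OF less.prems] False] .
    obtain t0 where t0: "t0 \<le> n" "rows_below la t0 \<noteq> rows_below \<nu> t0"
      using rows_below_inj[OF less.prems \<nu>(1)] \<nu>(2) by metis
    then have "rows_below la t0 < rows_below \<nu> t0" using le[of t0] by simp
    then have "(\<Sum>t\<le>n. rows_below la t) < (\<Sum>t\<le>n. rows_below \<nu> t)"
      using le t0 by (intro sum_strict_mono_ex1) auto
    then have "Suc n * n - (\<Sum>t\<le>n. rows_below \<nu> t) < Suc n * n - (\<Sum>t\<le>n. rows_below la t)"
      using tot[OF \<nu>(1)] by linarith
    then have "c \<nu> \<in> \<int>" using less.IH \<nu>(1) by blast
    then show ?thesis by simp
  qed simp
  have "(\<Sum>\<nu>\<in>partitions_of n. c \<nu> * real (schur \<nu> ?M)) =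
    c la * real (schur la ?M) + (\<Sum>\<nu>\<in>partitions_of n - {la}. c \<nu> * real (schur \<nu> ?M))"
    using less.prems finite_partitions_of by (rule sum.remove[rotated])
  then have "c la = (\<Sum>\<nu>\<in>partitions_of n. c \<nu> * real (schur \<nu> ?M)) - (\<Sum>\<nu>\<in>partitions_of n - {la}. c \<nu> * real (schur \<nu> ?M))"
    using schur_super_content_self[OF p[OF less.prems]] by simp
  moreover have "(\<Sum>\<nu>\<in>partitions_of n - {la}. c \<nu> * real (schur \<nu> ?M)) \<in> \<int>"
    using int by (intro Ints_sum) auto
  ultimately show ?case using N[of ?M] by (metis Ints_diff)
qed

lemma schur_positive_nat_coeffs:
  assumes fin: "finite A" and sp: "schur_positive n A"
  obtains c :: "nat list \<Rightarrow> nat" where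
    "\<And>D. D \<subseteq> {1..n - 1} \<Longrightarrow> card {\<pi> \<in> A. Des_perm n \<pi> = D} = (\<Sum>la\<in>partitions_of n. c la * des_count la D)"
proof -
  obtain c where c: "\<And>la. c la \<ge> 0"
    and M: "\<forall>M. (\<Sum>\<pi>\<in>A. real (fundamental_qsym n (Des_perm n \<pi>) M)) = (\<Sum>la\<in>partitions_of n. c la * real (schur la M))"
    using sp unfolding schur_positive_def by blast
  have "(\<Sum>la\<in>partitions_of n. c la * real (schur la M)) \<in> \<int>" for M
    using M[rule_format, of M, symmetric] by (simp add: Ints_sum)
  then have ci: "c la \<in> \<int>" if "la \<in> partitions_of n" for la using schur_coeffs_integral that by blast
  define c' where "c' la = nat \<lfloor>c la\<rfloor>" for la
  have cc: "c la = real (c' la)" if "la \<in> partitions_of n" for la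
    using ci[OF that] c[of la] by (auto simp: c'_def Ints_def)
  have D: "real (card {\<pi> \<in> A. Des_perm n \<pi> = D}) = (\<Sum>la\<in>partitions_of n. c la * real (des_count la D))" if "D \<subseteq> {1..n - 1}" for D
    using schur_positive_iff[OF fin, of n c] M that by blast
  show thesis
  proof (rule that)
    fix D assume "D \<subseteq> {1..n - 1}"
    then have "real (card {\<pi> \<in> A. Des_perm n \<pi> = D}) = real (\<Sum>la\<in>partitions_of n. c' la * des_count la D)"
      using D cc by simp
    then show "card {\<pi> \<in> A. Des_perm n \<pi> = D} = (\<Sum>la\<in>partitions_of n. c' la * des_count la D)"
      using of_nat_eq_iff by blast
  qed
qed

lemma schur_positiveI:
  fixes c :: "nat list \<Rightarrow> nat"
  assumes "finite A" "\<And>D. D \<subseteq> {1..n - 1} \<Longrightarrow> card {\<pi> \<in> A. Des_perm n \<pi> = D} = (\<Sum>la\<in>partitions_of n. c la * des_count la D)"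
  shows "schur_positive n A"
  unfolding schur_positive_def
  using schur_positive_iff[OF assms(1), of n "\<lambda>la. real (c la)"] assms(2)
  by (intro exI[of _ "\<lambda>la. real (c la)"]) simp

section \<open>Cyclic descent extensions\<close>

text \<open>Equivariance is a matter of fibre sizes: bijections between the fibres over
  \<open>y\<close> and \<open>\<sigma> y\<close> are glued, and finiteness turns the injective
  result into a bijection.\<close>

lemma fiberwise_bijection:
  assumes fin: "finite X" and h: "\<And>x. x \<in> X \<Longrightarrow> h x \<in> Y" and \<sigma>: "inj_on \<sigma> Y"
    and card: "\<And>y. y \<in> Y \<Longrightarrow> card {x \<in> X. h x = \<sigma> y} = card {x \<in> X. h x = y}"
  shows "\<exists>\<psi>. bij_betw \<psi> X X \<and> (\<forall>x\<in>X. h (\<psi> x) = \<sigma> (h x))"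
proof -
  have "\<exists>f. bij_betw f {x \<in> X. h x = y} {x \<in> X. h x = \<sigma> y}" if "y \<in> Y" for y
    using fin card[OF that] by (intro finite_same_card_bij) auto
  then obtain f where f: "\<And>y. y \<in> Y \<Longrightarrow> bij_betw (f y) {x \<in> X. h x = y} {x \<in> X. h x = \<sigma> y}" by metis
  define \<psi> where "\<psi> x = f (h x) x" for x
  have im: "\<psi> x \<in> X \<and> h (\<psi> x) = \<sigma> (h x)" if "x \<in> X" for x
    using bij_betw_apply[OF f[OF h[OF that]], of x] that by (simp add: \<psi>_def)
  have "inj_on \<psi> X"
  proof (rule inj_onI)
    fix x x' assume x: "x \<in> X" "x' \<in> X" "\<psi> x = \<psi> x'"
    then have "\<sigma> (h x) = \<sigma> (h x')" using im by metis
    then have e: "h x = h x'" using \<sigma> h x by (auto simp: inj_on_def)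
    then show "x = x'"
      using bij_betw_imp_inj_on[OF f[OF h[OF x(1)]]] x by (auto simp: inj_on_def \<psi>_def)
  qed
  moreover have "\<psi> ` X \<subseteq> X" using im by blast
  ultimately have "bij_betw \<psi> X X" using fin by (metis bij_betw_def endo_inj_surj)
  then show ?thesis using im by blast
qed

text \<open>Only the counts matter: in each descent class \<open>D\<close> an arbitrary set of
  \<open>m (insert n D)\<close> tableaux receives the extra element \<open>n\<close>, and
  \<open>rec\<close> leaves \<open>m D\<close> tableaux without it. Rotation invariance of
  \<open>m\<close> then yields the bijection.\<close>

lemma cyclic_descent_ext_exists:
  assumes C: "convex_cells C" and n: "card C = n" "n \<ge> 1"
    and shift: "\<And>J. J \<subseteq> {1..n} \<Longrightarrow> m (cshift n J) = m J"
    and rec: "\<And>D. D \<subseteq> {1..n - 1} \<Longrightarrow> m D + m (insert n D) = card {T \<in> SYT C. Des_SYT C T = D}"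
    and m0: "m {} = 0" and mn: "m {1..n} = 0"
  shows "\<exists>cD \<psi>. cyclic_descent_ext C cD \<psi> \<and>
    (\<forall>J. card {T \<in> SYT C. cD T = J} = (if J \<subseteq> {1..n} then m J else (0::nat)))"
proof -
  interpret convex_cells C by (rule C)
  have "\<exists>Y. Y \<subseteq> {T \<in> SYT C. Des_SYT C T = D} \<and> card Y = m (insert n D)" if "D \<subseteq> {1..n - 1}" for D
  proof -
    have "m (insert n D) \<le> card {T \<in> SYT C. Des_SYT C T = D}" using rec[OF that] by simp
    then show ?thesis by (rule obtain_subset_with_card_n) blast
  qed
  then obtain Y where Y: "\<And>D. D \<subseteq> {1..n - 1} \<Longrightarrow> Y D \<subseteq> {T \<in> SYT C. Des_SYT C T = D} \<and> card (Y D) = m (insert n D)"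
    by metis
  define cD where "cD T = (if T \<in> Y (Des_SYT C T) then insert n (Des_SYT C T) else Des_SYT C T)" for T
  have Ds: "Des_SYT C T \<subseteq> {1..n - 1}" for T using Des_subset n by simp
  have nD: "n \<notin> Des_SYT C T" for T using Ds[of T] n by auto
  have sub: "cD T \<subseteq> {1..n}" for T
  proof -
    have "{1..n - 1} \<subseteq> {1..n}" "n \<in> {1..n}" using n(2) by auto
    then have "insert n (Des_SYT C T) \<subseteq> {1..n}" using Ds[of T] by blast
    then show ?thesis unfolding cD_def by (cases "T \<in> Y (Des_SYT C T)") auto
  qed
  have cnt: "card {T \<in> SYT C. cD T = J} = (if J \<subseteq> {1..n} then m J else 0)" for J
  proof (cases "J \<subseteq> {1..n}")
    case True
    define D where "D = J - {n}"
    have D: "D \<subseteq> {1..n - 1}"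
    proof
      fix d assume "d \<in> D"
      then have "d \<in> {1..n}" "d \<noteq> n" using True unfolding D_def by blast+
      then show "d \<in> {1..n - 1}" by auto
    qed
    show ?thesis
    proof (cases "n \<in> J")
      case nJ: True
      then have J: "J = insert n D" by (auto simp: D_def)
      have "{T \<in> SYT C. cD T = J} = Y D"
      proof (intro equalityI subsetI)
        fix T assume T: "T \<in> {T \<in> SYT C. cD T = J}"
        then have *: "T \<in> Y (Des_SYT C T)" "insert n (Des_SYT C T) = J"
          using nD[of T] nJ by (auto simp: cD_def split: if_splits)
        then have "Des_SYT C T = D" using nD[of T] unfolding D_def by blast
        then show "T \<in> Y D" using * by simp
      next
        fix T assume T: "T \<in> Y D"
        then have "T \<in> SYT C" "Des_SYT C T = D" using Y[OF D] by blast+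
        then show "T \<in> {T \<in> SYT C. cD T = J}" using T J by (simp add: cD_def)
      qed
      then show ?thesis using Y[OF D] J True by simp
    next
      case nJ: False
      then have J: "J = D" by (auto simp: D_def)
      have "{T \<in> SYT C. cD T = J} = {T \<in> SYT C. Des_SYT C T = D} - Y D"
        using nJ J by (auto simp: cD_def split: if_splits)
      moreover have "finite {T \<in> SYT C. Des_SYT C T = D}" using finite_SYT by simp
      then have "finite (Y D)" using Y[OF D] finite_subset by blast
      ultimately have "card {T \<in> SYT C. cD T = J} = card {T \<in> SYT C. Des_SYT C T = D} - card (Y D)"
        using Y[OF D] by (simp only: card_Diff_subset)
      then show ?thesis using Y[OF D] rec[OF D] J True by simp
    qed
  next
    case False
    then have "{T \<in> SYT C. cD T = J} = {}" using sub by blast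
    then show ?thesis using False by (simp only: card.empty if_False)
  qed
  have "\<exists>\<psi>. bij_betw \<psi> (SYT C) (SYT C) \<and> (\<forall>T\<in>SYT C. cD (\<psi> T) = cshift n (cD T))"
  proof (rule fiberwise_bijection[OF finite_SYT])
    show "cD T \<in> Pow {1..n}" for T using sub by blast
    show "inj_on (cshift n) (Pow {1..n})" using cshift_inj[OF n(2)] .
    fix J assume "J \<in> Pow {1..n}"
    then show "card {T \<in> SYT C. cD T = cshift n J} = card {T \<in> SYT C. cD T = J}"
      unfolding cnt using shift cshift_subset[OF n(2)] by auto
  qed
  then obtain \<psi> where \<psi>: "bij_betw \<psi> (SYT C) (SYT C)" "\<forall>T\<in>SYT C. cD (\<psi> T) = cshift n (cD T)" by blast
  have ne: "cD T \<noteq> J" if "T \<in> SYT C" "J \<subseteq> {1..n}" "m J = 0" for T J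
  proof
    assume "cD T = J"
    then have "T \<in> {T \<in> SYT C. cD T = J}" using that by simp
    moreover have "finite {T \<in> SYT C. cD T = J}" using finite_SYT by simp
    moreover have "card {T \<in> SYT C. cD T = J} = 0" using cnt[of J] that by simp
    ultimately show False by (metis card_0_eq empty_iff)
  qed
  have "cD T \<inter> {1..n - 1} = Des_SYT C T" for T
  proof -
    have "n \<notin> {1..n - 1}" using n(2) by simp
    then have "insert n (Des_SYT C T) \<inter> {1..n - 1} = Des_SYT C T" "Des_SYT C T \<inter> {1..n - 1} = Des_SYT C T"
      using Ds[of T] by blast+
    then show ?thesis unfolding cD_def by (cases "T \<in> Y (Des_SYT C T)") (simp_all only: if_True if_False)
  qed
  then have "cyclic_descent_ext C cD \<psi>"
    unfolding cyclic_descent_ext_def n(1) using \<psi> sub ne m0 mn by blast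
  then show ?thesis using cnt by blast
qed

section \<open>Hooks and row-column shapes\<close>

text \<open>For \<open>a = 0\<close> a hook, for \<open>a = 1\<close> a row and a column that meet only diagonally.\<close>

definition corner :: "nat \<Rightarrow> nat \<Rightarrow> nat \<Rightarrow> (nat \<times> nat) set" where
  "corner a h k = {(0, j) | j. a \<le> j \<and> j < h} \<union> {(i, 0) | i. 1 \<le> i \<and> i \<le> k}"

lemma cells_corner:
  "cells (h # replicate k 1, []) = corner 0 h k"
  "cells (h # replicate k 1, [1]) = corner 1 h k"
proof -
  have "(i, j) \<in> cells (h # replicate k 1, []) \<longleftrightarrow> (i, j) \<in> corner 0 h k" for i j
    by (cases i) (auto simp: cells_def part_row_def corner_def)
  then show "cells (h # replicate k 1, []) = corner 0 h k" by auto
  have "(i, j) \<in> cells (h # replicate k 1, [1]) \<longleftrightarrow> (i, j) \<in> corner 1 h k" for i j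
    by (cases i) (auto simp: cells_def part_row_def corner_def)
  then show "cells (h # replicate k 1, [1]) = corner 1 h k" by auto
qed

lemma card_corner: "a \<le> h \<Longrightarrow> card (corner a h k) = h - a + k"
proof -
  assume "a \<le> h"
  have e: "corner a h k = (\<lambda>j. (0, j)) ` {a..<h} \<union> (\<lambda>i. (i, 0)) ` {1..k}"
    by (auto simp: corner_def)
  show ?thesis unfolding e
    by (subst card_Un_disjoint) (auto simp: card_image inj_on_def)
qed

definition corner_filling :: "nat \<Rightarrow> nat \<Rightarrow> nat \<Rightarrow> nat set \<Rightarrow> nat \<times> nat \<Rightarrow> nat" where
  "corner_filling a h k B = (\<lambda>(i, j). if (i, j) \<notin> corner a h k then 0
     else if i = 0 then sorted_list_of_set ({1..h - a + k} - B) ! (j - a) else sorted_list_of_set B ! (i - 1))"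

definition leg_set :: "nat \<Rightarrow> (nat \<times> nat \<Rightarrow> nat) \<Rightarrow> nat set" where
  "leg_set k T = (\<lambda>i. T (i, 0)) ` {1..k}"

lemma sorted_list_of_set_strict_mono:
  assumes "finite B" "i < j" "j < card B"
  shows "sorted_list_of_set B ! i < sorted_list_of_set B ! j"
  using assms sorted_wrt_nth_less[OF strict_sorted_list_of_set, of i j B] by simp

lemma corner_filling_SYT:
  assumes ah: "a \<le> h" "a \<le> 1" and B: "B \<subseteq> {1..h - a + k}" "card B = k" and one: "a = 0 \<Longrightarrow> 1 \<le> h \<and> 1 \<notin> B"
  shows "corner_filling a h k B \<in> SYT (corner a h k)" "leg_set k (corner_filling a h k B) = B"
proof -
  let ?n = "h - a + k" and ?T = "corner_filling a h k B" and ?R = "{1..h - a + k} - B"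
  have fin: "finite B" "finite ?R" using B finite_subset by auto
  have cR: "card ?R = h - a" using B fin by (simp add: card_Diff_subset)
  let ?b = "sorted_list_of_set B" and ?r = "sorted_list_of_set ?R"
  have len: "length ?b = k" "length ?r = h - a" using B cR by auto
  have Tr: "?T (0, j) = ?r ! (j - a)" if "a \<le> j" "j < h" for j
    using that by (auto simp: corner_filling_def corner_def)
  have Tb: "?T (i, 0) = ?b ! (i - 1)" if "1 \<le> i" "i \<le> k" for i
    using that by (auto simp: corner_filling_def corner_def)
  have leg: "leg_set k ?T = B"
  proof -
    have "leg_set k ?T = (\<lambda>i. ?b ! (i - 1)) ` {1..k}" unfolding leg_set_def using Tb by (intro image_cong) auto
    also have "\<dots> = (\<lambda>i. ?b ! i) ` {..<k}"
    proof -
      have "{..<k} = (\<lambda>i. i - 1) ` {1..k}"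
      proof (intro equalityI subsetI)
        fix i assume "i \<in> {..<k}"
        then show "i \<in> (\<lambda>i. i - 1) ` {1..k}" by (intro image_eqI[of _ _ "Suc i"]) simp_all
      qed auto
      then show ?thesis by (simp add: image_image)
    qed
    also have "\<dots> = set ?b" using len nth_image[of "length ?b" ?b] by (simp add: lessThan_atLeast0)
    finally show ?thesis using fin by simp
  qed
  then show "leg_set k ?T = B" .
  have arm: "(\<lambda>j. ?T (0, j)) ` {a..<h} = ?R"
  proof -
    have "(\<lambda>j. ?T (0, j)) ` {a..<h} = (\<lambda>j. ?r ! (j - a)) ` {a..<h}" using Tr by (intro image_cong) auto
    also have "\<dots> = (\<lambda>i. ?r ! i) ` {..<h - a}"
    proof -
      have "{..<h - a} = (\<lambda>j. j - a) ` {a..<h}"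
      proof (intro equalityI subsetI)
        fix j assume "j \<in> {..<h - a}"
        then show "j \<in> (\<lambda>j. j - a) ` {a..<h}" by (intro image_eqI[of _ _ "j + a"]) auto
      qed auto
      then show ?thesis by (simp add: image_image)
    qed
    also have "\<dots> = set ?r" using len nth_image[of "length ?r" ?r] by (simp add: lessThan_atLeast0)
    finally show ?thesis using fin by simp
  qed
  have C: "corner a h k = (\<lambda>j. (0, j)) ` {a..<h} \<union> (\<lambda>i. (i, 0)) ` {1..k}" by (auto simp: corner_def)
  have im: "?T ` corner a h k = {1..?n}"
  proof -
    have "?T ` corner a h k = (\<lambda>j. ?T (0, j)) ` {a..<h} \<union> leg_set k ?T" unfolding C leg_set_def by (simp add: image_Un image_image)
    also have "\<dots> = {1..?n}" unfolding arm leg using B by auto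
    finally show ?thesis .
  qed
  have finC: "finite (corner a h k)" unfolding C by simp
  have "inj_on ?T (corner a h k)"
    using im card_corner[OF ah(1), of k] finC by (intro eq_card_imp_inj_on) auto
  then have bij: "bij_betw ?T (corner a h k) {1..card (corner a h k)}"
    using im card_corner[OF ah(1), of k] by (simp add: bij_betw_def)
  moreover have "?T c = 0" if "c \<notin> corner a h k" for c
    using that by (cases c) (auto simp: corner_filling_def)
  moreover have "?T (i, j) < ?T (i', j')"
    if c: "(i, j) \<in> corner a h k" "(i', j') \<in> corner a h k" "i = i' \<and> j < j' \<or> j = j' \<and> i < i'" for i j i' j'
  proof -
    consider (row) "i = 0" "i' = 0" "a \<le> j" "j < j'" "j' < h" | (col) "j = 0" "j' = 0" "1 \<le> i" "i < i'" "i' \<le> k"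
      | (bend) "j = 0" "j' = 0" "i = 0" "a = 0" "1 \<le> i'" "i' \<le> k"
      using c by (auto simp: corner_def)
    then show ?thesis
    proof cases
      case row
      then show ?thesis using Tr[of j] Tr[of j'] sorted_list_of_set_strict_mono[OF fin(2), of "j - a" "j' - a"] cR by auto
    next
      case col
      then show ?thesis using Tb[of i] Tb[of i'] sorted_list_of_set_strict_mono[OF fin(1), of "i - 1" "i' - 1"] B by auto
    next
      \<comment> \<open>Only in a hook does the corner cell have the leg below it. There 1 belongs
        to the arm and, being smallest, sits in the corner, so all leg labels exceed it.\<close>
      case bend
      have h: "1 \<le> h" "1 \<notin> B" using one bend by auto
      then have "1 \<in> ?R" using bend by auto
      then have "1 \<in> (\<lambda>j. ?T (0, j)) ` {a..<h}" unfolding arm .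
      then obtain j0 where j0: "j0 \<in> {a..<h}" "?T (0, j0) = 1" by (elim imageE) simp
      have "?T (0, 0) = 1"
      proof (cases "j0 = 0")
        case False
        then have "?T (0, 0) < ?T (0, j0)"
          using Tr[of 0] Tr[of j0] j0 bend h sorted_list_of_set_strict_mono[OF fin(2), of 0 j0] cR by auto
        then have "?T (0, 0) < 1" using j0 by simp
        moreover have "?T (0, 0) \<in> ?R" unfolding arm[symmetric] using bend h by (intro imageI) simp
        ultimately show ?thesis by auto
      qed (use j0 in simp)
      moreover have "?T (i', 0) \<in> leg_set k ?T" unfolding leg_set_def using bend by (intro imageI) simp
      then have "?T (i', 0) \<in> B" unfolding leg .
      then have "?T (i', 0) \<in> {1..?n}" "?T (i', 0) \<noteq> 1" using B h by (auto dest: subsetD)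
      then have "1 < ?T (i', 0)" by simp
      ultimately show ?thesis using bend by simp
    qed
  qed
  ultimately show "?T \<in> SYT (corner a h k)" unfolding SYT_def by blast
qed

lemma SYT_corner_leg:
  assumes ah: "a \<le> h" and T: "T \<in> SYT (corner a h k)"
  shows "leg_set k T \<subseteq> {1..h - a + k}" "card (leg_set k T) = k" "T = corner_filling a h k (leg_set k T)"
proof -
  let ?n = "h - a + k" and ?B = "leg_set k T"
  have C: "corner a h k = (\<lambda>j. (0, j)) ` {a..<h} \<union> (\<lambda>i. (i, 0)) ` {1..k}" by (auto simp: corner_def)
  have bij: "bij_betw T (corner a h k) {1..?n}" using T card_corner[OF ah, of k] by (simp add: SYT_def)
  have im: "T ` corner a h k = {1..?n}" "inj_on T (corner a h k)" using bij by (auto simp: bij_betw_def)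
  have un: "(\<lambda>j. T (0, j)) ` {a..<h} \<union> ?B = {1..?n}"
    unfolding im(1)[symmetric] C leg_set_def by (simp add: image_Un image_image)
  then show sub: "?B \<subseteq> {1..?n}" by blast
  have col: "T (i, 0) < T (i', 0)" if "1 \<le> i" "i < i'" "i' \<le> k" for i i'
    using T that unfolding SYT_def by (auto simp: corner_def)
  have row: "T (0, j) < T (0, j')" if "a \<le> j" "j < j'" "j' < h" for j j'
    using T that unfolding SYT_def by (auto simp: corner_def)
  have injB: "inj_on (\<lambda>i. T (i, 0)) {1..k}"
    using col by (intro inj_onI) (metis atLeastAtMost_iff linorder_neqE_nat less_irrefl)
  then show cB: "card ?B = k" unfolding leg_set_def by (simp add: card_image)
  have dj: "(\<lambda>j. T (0, j)) ` {a..<h} \<inter> ?B = {}"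
  proof (rule ccontr)
    assume "\<not> ?thesis"
    then obtain j i where "j \<in> {a..<h}" "i \<in> {1..k}" "T (0, j) = T (i, 0)" unfolding leg_set_def by blast
    moreover have "(0, j) \<in> corner a h k" "(i, 0) \<in> corner a h k" using calculation by (auto simp: corner_def)
    ultimately have "(0, j) = (i, 0)" using im(2) by (meson inj_onD)
    then show False using \<open>i \<in> {1..k}\<close> by simp
  qed
  have b: "sorted_list_of_set ?B = map (\<lambda>i. T (Suc i, 0)) [0..<k]"
  proof -
    have "sorted_wrt (<) (map (\<lambda>i. T (Suc i, 0)) [0..<k])" using col by (auto simp: sorted_wrt_iff_nth_less)
    moreover have "set (map (\<lambda>i. T (Suc i, 0)) [0..<k]) = ?B"
    proof -
      have "{1..k} = Suc ` {0..<k}" by (metis One_nat_def atLeastLessThanSuc_atLeastAtMost image_Suc_atLeastLessThan)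
      then show ?thesis unfolding leg_set_def by (simp only: image_image set_map set_upt)
    qed
    ultimately show ?thesis by (metis sorted_list_of_set.idem_if_sorted_distinct strict_sorted_iff)
  qed
  have r: "sorted_list_of_set ({1..?n} - ?B) = map (\<lambda>j. T (0, j)) [a..<h]"
  proof -
    have "sorted_wrt (<) (map (\<lambda>j. T (0, j)) [a..<h])" using row by (auto simp: sorted_wrt_iff_nth_less)
    moreover have "set (map (\<lambda>j. T (0, j)) [a..<h]) = {1..?n} - ?B" using un dj by auto
    ultimately show ?thesis by (metis sorted_list_of_set.idem_if_sorted_distinct strict_sorted_iff)
  qed
  show "T = corner_filling a h k ?B"
  proof
    fix c :: "nat \<times> nat"
    obtain i j where c: "c = (i, j)" by (metis prod.exhaust)
    show "T c = corner_filling a h k ?B c"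
    proof (cases "(i, j) \<in> corner a h k")
      case False
      then show ?thesis using T SYT_zero c by (simp add: corner_filling_def)
    next
      case True
      then show ?thesis unfolding c corner_filling_def using b r by (auto simp: corner_def)
    qed
  qed
qed

text \<open>The label just before a leg label is either in the arm, which is the top row, or higher
  up in the leg. Nothing lies above the arm, so no descent leads into it.\<close>

lemma Des_corner:
  assumes C: "convex_cells (corner a h k)" and ah: "a \<le> h" and T: "T \<in> SYT (corner a h k)"
  shows "Des_SYT (corner a h k) T = {d \<in> {1..h - a + k - 1}. Suc d \<in> leg_set k T}"
proof -
  interpret convex_cells "corner a h k" by (rule C)
  have n: "card (corner a h k) = h - a + k" using card_corner[OF ah] .
  note F = SYT_filling[OF T]
  have leg: "v \<in> leg_set k T \<longleftrightarrow> fst (cell T v) \<noteq> 0" if "v \<in> {1..h - a + k}" for v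
  proof -
    have v: "cell T v \<in> corner a h k" "T (cell T v) = v" using cell_in[OF F] label_cell[OF F] that n by auto
    show ?thesis
    proof
      assume "v \<in> leg_set k T"
      then obtain i where i: "1 \<le> i" "i \<le> k" "v = T (i, 0)" unfolding leg_set_def by auto
      then have "cell T v = (i, 0)" using cell_eqI[OF F, of "(i, 0)" v] by (auto simp: corner_def)
      then show "fst (cell T v) \<noteq> 0" using i by simp
    next
      assume "fst (cell T v) \<noteq> 0"
      then obtain i where "cell T v = (i, 0)" "1 \<le> i" "i \<le> k" using v(1) by (auto simp: corner_def)
      then show "v \<in> leg_set k T" using v(2) unfolding leg_set_def by (metis atLeastAtMost_iff image_eqI)
    qed
  qed
  have "d \<in> Des_SYT (corner a h k) T \<longleftrightarrow> Suc d \<in> leg_set k T" if d: "d \<in> {1..h - a + k - 1}" for d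
  proof -
    have d1: "1 \<le> d" "d < card (corner a h k)" using d n by auto
    have "Suc d \<in> leg_set k T \<longleftrightarrow> fst (cell T (Suc d)) \<noteq> 0" using leg d by auto
    also have "\<dots> \<longleftrightarrow> fst (cell T d) < fst (cell T (Suc d))"
    proof
      assume nz: "fst (cell T (Suc d)) \<noteq> 0"
      have c: "cell T (Suc d) \<in> corner a h k" using cell_in[OF F] d1 by auto
      then have s0: "snd (cell T (Suc d)) = 0" using nz by (auto simp: corner_def)
      show "fst (cell T d) < fst (cell T (Suc d))"
        using T d1
      proof (cases rule: SYT_adjacent_cases)
        case row
        have "cell T d \<in> corner a h k" using cell_in[OF F] d1 by auto
        then have "snd (cell T d) = 0" using row(1) nz by (auto simp: corner_def)
        then show ?thesis using row s0 by (simp add: axial_def content_def)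
      qed (use s0 in auto)
    qed simp
    finally show ?thesis using Des_iff[OF T d1] by simp
  qed
  moreover have "Des_SYT (corner a h k) T \<subseteq> {1..h - a + k - 1}" using Des_subset[of T] n by simp
  ultimately show ?thesis by blast
qed

lemma card_SYT_corner:
  assumes C: "convex_cells (corner a h k)" and ah: "a \<le> h" "a \<le> 1" and h1: "a = 0 \<Longrightarrow> 1 \<le> h"
  shows "card {T \<in> SYT (corner a h k). Des_SYT (corner a h k) T = D} =
    card {B. B \<subseteq> {1..h - a + k} \<and> card B = k \<and> (a = 0 \<longrightarrow> 1 \<notin> B) \<and> {d \<in> {1..h - a + k - 1}. Suc d \<in> B} = D}"
proof -
  let ?C = "corner a h k"
  have "bij_betw (leg_set k) {T \<in> SYT ?C. Des_SYT ?C T = D}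
    {B. B \<subseteq> {1..h - a + k} \<and> card B = k \<and> (a = 0 \<longrightarrow> 1 \<notin> B) \<and> {d \<in> {1..h - a + k - 1}. Suc d \<in> B} = D}"
  proof (rule bij_betw_byWitness[of _ "corner_filling a h k"])
    show "\<forall>T\<in>{T \<in> SYT ?C. Des_SYT ?C T = D}. corner_filling a h k (leg_set k T) = T"
      using SYT_corner_leg(3)[OF ah(1)] by auto
    show "\<forall>B\<in>{B. B \<subseteq> {1..h - a + k} \<and> card B = k \<and> (a = 0 \<longrightarrow> 1 \<notin> B) \<and> {d \<in> {1..h - a + k - 1}. Suc d \<in> B} = D}.
      leg_set k (corner_filling a h k B) = B"
      using corner_filling_SYT(2)[OF ah] h1 by blast
    show "leg_set k ` {T \<in> SYT ?C. Des_SYT ?C T = D} \<subseteq> {B. B \<subseteq> {1..h - a + k} \<and> card B = k \<and> (a = 0 \<longrightarrow> 1 \<notin> B) \<and> {d \<in> {1..h - a + k - 1}. Suc d \<in> B} = D}"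
    proof (rule image_subsetI)
      fix T assume "T \<in> {T \<in> SYT ?C. Des_SYT ?C T = D}"
      then have T: "T \<in> SYT ?C" "Des_SYT ?C T = D" by auto
      have "1 \<notin> leg_set k T" if "a = 0"
      proof
        assume "1 \<in> leg_set k T"
        then obtain i where i: "1 \<le> i" "i \<le> k" "T (i, 0) = 1" unfolding leg_set_def by auto
        have c: "(0, 0) \<in> ?C" "(i, 0) \<in> ?C" using that h1 i by (auto simp: corner_def)
        then have "T (0, 0) < T (i, 0)" using convex_cells.SYT_col[OF C T(1) c] i by simp
        then have "T (0, 0) = 0" using i by simp
        moreover have "bij_betw T ?C {1..card ?C}" using T(1) by (simp add: SYT_def)
        ultimately show False using bij_betw_apply[OF _ c(1), of T "{1..card ?C}"] by auto
      qed
      then show "leg_set k T \<in> {B. B \<subseteq> {1..h - a + k} \<and> card B = k \<and> (a = 0 \<longrightarrow> 1 \<notin> B) \<and> {d \<in> {1..h - a + k - 1}. Suc d \<in> B} = D}"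
        using SYT_corner_leg(1,2)[OF ah(1) T(1)] Des_corner[OF C ah(1) T(1)] T(2) by auto
    qed
    show "corner_filling a h k ` {B. B \<subseteq> {1..h - a + k} \<and> card B = k \<and> (a = 0 \<longrightarrow> 1 \<notin> B) \<and> {d \<in> {1..h - a + k - 1}. Suc d \<in> B} = D}
      \<subseteq> {T \<in> SYT ?C. Des_SYT ?C T = D}"
    proof (rule image_subsetI)
      fix B assume "B \<in> {B. B \<subseteq> {1..h - a + k} \<and> card B = k \<and> (a = 0 \<longrightarrow> 1 \<notin> B) \<and> {d \<in> {1..h - a + k - 1}. Suc d \<in> B} = D}"
      then have B: "B \<subseteq> {1..h - a + k}" "card B = k" "a = 0 \<Longrightarrow> 1 \<notin> B" "{d \<in> {1..h - a + k - 1}. Suc d \<in> B} = D" by auto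
      have one: "a = 0 \<Longrightarrow> 1 \<le> h \<and> 1 \<notin> B" using h1 B(3) by blast
      note f = corner_filling_SYT[OF ah B(1,2) one]
      have "Des_SYT ?C (corner_filling a h k B) = D" using Des_corner[OF C ah(1) f(1)] f(2) B(4) by simp
      then show "corner_filling a h k B \<in> {T \<in> SYT ?C. Des_SYT ?C T = D}" using f(1) by blast
    qed
  qed
  then show ?thesis by (rule bij_betw_same_card)
qed

text \<open>Descents do not see whether 1 is in the leg. A hook forbids it and the disconnected
  shape allows it; this one bit is the source of the two summands in
  \<open>card_SYT_row_column\<close>.\<close>

lemma Suc_image_descents:
  assumes "n \<ge> 1" "B \<subseteq> {1..n}"
  shows "{d \<in> {1..n - 1}. Suc d \<in> B} = D \<longleftrightarrow> D \<subseteq> {1..n - 1} \<and> (B = Suc ` D \<or> B = insert 1 (Suc ` D))"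
proof
  assume e: "{d \<in> {1..n - 1}. Suc d \<in> B} = D"
  have "B - {1} = Suc ` D"
  proof (intro equalityI subsetI)
    fix b assume b: "b \<in> B - {1}"
    then have "1 \<le> b" "b \<le> n" "b \<noteq> 1" using assms by auto
    then obtain d where "b = Suc d" "1 \<le> d" "d \<le> n - 1" by (cases b) auto
    then show "b \<in> Suc ` D" using b e by auto
  next
    fix b assume "b \<in> Suc ` D"
    then show "b \<in> B - {1}" using e by auto
  qed
  then show "D \<subseteq> {1..n - 1} \<and> (B = Suc ` D \<or> B = insert 1 (Suc ` D))" using e by blast
next
  assume h: "D \<subseteq> {1..n - 1} \<and> (B = Suc ` D \<or> B = insert 1 (Suc ` D))"
  then have "Suc d \<in> B \<longleftrightarrow> d \<in> D" if "1 \<le> d" for d using that by auto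
  then show "{d \<in> {1..n - 1}. Suc d \<in> B} = D" using h by auto
qed

lemma card_SYT_hook:
  assumes C: "convex_cells (corner 0 h k)" and h: "h \<ge> 1" and D: "D \<subseteq> {1..h + k - 1}"
  shows "card {T \<in> SYT (corner 0 h k). Des_SYT (corner 0 h k) T = D} = (if card D = k then 1 else 0)"
proof -
  have s: "Suc ` D \<subseteq> {1..h + k}" "1 \<notin> Suc ` D" using D h by force+
  have c: "card (Suc ` D) = card D" by (simp add: card_image)
  have "{B. B \<subseteq> {1..h - 0 + k} \<and> card B = k \<and> (0 = (0::nat) \<longrightarrow> 1 \<notin> B) \<and> {d \<in> {1..h - 0 + k - 1}. Suc d \<in> B} = D}
    = (if card D = k then {Suc ` D} else {})"
    using Suc_image_descents[of "h + k" _ D] s c D h by auto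
  then show ?thesis using card_SYT_corner[OF C, of D] h by simp
qed

lemma card_SYT_row_column:
  assumes C: "convex_cells (corner 1 h k)" and h: "h \<ge> 1" and n: "n = h - 1 + k" "n \<ge> 1" and D: "D \<subseteq> {1..n - 1}"
  shows "card {T \<in> SYT (corner 1 h k). Des_SYT (corner 1 h k) T = D} =
    (if card D = k then 1 else 0) + (if Suc (card D) = k then 1 else 0)"
proof -
  have finD: "finite D" using D finite_subset by blast
  have s: "Suc ` D \<subseteq> {1..n}" "1 \<notin> Suc ` D" using D n(2) by force+
  have c: "card (Suc ` D) = card D" "card (insert 1 (Suc ` D)) = Suc (card D)"
    using s(2) finD by (simp_all add: card_image)
  have "{B. B \<subseteq> {1..n} \<and> card B = k \<and> (1 = (0::nat) \<longrightarrow> 1 \<notin> B) \<and> {d \<in> {1..n - 1}. Suc d \<in> B} = D}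
    = (if card D = k then {Suc ` D} else {}) \<union> (if Suc (card D) = k then {insert 1 (Suc ` D)} else {})"
    (is "?L = ?R")
  proof (intro set_eqI)
    fix B
    show "B \<in> ?L \<longleftrightarrow> B \<in> ?R"
    proof (cases "B \<subseteq> {1..n}")
      case True
      then show ?thesis using Suc_image_descents[OF n(2) True, of D] s c D by auto
    next
      case False
      then show ?thesis using s n(2) by auto
    qed
  qed
  then show ?thesis using card_SYT_corner[OF C, of D] h n by auto
qed

section \<open>Cyclic Schur-positivity\<close>

lemma cDes_perm_subset: "cDes_perm n \<pi> \<subseteq> {1..n}"
  by (auto simp: cDes_perm_def)

lemma cDes_perm_Des:
  assumes "n \<ge> 1"
  shows "cDes_perm n \<pi> - {n} = Des_perm n \<pi>"
  using assms by (auto simp: cDes_perm_def Des_perm_def)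

text \<open>The position of the value \<open>n\<close> is always a cyclic descent and that of the
  value 1 never is; \<open>n \<ge> 2\<close> makes every cyclic successor a different
  position.\<close>

lemma cDes_perm_proper:
  assumes n: "n \<ge> 2" and \<pi>: "\<pi> permutes {1..n}"
  shows "cDes_perm n \<pi> \<noteq> {}" "cDes_perm n \<pi> \<noteq> {1..n}"
proof -
  define nx where "nx i = (if i = n then 1 else i + 1)" for i
  have nx: "nx i \<in> {1..n}" "nx i \<noteq> i" if "i \<in> {1..n}" for i using that n by (auto simp: nx_def)
  have img: "\<pi> ` {1..n} = {1..n}" using permutes_image[OF \<pi>] .
  have inj: "\<pi> i \<noteq> \<pi> j" if "i \<noteq> j" for i j using permutes_inj[OF \<pi>] that by (auto simp: inj_def)
  have rng: "\<pi> i \<in> {1..n}" if "i \<in> {1..n}" for i using img that by blast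
  have "n \<in> \<pi> ` {1..n}" "1 \<in> \<pi> ` {1..n}" unfolding img using n by auto
  then obtain i j where i: "i \<in> {1..n}" "\<pi> i = n" and j: "j \<in> {1..n}" "\<pi> j = 1" by (metis imageE)
  have "\<pi> (nx i) < \<pi> i" using rng[OF nx(1)[OF i(1)]] inj[OF nx(2)[OF i(1)]] i(2) by auto
  then have "i \<in> cDes_perm n \<pi>" using i(1) unfolding cDes_perm_def nx_def by simp
  then show "cDes_perm n \<pi> \<noteq> {}" by blast
  have "\<not> \<pi> (nx j) < \<pi> j" using rng[OF nx(1)[OF j(1)]] j(2) by auto
  then have "j \<notin> cDes_perm n \<pi>" unfolding cDes_perm_def nx_def by simp
  then show "cDes_perm n \<pi> \<noteq> {1..n}" using j(1) by blast
qed

lemma card_Des_perm_split: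
  assumes "finite A" "n \<ge> 1" "D \<subseteq> {1..n - 1}"
  shows "card {\<pi> \<in> A. Des_perm n \<pi> = D} = card {\<pi> \<in> A. cDes_perm n \<pi> = D} + card {\<pi> \<in> A. cDes_perm n \<pi> = insert n D}"
proof -
  have nD: "n \<notin> D" using assms(2,3) by auto
  have "Des_perm n \<pi> = D \<longleftrightarrow> cDes_perm n \<pi> = D \<or> cDes_perm n \<pi> = insert n D" for \<pi>
    unfolding cDes_perm_Des[OF assms(2), symmetric] using nD by blast
  then have "{\<pi> \<in> A. Des_perm n \<pi> = D} = {\<pi> \<in> A. cDes_perm n \<pi> = D} \<union> {\<pi> \<in> A. cDes_perm n \<pi> = insert n D}" by blast
  moreover have "{\<pi> \<in> A. cDes_perm n \<pi> = D} \<inter> {\<pi> \<in> A. cDes_perm n \<pi> = insert n D} = {}" using nD by blast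
  ultimately show ?thesis using assms(1) by (simp add: card_Un_disjoint)
qed

lemma cDes_invariant_iff:
  assumes "finite A" "n \<ge> 1"
  shows "cDes_invariant n A \<longleftrightarrow>
    (\<forall>J\<subseteq>{1..n}. card {\<pi> \<in> A. cDes_perm n \<pi> = cshift n J} = card {\<pi> \<in> A. cDes_perm n \<pi> = J})"
proof
  assume "cDes_invariant n A"
  then obtain \<psi> where \<psi>: "bij_betw \<psi> A A" "\<And>\<pi>. \<pi> \<in> A \<Longrightarrow> cDes_perm n (\<psi> \<pi>) = cshift n (cDes_perm n \<pi>)"
    unfolding cDes_invariant_def by blast
  show "\<forall>J\<subseteq>{1..n}. card {\<pi> \<in> A. cDes_perm n \<pi> = cshift n J} = card {\<pi> \<in> A. cDes_perm n \<pi> = J}"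
  proof (intro allI impI)
    fix J assume J: "J \<subseteq> {1..n}"
    have iff: "cDes_perm n (\<psi> \<pi>) = cshift n J \<longleftrightarrow> cDes_perm n \<pi> = J" if "\<pi> \<in> A" for \<pi>
      using \<psi>(2)[OF that] cshift_inj[OF assms(2)] J cDes_perm_subset[of n \<pi>] by (auto simp: inj_on_def)
    have "{\<pi> \<in> A. cDes_perm n \<pi> = cshift n J} = \<psi> ` {\<pi> \<in> A. cDes_perm n \<pi> = J}"
    proof (intro equalityI subsetI)
      fix \<pi> assume p: "\<pi> \<in> {\<pi> \<in> A. cDes_perm n \<pi> = cshift n J}"
      then obtain \<rho> where r: "\<rho> \<in> A" "\<pi> = \<psi> \<rho>" using \<psi>(1) unfolding bij_betw_def by blast
      then show "\<pi> \<in> \<psi> ` {\<pi> \<in> A. cDes_perm n \<pi> = J}" using p iff[OF r(1)] by blast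
    next
      fix \<pi> assume "\<pi> \<in> \<psi> ` {\<pi> \<in> A. cDes_perm n \<pi> = J}"
      then obtain \<rho> where r: "\<rho> \<in> A" "cDes_perm n \<rho> = J" "\<pi> = \<psi> \<rho>" by blast
      then show "\<pi> \<in> {\<pi> \<in> A. cDes_perm n \<pi> = cshift n J}"
        using iff[OF r(1)] \<psi>(1) unfolding bij_betw_def by blast
    qed
    moreover have "inj_on \<psi> {\<pi> \<in> A. cDes_perm n \<pi> = J}"
      using bij_betw_imp_inj_on[OF \<psi>(1)] by (rule inj_on_subset) blast
    ultimately show "card {\<pi> \<in> A. cDes_perm n \<pi> = cshift n J} = card {\<pi> \<in> A. cDes_perm n \<pi> = J}"
      by (simp only: card_image)
  qed
next
  assume "\<forall>J\<subseteq>{1..n}. card {\<pi> \<in> A. cDes_perm n \<pi> = cshift n J} = card {\<pi> \<in> A. cDes_perm n \<pi> = J}"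
  then show "cDes_invariant n A" unfolding cDes_invariant_def
    using cDes_perm_subset cshift_inj[OF assms(2)]
    by (intro fiberwise_bijection[OF assms(1), of _ "Pow {1..n}"]) auto
qed

lemma cyclic_descent_ext_shift:
  assumes ext: "cyclic_descent_ext C cD \<psi>" and n: "card C = n" "n \<ge> 1" and J: "J \<subseteq> {1..n}"
  shows "card {T \<in> SYT C. cD T = cshift n J} = card {T \<in> SYT C. cD T = J}"
proof -
  have \<psi>: "bij_betw \<psi> (SYT C) (SYT C)"
    and cD: "\<And>T. T \<in> SYT C \<Longrightarrow> cD T \<subseteq> {1..n}" "\<And>T. T \<in> SYT C \<Longrightarrow> cD (\<psi> T) = cshift n (cD T)"
    using ext unfolding cyclic_descent_ext_def n(1) by blast+
  have iff: "cD (\<psi> T) = cshift n J \<longleftrightarrow> cD T = J" if "T \<in> SYT C" for T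
    using cD(2)[OF that] cshift_inj[OF n(2)] J cD(1)[OF that] by (auto simp: inj_on_def)
  have "{T \<in> SYT C. cD T = cshift n J} = \<psi> ` {T \<in> SYT C. cD T = J}"
  proof (intro equalityI subsetI)
    fix T assume p: "T \<in> {T \<in> SYT C. cD T = cshift n J}"
    then obtain S where r: "S \<in> SYT C" "T = \<psi> S" using \<psi> unfolding bij_betw_def by blast
    then show "T \<in> \<psi> ` {T \<in> SYT C. cD T = J}" using p iff[OF r(1)] by blast
  next
    fix T assume "T \<in> \<psi> ` {T \<in> SYT C. cD T = J}"
    then obtain S where r: "S \<in> SYT C" "cD S = J" "T = \<psi> S" by blast
    then show "T \<in> {T \<in> SYT C. cD T = cshift n J}" using iff[OF r(1)] \<psi> unfolding bij_betw_def by blast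
  qed
  moreover have "inj_on \<psi> {T \<in> SYT C. cD T = J}"
    using bij_betw_imp_inj_on[OF \<psi>] by (rule inj_on_subset) blast
  ultimately show ?thesis by (simp only: card_image)
qed

lemma cyclic_descent_ext_split:
  assumes C: "finite (SYT C)" and ext: "cyclic_descent_ext C cD \<psi>" and n: "card C = n" "n \<ge> 1" and D: "D \<subseteq> {1..n - 1}"
  shows "card {T \<in> SYT C. cD T = D} + card {T \<in> SYT C. cD T = insert n D} = card {T \<in> SYT C. Des_SYT C T = D}"
proof -
  have cD: "cD T \<subseteq> {1..n}" "cD T \<inter> {1..n - 1} = Des_SYT C T" if "T \<in> SYT C" for T
    using ext that unfolding cyclic_descent_ext_def n(1) by blast+
  have nD: "n \<notin> D" "{1..n} = insert n {1..n - 1}" "n \<notin> {1..n - 1}" using D n(2) by auto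
  have "Des_SYT C T = D \<longleftrightarrow> cD T = D \<or> cD T = insert n D" if "T \<in> SYT C" for T
  proof -
    have sub: "cD T \<subseteq> insert n {1..n - 1}" using cD(1)[OF that] unfolding nD(2) .
    have "X \<inter> Y = D \<longleftrightarrow> X = D \<or> X = insert n D" if "X \<subseteq> insert n Y" "n \<notin> Y" "D \<subseteq> Y" for X Y :: "nat set"
      using that by blast
    from this[OF sub nD(3) D] show ?thesis unfolding cD(2)[OF that] .
  qed
  then have "{T \<in> SYT C. Des_SYT C T = D} = {T \<in> SYT C. cD T = D} \<union> {T \<in> SYT C. cD T = insert n D}" by blast
  moreover have "{T \<in> SYT C. cD T = D} \<inter> {T \<in> SYT C. cD T = insert n D} = {}" using nD by blast
  moreover have "finite {T \<in> SYT C. cD T = D}" "finite {T \<in> SYT C. cD T = insert n D}" using C by simp_all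
  ultimately show ?thesis by (simp only: card_Un_disjoint)
qed

lemma skew_multiset_decomposition:
  assumes "\<forall>s\<in>#S. valid_skew s \<and> card (cells s) = n"
  shows "\<exists>c :: nat list \<Rightarrow> nat. \<forall>D. (\<Sum>s\<in>#S. card {T \<in> SYT (cells s). Des_SYT (cells s) T = D}) =
    (\<Sum>la\<in>partitions_of n. c la * des_count la D)"
  using assms
proof (induction S)
  case empty
  then show ?case by (intro exI[of _ "\<lambda>_. 0"]) simp
next
  case (add s S)
  then obtain c where c: "\<And>D. (\<Sum>s\<in>#S. card {T \<in> SYT (cells s). Des_SYT (cells s) T = D}) =
    (\<Sum>la\<in>partitions_of n. c la * des_count la D)" by auto
  interpret convex_cells "cells s" using convex_cells_skew add.prems by simp
  have n: "card (cells s) = n" using add.prems by simp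
  obtain c' where c': "\<And>D. card {T \<in> SYT (cells s). Des_SYT (cells s) T = D} = (\<Sum>la\<in>partitions_of n. c' la * des_count la D)"
    by (rule skew_des_decomposition[unfolded n, folded des_count_def]) blast
  show ?case
    by (intro exI[of _ "\<lambda>la. c' la + c la"]) (simp add: c c' sum.distrib distrib_right)
qed

text \<open>Rotation invariance passes from each shape to the sum of counts. Adding the counts for
  \<open>D\<close> and \<open>insert n D\<close> forgets the cyclic information, and what remains
  are descent counts of skew shapes, which expand in straight ones.\<close>

lemma cyclic_schur_positive_imp:
  assumes n: "n \<ge> 2" and A: "A \<subseteq> {\<pi>. \<pi> permutes {1..n}}" and c: "cyclic_schur_positive n A"
  shows "schur_positive n A" "cDes_invariant n A"
proof -
  have fin: "finite A" using A finite_permutations[of "{1..n}"] finite_subset by auto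
  have n1: "n \<ge> 1" using n by simp
  obtain S cD \<psi> where S: "\<forall>s\<in>#S. valid_skew s \<and> card (cells s) = n \<and> \<not> connected_ribbon (cells s)"
    and ext: "\<forall>s\<in>#S. cyclic_descent_ext (cells s) (cD s) (\<psi> s)"
    and eq: "\<forall>J. card {\<pi>\<in>A. cDes_perm n \<pi> = J} = (\<Sum>s\<in>#S. card {T\<in>SYT (cells s). cD s T = J})"
    using c unfolding cyclic_schur_positive_def by blast
  have "card {\<pi> \<in> A. cDes_perm n \<pi> = cshift n J} = card {\<pi> \<in> A. cDes_perm n \<pi> = J}" if J: "J \<subseteq> {1..n}" for J
  proof -
    have "(\<Sum>s\<in>#S. card {T\<in>SYT (cells s). cD s T = cshift n J}) = (\<Sum>s\<in>#S. card {T\<in>SYT (cells s). cD s T = J})"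
    proof (intro arg_cong[of _ _ sum_mset] image_mset_cong)
      fix s assume s: "s \<in># S"
      show "card {T\<in>SYT (cells s). cD s T = cshift n J} = card {T\<in>SYT (cells s). cD s T = J}"
        using cyclic_descent_ext_shift[OF _ _ n1 J] s S ext by blast
    qed
    then show ?thesis using eq by simp
  qed
  then show "cDes_invariant n A" using cDes_invariant_iff[OF fin n1] by blast
  have "\<forall>s\<in>#S. valid_skew s \<and> card (cells s) = n" using S by blast
  then obtain c where c: "\<And>D. (\<Sum>s\<in>#S. card {T \<in> SYT (cells s). Des_SYT (cells s) T = D}) =
    (\<Sum>la\<in>partitions_of n. c la * des_count la D)" using skew_multiset_decomposition by blast
  show "schur_positive n A"
  proof (rule schur_positiveI[OF fin])
    fix D assume D: "D \<subseteq> {1..n - 1}"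
    have "card {\<pi> \<in> A. Des_perm n \<pi> = D} =
      (\<Sum>s\<in>#S. card {T\<in>SYT (cells s). cD s T = D}) + (\<Sum>s\<in>#S. card {T\<in>SYT (cells s). cD s T = insert n D})"
      using card_Des_perm_split[OF fin n1 D] eq by simp
    also have "\<dots> = (\<Sum>s\<in>#S. card {T\<in>SYT (cells s). cD s T = D} + card {T\<in>SYT (cells s). cD s T = insert n D})"
      by (simp add: sum_mset.distrib)
    also have "\<dots> = (\<Sum>s\<in>#S. card {T \<in> SYT (cells s). Des_SYT (cells s) T = D})"
    proof (intro arg_cong[of _ _ sum_mset] image_mset_cong)
      fix s assume s: "s \<in># S"
      have "convex_cells (cells s)" using convex_cells_skew S s by blast
      then have f: "finite (SYT (cells s))" by (rule convex_cells.finite_SYT)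
      show "card {T\<in>SYT (cells s). cD s T = D} + card {T\<in>SYT (cells s). cD s T = insert n D} = card {T \<in> SYT (cells s). Des_SYT (cells s) T = D}"
        using cyclic_descent_ext_split[OF f _ _ n1 D] s S ext by blast
    qed
    also have "\<dots> = (\<Sum>la\<in>partitions_of n. c la * des_count la D)" by (rule c)
    finally show "card {\<pi> \<in> A. Des_perm n \<pi> = D} = (\<Sum>la\<in>partitions_of n. c la * des_count la D)" .
  qed
qed

text \<open>A row of \<open>n - k\<close> cells and a column of \<open>k\<close> cells: the inner
  partition \<open>[1]\<close> removes the corner of a hook, which accounts for the
  \<open>+ 1\<close>.\<close>

definition row_column_shape :: "nat \<Rightarrow> nat \<Rightarrow> nat list \<times> nat list" where
  "row_column_shape n k = ((n - k + 1) # replicate k 1, [1])"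

lemma row_column_shape:
  assumes "1 \<le> k" "k < n"
  shows "valid_skew (row_column_shape n k)" "card (cells (row_column_shape n k)) = n"
    "\<not> connected_ribbon (cells (row_column_shape n k))"
proof -
  have C: "cells (row_column_shape n k) = corner 1 (n - k + 1) k"
    unfolding row_column_shape_def by (rule cells_corner)
  show "valid_skew (row_column_shape n k)"
    by (auto simp: row_column_shape_def valid_skew_def is_partition_def sorted_wrt_iff_nth_less nth_Cons')
  show "card (cells (row_column_shape n k)) = n" unfolding C using card_corner[of 1 "n - k + 1" k] assms by simp
  show "\<not> connected_ribbon (cells (row_column_shape n k))"
  proof
    let ?C = "corner 1 (n - k + 1) k"
    assume "connected_ribbon (cells (row_column_shape n k))"
    then have r: "\<forall>c\<in>?C. \<forall>d\<in>?C. (\<lambda>x y. x \<in> ?C \<and> y \<in> ?C \<and> adjacent_cells x y)\<^sup>*\<^sup>* c d"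
      unfolding connected_ribbon_def C by blast
    have "(0, 1) \<in> ?C" "(1, 0) \<in> ?C" using assms by (auto simp: corner_def)
    then have "(\<lambda>x y. x \<in> ?C \<and> y \<in> ?C \<and> adjacent_cells x y)\<^sup>*\<^sup>* (0, 1) (1, 0)" using r by blast
    then have "fst (1::nat, 0::nat) = 0"
    proof (induction rule: rtranclp_induct)
      case (step y z)
      then have "y \<in> ?C" "z \<in> ?C" "adjacent_cells y z" "fst y = 0" by auto
      then show ?case by (auto simp: corner_def adjacent_cells_def)
    qed simp
    then show False by simp
  qed
qed

text \<open>The cyclic distribution is uniform on the sets of size \<open>k\<close>. For a descent
  set \<open>D\<close> one of \<open>D\<close> and \<open>insert n D\<close> has size
  \<open>k\<close> exactly if \<open>card D\<close> is \<open>k\<close> or \<open>k - 1\<close>, in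
  agreement with \<open>card_SYT_row_column\<close>.\<close>

lemma row_column_ext:
  assumes k: "1 \<le> k" "k < n"
  shows "\<exists>cD \<psi>. cyclic_descent_ext (cells (row_column_shape n k)) cD \<psi> \<and>
    (\<forall>J. card {T \<in> SYT (cells (row_column_shape n k)). cD T = J} = (if J \<subseteq> {1..n} then (if card J = k then 1 else 0) else (0::nat)))"
proof (rule cyclic_descent_ext_exists[where m = "\<lambda>J. if card J = k then 1 else 0"])
  let ?C = "cells (row_column_shape n k)"
  show C: "convex_cells ?C" using convex_cells_skew row_column_shape[OF k] by blast
  show "card ?C = n" using row_column_shape[OF k] by blast
  show n1: "n \<ge> 1" using k by simp
  show "(if card (cshift n J) = k then 1 else 0) = (if card J = k then 1 else (0::nat))" if "J \<subseteq> {1..n}" for J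
  proof -
    have "card (cshift n J) = card J"
      unfolding cshift_def using next_bij[OF n1] that by (intro card_image) (auto simp: bij_betw_def intro: inj_on_subset)
    then show ?thesis by simp
  qed
  have e: "?C = corner 1 (n - k + 1) k" unfolding row_column_shape_def by (rule cells_corner)
  show "(if card D = k then 1 else 0) + (if card (insert n D) = k then 1 else 0) = card {T \<in> SYT ?C. Des_SYT ?C T = D}"
    if D: "D \<subseteq> {1..n - 1}" for D
  proof -
    have "n \<notin> D" "finite D" using D n1 finite_subset by auto
    then have "card (insert n D) = Suc (card D)" by simp
    then show ?thesis using card_SYT_row_column[of "n - k + 1" k n D] C D k unfolding e by simp
  qed
qed (use k in auto)

lemma hook_shape:
  assumes "la \<in> partitions_of n" "n \<ge> 1" "(1, 1) \<notin> cells (la, [])"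
  shows "la = hd la # replicate (length la - 1) 1" "hd la \<ge> 1" "hd la + (length la - 1) = n"
proof -
  have p: "is_partition la" "sum_list la = n" using assms by (auto simp: partitions_of_def)
  then obtain h t where la: "la = h # t" using assms(2) by (cases la) auto
  have "x = 1" if x: "x \<in> set t" for x
  proof -
    obtain i where i: "i < length t" "x = t ! i" using x by (metis in_set_conv_nth)
    have "sorted_wrt (\<ge>) t" using p(1) unfolding la is_partition_def by simp
    then have "t ! i \<le> t ! 0" using i sorted_wrt_nth_less[of "(\<ge>)" t 0 i] by (cases i) auto
    moreover have "t ! 0 \<le> 1" using assms(3) i by (auto simp: la cells_straight)
    moreover have "x \<noteq> 0" using p(1) x unfolding la is_partition_def by (metis list.set_intros(2))
    ultimately show ?thesis using i by simp
  qed
  then have t: "t = replicate (length t) 1" by (metis replicate_length_same)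
  then show "la = hd la # replicate (length la - 1) 1" by (simp add: la)
  have "h \<noteq> 0" using p(1) by (auto simp: la is_partition_def)
  then show "hd la \<ge> 1" by (simp add: la)
  have "sum_list t = length t" by (subst t) (simp add: sum_list_replicate)
  then show "hd la + (length la - 1) = n" using p(2) by (simp add: la)
qed

lemma des_count_hook:
  assumes "la \<in> partitions_of n" "n \<ge> 1" "(1, 1) \<notin> cells (la, [])" "D \<subseteq> {1..n - 1}"
  shows "des_count la D = (if card D = length la - 1 then 1 else 0)"
proof -
  note h = hook_shape[OF assms(1,2,3)]
  have C: "cells (la, []) = corner 0 (hd la) (length la - 1)" by (subst h(1)) (rule cells_corner)
  have "convex_cells (cells (la, []))" using convex_cells_skew valid_skew_straight assms(1) by (auto simp: partitions_of_def)
  then show ?thesis unfolding des_count_def C using card_SYT_hook[of "hd la" "length la - 1" D] h assms(4) by simp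
qed

lemma nonhook_cells:
  assumes "la \<in> partitions_of n" "(1, 1) \<in> cells (la, [])"
  shows "(0, 0) \<in> cells (la, [])" "(0, 1) \<in> cells (la, [])" "(1, 0) \<in> cells (la, [])"
    "\<not> connected_ribbon (cells (la, []))"
proof -
  have p: "is_partition la" using assms by (auto simp: partitions_of_def)
  have "la ! 1 \<le> la ! 0" using p assms(2) by (auto simp: is_partition_def sorted_wrt_iff_nth_less cells_straight)
  then show c: "(0, 0) \<in> cells (la, [])" "(0, 1) \<in> cells (la, [])" "(1, 0) \<in> cells (la, [])"
    using assms(2) by (auto simp: cells_straight)
  have "\<exists>i j. (i, j) \<in> cells (la, []) \<and> (i, j+1) \<in> cells (la, []) \<and> (i+1, j) \<in> cells (la, []) \<and> (i+1, j+1) \<in> cells (la, [])"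
    using c assms(2) by (intro exI[of _ 0]) simp
  then show "\<not> connected_ribbon (cells (la, []))" unfolding connected_ribbon_def by blast
qed

text \<open>The interval \<open>{n - k + 1..n}\<close> is \<open>insert n D\<close> for an excluded
  descent set \<open>D\<close>, so both nonnegative summands of a zero count vanish. The case
  \<open>k = n\<close> is the full set, which a cyclic extension must avoid.\<close>

lemma nonhook_distribution:
  assumes "la \<in> partitions_of n" "n \<ge> 2" "(1, 1) \<in> cells (la, [])"
  shows "\<exists>m :: nat set \<Rightarrow> nat. (\<forall>J\<subseteq>{1..n}. m (cshift n J) = m J) \<and>
    (\<forall>D\<subseteq>{1..n - 1}. m D + m (insert n D) = des_count la D) \<and> m {} = 0 \<and>
    (\<forall>k. 1 \<le> k \<and> k \<le> n \<longrightarrow> m {n - k + 1..n} = 0)"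
proof -
  let ?C = "cells (la, [])"
  interpret convex_cells ?C using convex_cells_skew valid_skew_straight assms(1) by (auto simp: partitions_of_def)
  have card: "card ?C = n" using card_cells_straight assms(1) by (simp add: partitions_of_def)
  have hk: "Des_SYT ?C T \<noteq> {r..n - 1}" if "1 \<le> r" "r \<le> n" "T \<in> SYT ?C" for r T
    using no_hook_word[OF nonhook_cells(1)[OF assms(1,3)] assms(3) that(3,1)] that(2) card by simp
  obtain m :: "nat set \<Rightarrow> nat" where m: "\<And>J. J \<subseteq> {1..n} \<Longrightarrow> m (cshift n J) = m J"
    "\<And>D. D \<subseteq> {1..n - 1} \<Longrightarrow> m D + m (insert n D) = des_count la D"
    by (rule cyclic_distribution_exists[unfolded card, folded des_count_def, OF assms(2) hk]) blast+
  have z: "des_count la {r..n - 1} = 0" if "1 \<le> r" "r \<le> n" for r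
  proof -
    have "{T \<in> SYT ?C. Des_SYT ?C T = {r..n - 1}} = {}" using hk[OF that] by blast
    then show ?thesis unfolding des_count_def by (simp only: card.empty)
  qed
  have "m {} = 0" using m(2)[of "{}"] z[of n] assms(2) by simp
  moreover have "m {n - k + 1..n} = 0" if "1 \<le> k" "k \<le> n" for k
  proof -
    have "{n - k + 1..n} = insert n {n - k + 1..n - 1}" using that assms(2) by auto
    moreover have "{n - k + 1..n - 1} \<subseteq> {1..n - 1}" by auto
    ultimately show ?thesis using m(2)[of "{n - k + 1..n - 1}"] z[of "n - k + 1"] that by simp
  qed
  ultimately show ?thesis using m by blast
qed

text \<open>\<open>rec\<close> is the case \<open>j = n\<close>; rotating \<open>J\<close> moves any
  other \<open>j\<close> to \<open>n\<close> without changing the values of \<open>b\<close> or the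
  cardinality. Since any element may be removed, \<open>b J\<close> depends on \<open>card J\<close>
  only once \<open>b {}\<close> is known.\<close>

lemma shift_invariant_remove:
  fixes b :: "nat set \<Rightarrow> int"
  assumes n: "n \<ge> 1" and shift: "\<And>J. J \<subseteq> {1..n} \<Longrightarrow> b (cshift n J) = b J"
    and rec: "\<And>D. D \<subseteq> {1..n - 1} \<Longrightarrow> b D + b (insert n D) = H (card D)"
    and j: "j \<le> n" "1 \<le> j"
  shows "J \<subseteq> {1..n} \<Longrightarrow> j \<in> J \<Longrightarrow> b J + b (J - {j}) = H (card J - 1)"
  using j
proof (induction j arbitrary: J rule: inc_induct)
  case base
  have D: "J - {n} \<subseteq> {1..n - 1}"
  proof
    fix d assume "d \<in> J - {n}"
    then have "d \<in> {1..n}" "d \<noteq> n" using base by auto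
    then show "d \<in> {1..n - 1}" by auto
  qed
  have "insert n (J - {n}) = J" using base by blast
  moreover have "card (J - {n}) = card J - 1" using base finite_subset[of J "{1..n}"] by simp
  ultimately show ?case using rec[OF D] by (simp add: add.commute)
next
  case (step j)
  let ?K = "cshift n J"
  have inj: "inj_on (\<lambda>j. j mod n + 1) {1..n}" using next_bij[OF n] by (simp add: bij_betw_def)
  have nx: "j mod n + 1 = Suc j" using step.hyps by simp
  have K: "?K \<subseteq> {1..n}" using cshift_subset[OF n step.prems(1)] .
  have jK: "Suc j \<in> ?K" unfolding cshift_def using step.prems(2) nx by (metis imageI)
  have "cshift n (J - {j}) = ?K - cshift n {j}"
    unfolding cshift_def using inj step.prems by (intro inj_on_image_set_diff[OF inj]) auto
  then have rem: "cshift n (J - {j}) = ?K - {Suc j}" unfolding cshift_def[of n "{j}"] using nx by simp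
  have "card ?K = card J" unfolding cshift_def using inj step.prems(1) by (intro card_image) (rule inj_on_subset)
  moreover have "b ?K + b (?K - {Suc j}) = H (card ?K - 1)" using step.IH[OF K jK] by simp
  moreover have "b ?K = b J" "b (?K - {Suc j}) = b (J - {j})"
    using shift[OF step.prems(1)] shift[of "J - {j}"] step.prems(1) rem by auto
  ultimately show ?case by simp
qed

lemma sum_mset_replicate:
  fixes f :: "'b \<Rightarrow> nat"
  assumes "finite X"
  shows "(\<Sum>s\<in>#(\<Sum>x\<in>X. replicate_mset (c x) (g x)). f s) = (\<Sum>x\<in>X. c x * f (g x))"
  using assms by (induction X rule: finite_induct) simp_all

lemma in_sum_replicate:
  assumes "finite X" "s \<in># (\<Sum>x\<in>X. replicate_mset (c x) (g x))"
  shows "\<exists>x\<in>X. s = g x"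
  using assms by (induction X rule: finite_induct) (auto simp: in_replicate_mset split: if_splits)

lemma schur_positive_invariant_imp:
  assumes n: "n \<ge> 2" and A: "A \<subseteq> {\<pi>. \<pi> permutes {1..n}}"
    and sp: "schur_positive n A" and inv: "cDes_invariant n A"
  shows "cyclic_schur_positive n A"
proof -
  let ?N = "{1..n}"
  have fin: "finite A" using A finite_permutations[of ?N] finite_subset by auto
  have n1: "n \<ge> 1" using n by simp
  define a where "a J = card {\<pi> \<in> A. cDes_perm n \<pi> = J}" for J
  have a_shift: "a (cshift n J) = a J" if "J \<subseteq> ?N" for J
    using inv cDes_invariant_iff[OF fin n1] that unfolding a_def by blast
  have a_zero: "a {} = 0" "a ?N = 0"
  proof -
    have "{\<pi> \<in> A. cDes_perm n \<pi> = {}} = {}" "{\<pi> \<in> A. cDes_perm n \<pi> = ?N} = {}"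
      using cDes_perm_proper[OF n] A by blast+
    then show "a {} = 0" "a ?N = 0" unfolding a_def by (simp_all only: card.empty)
  qed
  obtain c where c: "\<And>D. D \<subseteq> {1..n - 1} \<Longrightarrow> card {\<pi> \<in> A. Des_perm n \<pi> = D} = (\<Sum>la\<in>partitions_of n. c la * des_count la D)"
    using schur_positive_nat_coeffs[OF fin sp] by blast
  define NH where "NH = {la \<in> partitions_of n. (1, 1) \<in> cells (la, [])}"
  define HK where "HK = {la \<in> partitions_of n. (1, 1) \<notin> cells (la, [])}"
  have finNH: "finite NH" "finite HK" using finite_partitions_of by (simp_all add: NH_def HK_def)
  have "\<forall>la\<in>NH. \<exists>m :: nat set \<Rightarrow> nat. (\<forall>J\<subseteq>{1..n}. m (cshift n J) = m J) \<and>
    (\<forall>D\<subseteq>{1..n - 1}. m D + m (insert n D) = des_count la D) \<and> m {} = 0 \<and>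
    (\<forall>k. 1 \<le> k \<and> k \<le> n \<longrightarrow> m {n - k + 1..n} = 0)"
    using nonhook_distribution n unfolding NH_def by blast
  then obtain m :: "nat list \<Rightarrow> nat set \<Rightarrow> nat" where m: "\<forall>la\<in>NH. (\<forall>J\<subseteq>{1..n}. m la (cshift n J) = m la J) \<and>
    (\<forall>D\<subseteq>{1..n - 1}. m la D + m la (insert n D) = des_count la D) \<and> m la {} = 0 \<and>
    (\<forall>k. 1 \<le> k \<and> k \<le> n \<longrightarrow> m la {n - k + 1..n} = 0)"
    by (rule bchoice[THEN exE])
  define q where "q J = (\<Sum>la\<in>NH. c la * m la J)" for J
  define b where "b J = int (a J) - int (q J)" for J
  \<comment> \<open>The multiplicity of the hook with leg length \<open>k\<close>; written as a sum
    over \<open>HK\<close> it is 0 when no such hook exists.\<close>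
  define H where "H k = int (\<Sum>la\<in>HK. if k = length la - 1 then c la else 0)" for k
  have b_shift: "b (cshift n J) = b J" if "J \<subseteq> ?N" for J
    unfolding b_def q_def using a_shift[OF that] m that by simp
  have b_rec: "b D + b (insert n D) = H (card D)" if D: "D \<subseteq> {1..n - 1}" for D
  proof -
    have "a D + a (insert n D) = (\<Sum>la\<in>partitions_of n. c la * des_count la D)"
      using card_Des_perm_split[OF fin n1 D] c[OF D] unfolding a_def by simp
    also have "partitions_of n = NH \<union> HK" by (auto simp: NH_def HK_def)
    also have "(\<Sum>la\<in>NH \<union> HK. c la * des_count la D) = (\<Sum>la\<in>NH. c la * des_count la D) + (\<Sum>la\<in>HK. c la * des_count la D)"
      using finNH by (intro sum.union_disjoint) (auto simp: NH_def HK_def)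
    also have "(\<Sum>la\<in>NH. c la * des_count la D) = q D + q (insert n D)"
    proof -
      have "c la * des_count la D = c la * m la D + c la * m la (insert n D)" if "la \<in> NH" for la
        using m that D by (metis distrib_left)
      then show ?thesis unfolding q_def by (simp add: sum.distrib)
    qed
    also have "(\<Sum>la\<in>HK. c la * des_count la D) = (\<Sum>la\<in>HK. if card D = length la - 1 then c la else 0)"
      using des_count_hook[OF _ n1 _ D] by (intro sum.cong) (auto simp: HK_def)
    finally show ?thesis unfolding b_def H_def by linarith
  qed
  \<comment> \<open>The recursion of \<open>shift_invariant_remove\<close> with starting value
    \<open>b {} = 0\<close>; a priori its values are alternating sums of the
    \<open>H k\<close>.\<close>
  define \<beta> where "\<beta> = rec_nat 0 (\<lambda>k x. H k - x)"
  have \<beta>: "\<beta> 0 = 0" "\<beta> (Suc k) = H k - \<beta> k" for k by (simp_all add: \<beta>_def)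
  have b_empty: "b {} = 0"
    unfolding b_def q_def using a_zero m by simp
  have b_card: "b J = \<beta> (card J)" if J: "J \<subseteq> ?N" for J
  proof -
    have "finite J" using J finite_subset by blast
    then show ?thesis using J
    proof (induction J rule: finite_induct)
      case empty
      then show ?case using b_empty \<beta> by simp
    next
      case (insert j J)
      have j: "j \<le> n" "1 \<le> j" using insert.prems by auto
      have "b (insert j J) + b (insert j J - {j}) = H (card (insert j J) - 1)"
        using shift_invariant_remove[OF n1 b_shift b_rec j insert.prems] by blast
      then have "b (insert j J) + b J = H (card J)" using insert.hyps by simp
      then show ?case using insert \<beta>(2)[of "card J"] by simp
    qed
  qed
  \<comment> \<open>As \<open>b\<close> depends on the size only, it may be evaluated on an interval
    where every non-hook distribution vanishes; there it equals the count \<open>a\<close>.\<close>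
  have \<beta>_nonneg: "\<beta> k \<ge> 0" if "k \<le> n" for k
  proof (cases "k = 0")
    case False
    then have k: "1 \<le> k" "k \<le> n" using that by auto
    have "q {n - k + 1..n} = 0" unfolding q_def using m k by simp
    moreover have "card {n - k + 1..n} = k" using k by simp
    moreover have "{n - k + 1..n} \<subseteq> ?N" by auto
    ultimately have "\<beta> k = int (a {n - k + 1..n})" using b_card[of "{n - k + 1..n}"] unfolding b_def by simp
    then show ?thesis by simp
  qed (use \<beta> in simp)
  have q_N: "q ?N = 0"
  proof -
    have "{n - n + 1..n} = ?N" by simp
    moreover have "m la {n - n + 1..n} = 0" if "la \<in> NH" for la using m that n1 by blast
    ultimately show ?thesis unfolding q_def by simp
  qed
  \<comment> \<open>This excludes \<open>k = n\<close>, where the shape would be a single column and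
    hence a connected ribbon. Together with \<open>\<beta> 0 = 0\<close> it leaves the sizes in
    \<open>{1..<n}\<close>.\<close>
  have \<beta>_n: "\<beta> n = 0" using b_card[of ?N] a_zero q_N unfolding b_def by simp
  have main: "a J = q J + nat (\<beta> (card J))" if J: "J \<subseteq> ?N" for J
  proof -
    have "card J \<le> n" using card_mono[OF _ J] by simp
    then show ?thesis using b_card[OF J] \<beta>_nonneg[of "card J"] unfolding b_def by linarith
  qed
  define S1 where "S1 = (\<Sum>la\<in>NH. replicate_mset (c la) (la, [] :: nat list))"
  define S2 where "S2 = (\<Sum>k\<in>{1..<n}. replicate_mset (nat (\<beta> k)) (row_column_shape n k))"
  \<comment> \<open>An empty inner partition tells the straight shapes from the row-column ones, and
    for the latter \<open>length (fst s) - 1\<close> recovers \<open>k\<close>. The distribution has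
    to be a function of the shape, because \<open>cD\<close> is chosen per shape and not per
    occurrence in the multiset.\<close>
  define M :: "nat list \<times> nat list \<Rightarrow> nat set \<Rightarrow> nat" where
    "M s = (if snd s = [] then m (fst s) else (\<lambda>J. if card J = length (fst s) - 1 then 1 else 0))" for s
  have M1: "M (la, []) = m la" for la by (simp add: M_def)
  have M2: "M (row_column_shape n k) = (\<lambda>J. if card J = k then 1 else 0)" for k
    by (simp add: M_def row_column_shape_def)
  have good: "valid_skew s \<and> card (cells s) = n \<and> \<not> connected_ribbon (cells s) \<and>
    (\<exists>cD \<psi>. cyclic_descent_ext (cells s) cD \<psi> \<and>
      (\<forall>J. card {T \<in> SYT (cells s). cD T = J} = (if J \<subseteq> {1..n} then M s J else 0)))"
    if s: "s \<in># S1 + S2" for s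
  proof -
    consider (1) la where "la \<in> NH" "s = (la, [])" | (2) k where "k \<in> {1..<n}" "s = row_column_shape n k"
    proof -
      have "s \<in># S1 \<or> s \<in># S2" using s by simp
      then show thesis using that in_sum_replicate[OF finNH(1), of s c "\<lambda>la. (la, [])"]
          in_sum_replicate[of "{1..<n}" s "\<lambda>k. nat (\<beta> k)" "row_column_shape n"]
        unfolding S1_def S2_def by blast
    qed
    then show ?thesis
    proof cases
      case 1
      then have la: "la \<in> partitions_of n" "(1, 1) \<in> cells (la, [])" by (auto simp: NH_def)
      have v: "valid_skew (la, [])" using la(1) by (simp add: partitions_of_def valid_skew_straight)
      have cc: "card (cells (la, [])) = n" using la(1) card_cells_straight by (simp add: partitions_of_def)
      have mm: "\<And>J. J \<subseteq> {1..n} \<Longrightarrow> m la (cshift n J) = m la J" "m la {} = 0"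
        "\<And>D. D \<subseteq> {1..n - 1} \<Longrightarrow> m la D + m la (insert n D) = card {T \<in> SYT (cells (la, [])). Des_SYT (cells (la, [])) T = D}"
        using m 1(1) unfolding des_count_def by blast+
      have "{n - n + 1..n} = ?N" by simp
      then have mn: "m la ?N = 0" using m[rule_format, OF 1(1)] n1 by (metis order_refl)
      have "\<exists>cD \<psi>. cyclic_descent_ext (cells (la, [])) cD \<psi> \<and>
        (\<forall>J. card {T \<in> SYT (cells (la, [])). cD T = J} = (if J \<subseteq> {1..n} then m la J else 0))"
        by (rule cyclic_descent_ext_exists[OF convex_cells_skew[OF v] cc n1 mm(1) mm(3) mm(2) mn])
      then show ?thesis using v cc nonhook_cells(4)[OF la] unfolding 1(2) M1 by blast
    next
      case 2
      then have k: "1 \<le> k" "k < n" by auto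
      show ?thesis unfolding 2(2) M2 using row_column_shape[OF k] row_column_ext[OF k] by blast
    qed
  qed
  obtain cD \<psi> where ext: "\<And>s. s \<in># S1 + S2 \<Longrightarrow> cyclic_descent_ext (cells s) (cD s) (\<psi> s)"
    and cnt: "\<And>s J. s \<in># S1 + S2 \<Longrightarrow> card {T \<in> SYT (cells s). cD s T = J} = (if J \<subseteq> {1..n} then M s J else 0)"
  proof -
    let ?P = "\<lambda>s cD \<psi>. cyclic_descent_ext (cells s) cD \<psi> \<and>
      (\<forall>J. card {T \<in> SYT (cells s). cD T = J} = (if J \<subseteq> {1..n} then M s J else 0))"
    have "\<forall>s\<in>set_mset (S1 + S2). \<exists>cD \<psi>. ?P s cD \<psi>" using good by blast
    from bchoice[OF this] obtain cD where "\<forall>s\<in>set_mset (S1 + S2). \<exists>\<psi>. ?P s (cD s) \<psi>" by (elim exE)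
    from bchoice[OF this] obtain \<psi> where "\<forall>s\<in>set_mset (S1 + S2). ?P s (cD s) (\<psi> s)" by (elim exE)
    then show thesis by (intro that) blast+
  qed
  have "card {\<pi>\<in>A. cDes_perm n \<pi> = J} = (\<Sum>s\<in>#S1 + S2. card {T\<in>SYT (cells s). cD s T = J})" for J
  proof -
    have "(\<Sum>s\<in>#S1 + S2. card {T\<in>SYT (cells s). cD s T = J}) = (\<Sum>s\<in>#S1 + S2. if J \<subseteq> {1..n} then M s J else 0)"
      using cnt by (intro arg_cong[of _ _ sum_mset] image_mset_cong)
    also have "\<dots> = (if J \<subseteq> {1..n} then a J else 0)"
    proof (cases "J \<subseteq> {1..n}")
      case True
      have "(\<Sum>s\<in>#S1 + S2. M s J) = (\<Sum>s\<in>#S1. M s J) + (\<Sum>s\<in>#S2. M s J)" by simp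
      also have "(\<Sum>s\<in>#S1. M s J) = q J"
        unfolding S1_def sum_mset_replicate[OF finNH(1)] M1 q_def ..
      also have "(\<Sum>s\<in>#S2. M s J) = (\<Sum>k\<in>{1..<n}. nat (\<beta> k) * (if card J = k then 1 else 0))"
        unfolding S2_def by (subst sum_mset_replicate) (simp_all add: M2)
      also have "\<dots> = (\<Sum>k\<in>{1..<n}. if k = card J then nat (\<beta> (card J)) else 0)" by (intro sum.cong) auto
      also have "\<dots> = nat (\<beta> (card J))"
      proof -
        have le: "card J \<le> n" using card_mono[OF _ True] by simp
        have "card J = 0 \<or> card J = n \<Longrightarrow> \<beta> (card J) = 0" using \<beta>(1) \<beta>_n by auto
        then show ?thesis using le by (cases "card J \<in> {1..<n}") auto
      qed
      finally show ?thesis using main[OF True] True by simp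
    next
      case False
      then show ?thesis by simp
    qed
    also have "\<dots> = a J"
    proof (cases "J \<subseteq> {1..n}")
      case False
      then have "{\<pi> \<in> A. cDes_perm n \<pi> = J} = {}" using cDes_perm_subset by blast
      then have "a J = 0" unfolding a_def by (simp only: card.empty)
      then show ?thesis using False by simp
    qed simp
    finally show ?thesis unfolding a_def by simp
  qed
  then show ?thesis unfolding cyclic_schur_positive_def using good ext by blast
qed

theorem theorem3p4:
  fixes n :: nat and A :: "(nat \<Rightarrow> nat) set"
  assumes "n \<ge> 2"
    and "A \<subseteq> {\<pi>. \<pi> permutes {1..n}}"
  shows "cyclic_schur_positive n A \<longleftrightarrow> schur_positive n A \<and> cDes_invariant n A"
  using cyclic_schur_positive_imp schur_positive_invariant_imp assms by blast

end
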